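(* Let $\varepsilon_j>0$ with $\varepsilon_j\to0$. For any $(\theta,g)\in L^1(I)\times L^2(I)$ there exists a sequence $(\theta_j,g_j)\in\mathcal Y_C$, converging to $(\theta,g)$ in $L^1(I)\times L^2(I)$ as $j\to\infty$, and such that $$\limsup_{j\to\infty}G^C_{\varepsilon_j}(\theta_j,g_j)\ \le\ G^C_0(\theta,g).$$
   Context: Fix constants $\sigma>0$, $D_1>0$, $D_2>0$, $l>0$ and let $I=(-l,l)$. Let $$W(\theta)=8D_2\sin^8\tfrac\theta2+4(1+\sigma)\sin^4\tfrac\theta2-4\sigma\sin^2\tfrac\theta2+a_0,$$ where the constant $a_0$ is chosen so that $\min W=0$. On $[-\pi,\pi]$, $W$ has exactly two zeros $\pm\beta$, with $0<\beta<\pi/2$. Let $\Phi(s)=2\int_{-\beta}^s\sqrt{W(t)}\,dt$. For $\varepsilon>0$ let $$F^C_\varepsilon(\theta,g)=\int_I\Big[D_1\varepsilon(g''+\cos\theta\,\theta')^2+\frac{D_2}{2\varepsilon}(g'+\sin\theta)^4+\frac1\varepsilon(g'+\sin\theta)^2+\frac{4D_2}{\varepsilon}(g'+\sin\theta)^2\sin^4\tfrac\theta2+\varepsilon\theta'^2+\frac1\varepsilon W(\theta)\Big]dx .$$ Let $$\mathcal Y_C=\{(\theta,g)\in W^{1,2}(I)\times W^{2,2}(I):\ \theta(-l)=\theta(l),\ g(-l)=g(l),\ g'(-l)=g'(l)\},$$ $$\mathcal A_C=\Big\{(\theta,g)\in BV(I;\{\pm\beta\})\times W^{1,2}(I):\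 g'\in BV(I),\ g'+\sin\theta=0\text{ a.e.},\ \int_I\theta=0\Big\}.$$ Define $G^C_\varepsilon(\theta,g)=F^C_\varepsilon(\theta,g)$ if $(\theta,g)\in\mathcal Y_C$ and $+\infty$ otherwise; and $$G^C_0(\theta,g)=\int_I|(\Phi\circ\theta)'|+|\Phi(\tilde\theta(l))-\Phi(\tilde\theta(-l))|$$ if $(\theta,g)\in\mathcal A_C$ and $+\infty$ otherwise, where $\int_I|(\Phi\circ\theta)'|$ is the total variation of $\Phi\circ\theta$ on $I$ and $\tilde\theta(\pm l)$ are the (one-sided, from inside $I$) traces of $\theta$ at $\pm l$. *)

theory Defs
  imports "HOL-Analysis.Analysis"
begin

text \<open>Elements of the function spaces are functions on the whole real line of which only the
  restriction to the open interval, modulo null sets, matters; every notion below is invariant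
  under changes on null sets and outside the interval.\<close>

abbreviation leb_I :: "real \<Rightarrow> real measure"
  where "leb_I l \<equiv> lebesgue_on {-l<..<l}"

definition L1 :: "real \<Rightarrow> (real \<Rightarrow> real) set"
  where "L1 l = {u. integrable (leb_I l) u}"

definition L2 :: "real \<Rightarrow> (real \<Rightarrow> real) set"
  where "L2 l = {u \<in> borel_measurable (leb_I l). integrable (leb_I l) (\<lambda>x. (u x)^2)}"

definition norm_L1 :: "real \<Rightarrow> (real \<Rightarrow> real) \<Rightarrow> real"
  where "norm_L1 l u = (\<integral>x. \<bar>u x\<bar> \<partial>leb_I l)"

definition norm_L2 :: "real \<Rightarrow> (real \<Rightarrow> real) \<Rightarrow> real"
  where "norm_L2 l u = sqrt (\<integral>x. (u x)^2 \<partial>leb_I l)"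

definition Cc1 :: "real \<Rightarrow> (real \<Rightarrow> real) set"
  where "Cc1 l = {\<phi>. \<phi> C1_differentiable_on UNIV
           \<and> compact (closure {x. \<phi> x \<noteq> 0}) \<and> closure {x. \<phi> x \<noteq> 0} \<subseteq> {-l<..<l}}"

definition has_weak_deriv :: "real \<Rightarrow> (real \<Rightarrow> real) \<Rightarrow> (real \<Rightarrow> real) \<Rightarrow> bool"
  where "has_weak_deriv l u v \<longleftrightarrow>
    (\<forall>\<phi>\<in>Cc1 l. (\<integral>x. u x * deriv \<phi> x \<partial>leb_I l) = - (\<integral>x. v x * \<phi> x \<partial>leb_I l))"

definition W12 :: "real \<Rightarrow> (real \<Rightarrow> real) set"
  where "W12 l = {u \<in> L2 l. \<exists>v\<in>L2 l. has_weak_deriv l u v}"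

text \<open>The weak derivative of an element of \<open>W12 l\<close>: some representative of its a.e. class.\<close>

definition weak_deriv :: "real \<Rightarrow> (real \<Rightarrow> real) \<Rightarrow> (real \<Rightarrow> real)"
  where "weak_deriv l u = (SOME v. v \<in> L2 l \<and> has_weak_deriv l u v)"

definition W22 :: "real \<Rightarrow> (real \<Rightarrow> real) set"
  where "W22 l = {u \<in> W12 l. weak_deriv l u \<in> W12 l}"

text \<open>The representative of an element of \<open>W12 l\<close> that is continuous on the closed interval;
  point values of Sobolev functions at the end points refer to it.\<close>

definition cont_rep :: "real \<Rightarrow> (real \<Rightarrow> real) \<Rightarrow> (real \<Rightarrow> real)"
  where "cont_rep l u =
    (SOME w. continuous_on {-l..l} w \<and> (AE x in leb_I l. w x = u x))"

text \<open>Total variation of the distributional derivative. The supremum is nonnegative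
  (take the zero test function), so truncation by \<open>ennreal\<close> is harmless.\<close>

definition total_variation :: "real \<Rightarrow> (real \<Rightarrow> real) \<Rightarrow> ennreal"
  where "total_variation l u =
    (SUP \<phi> \<in> {\<phi> \<in> Cc1 l. \<forall>x. \<bar>\<phi> x\<bar> \<le> 1}. ennreal (\<integral>x. u x * deriv \<phi> x \<partial>leb_I l))"

definition BV :: "real \<Rightarrow> (real \<Rightarrow> real) set"
  where "BV l = {u \<in> L1 l. total_variation l u < \<infinity>}"

text \<open>Traces of BV functions at the end points, from inside the interval, characterised by
  vanishing one-sided mean deviation.\<close>

definition trace_left :: "real \<Rightarrow> (real \<Rightarrow> real) \<Rightarrow> real"
  where "trace_left l u = (THE t.
    ((\<lambda>r. (\<integral>x. \<bar>u x - t\<bar> \<partial>lebesgue_on {-l<..<-l+r}) / r) \<longlongrightarrow> 0) (at_right 0))"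

definition trace_right :: "real \<Rightarrow> (real \<Rightarrow> real) \<Rightarrow> real"
  where "trace_right l u = (THE t.
    ((\<lambda>r. (\<integral>x. \<bar>u x - t\<bar> \<partial>lebesgue_on {l-r<..<l}) / r) \<longlongrightarrow> 0) (at_right 0))"

definition W_unnorm :: "real \<Rightarrow> real \<Rightarrow> real \<Rightarrow> real"
  where "W_unnorm \<sigma> D2 t =
    8 * D2 * sin (t/2)^8 + 4 * (1 + \<sigma>) * sin (t/2)^4 - 4 * \<sigma> * sin (t/2)^2"

definition a0 :: "real \<Rightarrow> real \<Rightarrow> real"
  where "a0 \<sigma> D2 = - (INF t. W_unnorm \<sigma> D2 t)"

definition W :: "real \<Rightarrow> real \<Rightarrow> real \<Rightarrow> real"
  where "W \<sigma> D2 t = W_unnorm \<sigma> D2 t + a0 \<sigma> D2"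

text \<open>That \<open>W\<close> attains the minimum 0 and that \<open>beta\<close> is well defined is proved below
  (\<open>W_nonneg\<close>, \<open>beta_props\<close>).\<close>

definition beta :: "real \<Rightarrow> real \<Rightarrow> real"
  where "beta \<sigma> D2 =
    (THE b. 0 < b \<and> b < pi/2 \<and> {t \<in> {-pi..pi}. W \<sigma> D2 t = 0} = {-b, b})"

lemma W_unnorm_minimum:
  assumes "\<sigma> > 0" "D2 > 0"
  obtains b where "0 < b" "b < pi/2"
    "\<And>t. W_unnorm \<sigma> D2 b \<le> W_unnorm \<sigma> D2 t"
    "{t \<in> {-pi..pi}. W_unnorm \<sigma> D2 t = W_unnorm \<sigma> D2 b} = {-b, b}"
proof -
  define p where "p s = 8 * D2 * s^4 + 4 * (1 + \<sigma>) * s^2 - 4 * \<sigma> * s" for s :: real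
  define q where "q s = 32 * D2 * s^3 + 8 * (1 + \<sigma>) * s - 4 * \<sigma>" for s :: real
  have "\<exists>s. 0 \<le> s \<and> s \<le> 1/2 \<and> q s = 0"
    by (rule IVT') (use assms in \<open>auto simp: q_def power3_eq_cube field_simps intro!: continuous_intros\<close>)
  then obtain c where c: "0 \<le> c" "c \<le> 1/2" "q c = 0" by blast
  have "q 0 < 0" "q (1/2) > 0"
    using assms by (auto simp: q_def power3_eq_cube field_simps)
  with c(3) have "c \<noteq> 0" "c \<noteq> 1/2" by (metis less_irrefl)+
  with c have c': "0 < c" "c < 1/2" by auto
  have pdiff: "p s - p c = (s - c)^2 * (8 * D2 * ((s + c)^2 + 2 * c^2) + 4 * (1 + \<sigma>))" for s
  proof -
    have "p s - p c - q c * (s - c)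
        = (s - c)^2 * (8 * D2 * ((s + c)^2 + 2 * c^2) + 4 * (1 + \<sigma>))"
      unfolding p_def q_def by algebra
    with c(3) show ?thesis by simp
  qed
  have pos: "8 * D2 * ((s + c)^2 + 2 * c^2) + 4 * (1 + \<sigma>) > 0" for s
    by (rule add_nonneg_pos) (use assms in \<open>auto intro!: mult_nonneg_nonneg add_nonneg_nonneg\<close>)
  have ge: "p c \<le> p s" for s
    using pdiff[of s] pos[of s] by (smt (verit) mult_nonneg_nonneg zero_le_power2)
  have eq: "p s = p c \<longleftrightarrow> s = c" for s
    using pdiff[of s] pos[of s] by auto
  have Wp: "W_unnorm \<sigma> D2 t = p ((1 - cos t) / 2)" for t
  proof -
    have "cos t = 1 - 2 * sin (t/2)^2"
      using cos_double_sin[of "t/2"] by simp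
    then have "(1 - cos t) / 2 = sin (t/2)^2" by simp
    then show ?thesis by (simp add: W_unnorm_def p_def)
  qed
  define b where "b = arccos (1 - 2 * c)"
  have cosb: "cos b = 1 - 2 * c" using c' by (simp add: b_def)
  have b0: "0 < b" using c' arccos_less_arccos[of "1 - 2 * c" 1] by (simp add: b_def)
  have b1: "b < pi/2" using c' arccos_less_arccos[of 0 "1 - 2 * c"] by (simp add: b_def)
  have Wb: "W_unnorm \<sigma> D2 b = p c" by (simp add: Wp cosb)
  have "W_unnorm \<sigma> D2 t = W_unnorm \<sigma> D2 b \<longleftrightarrow> cos t = cos b" for t
    unfolding Wb cosb using eq[of "(1 - cos t) / 2"] by (simp add: Wp) argo
  moreover have "cos t = cos b \<longleftrightarrow> t = b \<or> t = -b" if "t \<in> {-pi..pi}" for t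
  proof -
    have "cos \<bar>t\<bar> = cos b \<longleftrightarrow> \<bar>t\<bar> = b"
      using that b0 b1 cos_inj_pi[of "\<bar>t\<bar>" b] by auto
    moreover have "cos \<bar>t\<bar> = cos t" by (simp add: abs_if)
    ultimately show ?thesis using b0 by auto
  qed
  ultimately have "{t \<in> {-pi..pi}. W_unnorm \<sigma> D2 t = W_unnorm \<sigma> D2 b} = {-b, b}"
    using b0 b1 by auto
  moreover have "W_unnorm \<sigma> D2 b \<le> W_unnorm \<sigma> D2 t" for t
    unfolding Wb unfolding Wp by (rule ge)
  ultimately show ?thesis using that b0 b1 by blast
qed

lemma
  assumes "\<sigma> > 0" "D2 > 0"
  shows W_nonneg: "W \<sigma> D2 t \<ge> 0"
    and beta_props: "0 < beta \<sigma> D2" "beta \<sigma> D2 < pi/2"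
      "{t \<in> {-pi..pi}. W \<sigma> D2 t = 0} = {- beta \<sigma> D2, beta \<sigma> D2}"
proof -
  obtain b where b: "0 < b" "b < pi/2"
    "\<And>t. W_unnorm \<sigma> D2 b \<le> W_unnorm \<sigma> D2 t"
    "{t \<in> {-pi..pi}. W_unnorm \<sigma> D2 t = W_unnorm \<sigma> D2 b} = {-b, b}"
    using W_unnorm_minimum[OF assms] by blast
  have "(INF t. W_unnorm \<sigma> D2 t) = W_unnorm \<sigma> D2 b"
    by (rule cInf_eq_minimum) (use b(3) in auto)
  then have W: "W \<sigma> D2 t = W_unnorm \<sigma> D2 t - W_unnorm \<sigma> D2 b" for t
    by (simp add: W_def a0_def)
  show "W \<sigma> D2 t \<ge> 0" using b(3) by (simp add: W)
  let ?P = "\<lambda>b. 0 < b \<and> b < pi/2 \<and> {t \<in> {-pi..pi}. W \<sigma> D2 t = 0} = {-b, b}"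
  have "?P b" using b by (simp add: W)
  moreover have "b' = b" if "?P b'" for b'
  proof -
    have "{-b', b'} = {-b, b}" using that \<open>?P b\<close> by metis
    then show ?thesis using that b(1) by (auto simp: doubleton_eq_iff)
  qed
  ultimately have "?P (beta \<sigma> D2)"
    unfolding beta_def by (rule theI)
  then show "0 < beta \<sigma> D2" "beta \<sigma> D2 < pi/2"
      "{t \<in> {-pi..pi}. W \<sigma> D2 t = 0} = {- beta \<sigma> D2, beta \<sigma> D2}" by blast+
qed

definition Phi :: "real \<Rightarrow> real \<Rightarrow> real \<Rightarrow> real"
  where "Phi \<sigma> D2 s = 2 * (LBINT t=-beta \<sigma> D2..s. sqrt (W \<sigma> D2 t))"

text \<open>The integrand is nonnegative by \<open>W_nonneg\<close>.\<close>

definition F_C :: "real \<Rightarrow> real \<Rightarrow> real \<Rightarrow> real \<Rightarrow> real \<Rightarrow> (real \<Rightarrow> real) \<Rightarrow> (real \<Rightarrow> real) \<Rightarrow> ennreal"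
  where "F_C \<sigma> D1 D2 l \<epsilon> \<theta> g =
    (let \<theta>' = weak_deriv l \<theta>; g' = weak_deriv l g; g'' = weak_deriv l g' in
      \<integral>\<^sup>+x. ennreal (
          D1 * \<epsilon> * (g'' x + cos (\<theta> x) * \<theta>' x)^2
        + D2 / (2 * \<epsilon>) * (g' x + sin (\<theta> x))^4
        + 1 / \<epsilon> * (g' x + sin (\<theta> x))^2
        + 4 * D2 / \<epsilon> * (g' x + sin (\<theta> x))^2 * sin (\<theta> x / 2)^4
        + \<epsilon> * (\<theta>' x)^2
        + 1 / \<epsilon> * W \<sigma> D2 (\<theta> x)) \<partial>leb_I l)"

definition Y_C :: "real \<Rightarrow> ((real \<Rightarrow> real) \<times> (real \<Rightarrow> real)) set"
  where "Y_C l = {(\<theta>, g). \<theta> \<in> W12 l \<and> g \<in> W22 l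
    \<and> cont_rep l \<theta> (-l) = cont_rep l \<theta> l
    \<and> cont_rep l g (-l) = cont_rep l g l
    \<and> cont_rep l (weak_deriv l g) (-l) = cont_rep l (weak_deriv l g) l}"

definition A_C :: "real \<Rightarrow> real \<Rightarrow> real \<Rightarrow> ((real \<Rightarrow> real) \<times> (real \<Rightarrow> real)) set"
  where "A_C \<sigma> D2 l = {(\<theta>, g).
      \<theta> \<in> BV l \<and> (AE x in leb_I l. \<theta> x \<in> {- beta \<sigma> D2, beta \<sigma> D2})
    \<and> g \<in> W12 l \<and> weak_deriv l g \<in> BV l
    \<and> (AE x in leb_I l. weak_deriv l g x + sin (\<theta> x) = 0)
    \<and> (\<integral>x. \<theta> x \<partial>leb_I l) = 0}"

definition G_C :: "real \<Rightarrow> real \<Rightarrow> real \<Rightarrow> real \<Rightarrow> real \<Rightarrow> (real \<Rightarrow> real) \<Rightarrow> (real \<Rightarrow> real) \<Rightarrow> ennreal"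
  where "G_C \<sigma> D1 D2 l \<epsilon> \<theta> g =
    (if (\<theta>, g) \<in> Y_C l then F_C \<sigma> D1 D2 l \<epsilon> \<theta> g else \<infinity>)"

definition G0_C :: "real \<Rightarrow> real \<Rightarrow> real \<Rightarrow> (real \<Rightarrow> real) \<Rightarrow> (real \<Rightarrow> real) \<Rightarrow> ennreal"
  where "G0_C \<sigma> D2 l \<theta> g =
    (if (\<theta>, g) \<in> A_C \<sigma> D2 l
     then total_variation l (Phi \<sigma> D2 \<circ> \<theta>)
        + ennreal \<bar>Phi \<sigma> D2 (trace_right l \<theta>) - Phi \<sigma> D2 (trace_left l \<theta>)\<bar>
     else \<infinity>)"

end

theory Submission imports Defs begin

text \<open>If the limit energy is infinite, density of polynomials that vanish to second order at
  \<open>\<plusminus>l\<close> suffices. Otherwise \<open>\<Phi> \<circ> \<theta>\<close> is a two-valued function of finite total variation. Testing with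
  primitives of differences of concentrated bumps shows that every point where \<open>\<theta>\<close> is not locally
  constant costs \<open>\<Phi> \<beta>\<close>; hence there are finitely many such points and \<open>\<theta>\<close> is a step function. If
  their number is odd, the boundary term pays for one more jump, placed at \<open>l\<close>, so that the number of
  jumps becomes even and \<open>\<theta>\<close> becomes periodic.

  With \<open>\<epsilon> = r\<^sup>4\<close>, each jump at \<open>t\<close> is replaced by the solution of
  \<open>\<epsilon> q' = sqrt (W q + r\<^sup>2)\<close> on \<open>[t - \<delta>, t]\<close>. The regularisation by \<open>r\<^sup>2\<close> makes the
  transition from \<open>-\<beta>\<close> to \<open>\<beta>\<close> take finite length \<open>\<delta> \<le> 2\<beta>r\<^sup>3\<close>, at energy at most
  \<open>\<Phi> \<beta> + 4\<beta>r\<close>. For \<open>g\<close> one takes a primitive of \<open>m - sin \<theta>\<close> with the constant \<open>m\<close>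
  that makes it periodic. Then the first term of the energy vanishes. As \<open>\<integral> \<theta> = 0\<close> forces
  \<open>\<integral> sin \<theta> = 0\<close> for the step function, \<open>m = O(r\<^sup>3)\<close>, and the terms of order
  \<open>m\<^sup>2 / \<epsilon> = O(r\<^sup>2)\<close> vanish in the limit.\<close>

section \<open>Polynomials vanishing to second order at the end points are dense\<close>

text \<open>Without regularisation the layer would have infinite length: \<open>W\<close> vanishes
  quadratically at \<plusminus>\<beta>, so a solution of \<open>\<epsilon> q' = sqrt (W q)\<close>
  never reaches the wells. Adding \<open>\<rho>^2\<close> to \<open>W\<close> costs at most
  \<open>4 * \<beta> * \<rho>\<close> per layer and gives length at most
  \<open>2 * \<beta> * \<epsilon> / \<rho>\<close>. The mean \<open>m\<close> is of the order of
  this length, and \<open>m^2 / \<epsilon>\<close> must vanish as well; hence \<open>\<rho>\<close>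
  has to lie strictly between the orders \<open>sqrt \<epsilon>\<close> and 1, and
  \<open>\<rho> = r\<close> with \<open>\<epsilon> = r^4\<close> is the choice in the middle.

  Each layer lies to the left of its jump, so that a jump placed at \<open>l\<close> has its whole
  layer inside the interval and \<open>f l\<close> is already the final value.

  Weak derivatives and continuous representatives are picked by a choice operator. The energy of an
  explicit pair can be evaluated only after they are identified, almost everywhere and at the end
  points respectively; this is what the fundamental lemma is for. The double zeros of the dense
  polynomials serve twice: they give periodicity of \<open>g\<close> and \<open>g'\<close>, and they
  turn zero extensions into C1 test functions.\<close>

lemma finite_measure_interval: "finite_measure (lebesgue_on {a<..<b::real})"
  by (intro finite_measure_lebesgue_on) auto

lemma integrable_bounded_interval:
  fixes f :: "real \<Rightarrow> real"
  assumes "f \<in> borel_measurable (lebesgue_on {a<..<b})"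
    and "AE x in lebesgue_on {a<..<b}. \<bar>f x\<bar> \<le> B"
  shows "integrable (lebesgue_on {a<..<b}) f"
  using assms by (intro finite_measure.integrable_const_bound[OF finite_measure_interval]) auto

lemma space_interval_AE: "AE x in lebesgue_on {a<..<b::real}. a < x \<and> x < b"
  by (rule AE_I2) auto

lemma continuous_on_measurable_interval:
  fixes f :: "real \<Rightarrow> real"
  assumes "continuous_on {a<..<b} f"
  shows "f \<in> borel_measurable (lebesgue_on {a<..<b})"
  by (rule continuous_imp_measurable_on_sets_lebesgue[OF assms]) auto

lemma power_add_le_two_power:
  fixes x y :: real
  shows "\<bar>x + y\<bar>^p \<le> 2^p * (\<bar>x\<bar>^p + \<bar>y\<bar>^p)"
proof -
  have "\<bar>x + y\<bar>^p \<le> (2 * max \<bar>x\<bar> \<bar>y\<bar>)^p" by (intro power_mono) auto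
  also have "\<dots> = 2^p * (max \<bar>x\<bar> \<bar>y\<bar>)^p" by (simp add: power_mult_distrib)
  also have "(max \<bar>x\<bar> \<bar>y\<bar>)^p \<le> \<bar>x\<bar>^p + \<bar>y\<bar>^p" by (auto simp: max_def)
  finally show ?thesis by simp
qed

text \<open>A measurable function is an a.e. limit of continuous ones. Clipping these at
  \<plusminus>\<open>K\<close> preserves the limit and gives a uniform bound; Stone-Weierstrass
  replaces them by polynomials, a cutoff creates the zeros at the end points, and dominated
  convergence concludes.\<close>

lemma polynomial_dense_bounded:
  fixes f :: "real \<Rightarrow> real"
  assumes "a < b" "p \<ge> 1" and meas: "f \<in> borel_measurable (lebesgue_on {a<..<b})"
    and bd: "\<And>x. \<bar>f x\<bar> \<le> K" and "e > 0"
  obtains r where "real_polynomial_function r" "r a = 0" "r b = 0"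
    "\<And>D x. x \<in> {a, b} \<Longrightarrow> (r has_real_derivative D) (at x) \<Longrightarrow> D = 0"
    "(\<integral>x. \<bar>f x - r x\<bar>^p \<partial>lebesgue_on {a<..<b}) < e"
proof -
  let ?M = "lebesgue_on {a<..<b}"
  have K0: "0 \<le> K" using bd[of 0] by linarith
  have "f measurable_on {a<..<b}"
    using meas by (simp add: measurable_on_iff_borel_measurable)
  then obtain N g where N: "negligible N" and g: "\<And>n::nat. continuous_on UNIV (g n)"
    and lim: "\<And>x. x \<notin> N \<Longrightarrow> (\<lambda>n. g n x) \<longlonglongrightarrow> (if x \<in> {a<..<b} then f x else 0)"
    unfolding measurable_on_def by blast
  define h where "h n x = max (-K) (min K (g n x))" for n x
  have hc: "continuous_on {a..b} (h n)" for n
    unfolding h_def by (intro continuous_intros continuous_on_subset[OF g]) auto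
  have "\<exists>q. real_polynomial_function q \<and> (\<forall>x\<in>{a..b}. \<bar>h n x - q x\<bar> < 1 / real (Suc n))" for n
    by (rule Stone_Weierstrass_real_polynomial_function[OF compact_Icc hc[of n], of "1 / real (Suc n)"]) auto
  then obtain q where q: "\<And>n. real_polynomial_function (q n)"
    "\<And>n x. x \<in> {a..b} \<Longrightarrow> \<bar>h n x - q n x\<bar> < 1 / real (Suc n)" by metis
  \<comment> \<open>\<open>w\<close> maps \<open>{a..b}\<close> affinely onto [-1,1]. The factor
    \<open>(1 - w^(2n+2))^2\<close> has double zeros at \<open>a\<close> and \<open>b\<close>, stays
    in [0,1] because the exponent \<open>2n+2\<close> is even, and tends to 1 at every interior
    point.\<close>
  define w where "w x = (2 * x - a - b) / (b - a)" for x
  define r where "r n x = q n x * (1 - w x ^ (2 * n + 2))^2" for n x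
  have wpoly: "real_polynomial_function w"
  proof -
    have "w = (\<lambda>x. x * (2 / (b - a)) + (- a - b) / (b - a))"
      by (auto simp: w_def fun_eq_iff diff_divide_distrib add_divide_distrib)
    moreover have "real_polynomial_function (\<lambda>x::real. x * (2 / (b - a)) + (- a - b) / (b - a))"
      by (rule real_polynomial_function.intros(3)[OF real_polynomial_function.intros(1)
            real_polynomial_function.intros(2)]) (rule bounded_linear_mult_left)
    ultimately show ?thesis by simp
  qed
  have rpoly: "real_polynomial_function (r n)" for n
    unfolding r_def
    by (intro real_polynomial_function.intros(2-4) q real_polynomial_function_power
        real_polynomial_function_diff wpoly)
  have wab: "w a = -1" "w b = 1" using \<open>a < b\<close> by (auto simp: w_def field_simps)
  have rab: "r n a = 0" "r n b = 0" for n by (auto simp: r_def wab)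
  have rd: "D = 0" if "x \<in> {a, b}" "(r n has_real_derivative D) (at x)" for n x D
  proof -
    define c where "c x = 1 - w x ^ (2 * n + 2)" for x
    have "real_polynomial_function c"
      unfolding c_def
      by (intro real_polynomial_function.intros(2-4) real_polynomial_function_power
          real_polynomial_function_diff wpoly)
    then obtain c' q' where c': "(c has_real_derivative c') (at x)"
      and q': "(q n has_real_derivative q') (at x)"
      using has_real_derivative_polynomial_function q(1) by metis
    have cx: "c x = 0" using that(1) wab by (auto simp: c_def)
    have "r n = (\<lambda>x. q n x * (c x * c x))" by (auto simp: r_def c_def power2_eq_square)
    moreover have "((\<lambda>x. q n x * (c x * c x)) has_real_derivative 0) (at x)"
      using DERIV_mult[OF q' DERIV_mult[OF c' c']] cx by simp
    ultimately have "(r n has_real_derivative 0) (at x)" by simp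
    then show ?thesis using that(2) DERIV_unique by blast
  qed
  have wlt: "\<bar>w x\<bar> < 1" if "x \<in> {a<..<b}" for x
    using that by (auto simp: w_def field_simps abs_if)
  have hK: "\<bar>h n x\<bar> \<le> K" for n x using K0 by (auto simp: h_def)
  have qK: "\<bar>q n x\<bar> \<le> K + 1" if "x \<in> {a<..<b}" for n x
  proof -
    have "1 / real (Suc n) \<le> 1" by simp
    then show ?thesis using hK[of n x] q(2)[of x n] that
      unfolding greaterThanLessThan_iff atLeastAtMost_iff by linarith
  qed
  have cut: "0 \<le> (1 - w x ^ (2 * n + 2))^2 \<and> (1 - w x ^ (2 * n + 2))^2 \<le> 1" if "x \<in> {a<..<b}" for n x
  proof -
    have "w x ^ (2 * n + 2) = (w x ^ (n+1))^2" by (subst power_mult[symmetric]) (simp add: algebra_simps)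
    moreover have "(w x ^ (n+1))^2 \<le> 1"
      using wlt[OF that] by (simp add: power_abs power_le_one abs_square_le_1 del: power_Suc)
    ultimately show ?thesis by (simp add: power_le_one)
  qed
  have rK: "\<bar>r n x\<bar> \<le> K + 1" if "x \<in> {a<..<b}" for n x
    using mult_mono[OF qK[OF that, of n] conjunct2[OF cut[OF that, of n]]] cut[OF that, of n] K0
    by (simp add: r_def abs_mult)
  have rlim: "(\<lambda>n. r n x) \<longlonglongrightarrow> f x" if x: "x \<in> {a<..<b}" "x \<notin> N" for x
  proof -
    have "(\<lambda>n. h n x) \<longlonglongrightarrow> max (-K) (min K (f x))"
      unfolding h_def using lim[OF x(2)] x(1) by (intro tendsto_intros) auto
    moreover have "max (-K) (min K (f x)) = f x" using bd[of x] by (auto simp: max_def min_def)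
    ultimately have h: "(\<lambda>n. h n x) \<longlonglongrightarrow> f x" by simp
    have "(\<lambda>n. h n x - q n x) \<longlonglongrightarrow> 0"
      by (rule tendsto_rabs_zero_cancel, rule tendsto_sandwich[OF _ _ tendsto_const LIMSEQ_inverse_real_of_nat])
        (use q(2)[of x] x in \<open>auto simp: field_simps intro!: always_eventually less_imp_le\<close>)
    from tendsto_diff[OF h this] have ql: "(\<lambda>n. q n x) \<longlonglongrightarrow> f x" by simp
    have "(\<lambda>n. w x ^ n) \<longlonglongrightarrow> 0" using wlt[OF x(1)] by (intro LIMSEQ_power_zero) simp
    then have "(\<lambda>n. w x ^ (2 * n + 2)) \<longlonglongrightarrow> 0"
      by (rule LIMSEQ_subseq_LIMSEQ[of "\<lambda>n. w x ^ n" 0 "\<lambda>n. 2*n+2", unfolded o_def])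
        (auto simp: strict_mono_def)
    then have "(\<lambda>n. (1 - w x ^ (2 * n + 2))^2) \<longlonglongrightarrow> (1 - 0)^2" by (intro tendsto_intros)
    from tendsto_mult[OF ql this] show ?thesis by (simp add: r_def)
  qed
  have "(\<lambda>n. \<integral>x. \<bar>f x - r n x\<bar>^p \<partial>?M) \<longlonglongrightarrow> (\<integral>x. 0 \<partial>?M)"
  proof (rule integral_dominated_convergence)
    show "(\<lambda>x. \<bar>f x - r n x\<bar>^p) \<in> borel_measurable ?M" for n
      by (intro borel_measurable_power borel_measurable_abs borel_measurable_diff meas
          continuous_on_measurable_interval continuous_on_polymonial_function
          rpoly[unfolded real_polynomial_function_eq])
    show "integrable ?M (\<lambda>x. (2 * K + 1)^p)"
      by (rule finite_measure.integrable_const[OF finite_measure_interval])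
    have "AE x in lebesgue. x \<notin> N" using N by (intro AE_not_in) (simp add: negligible_iff_null_sets)
    then have "AE x in ?M. x \<notin> N" by (auto simp: AE_restrict_space_iff)
    then show "AE x in ?M. (\<lambda>n. \<bar>f x - r n x\<bar>^p) \<longlonglongrightarrow> 0"
      using space_interval_AE
    proof eventually_elim
      case (elim x)
      then have "(\<lambda>n. \<bar>f x - r n x\<bar>^p) \<longlonglongrightarrow> \<bar>f x - f x\<bar>^p"
        by (intro tendsto_intros rlim) auto
      then show ?case using \<open>p \<ge> 1\<close> by (simp add: power_0_left split: if_splits)
    qed
    show "AE x in ?M. norm (\<bar>f x - r n x\<bar>^p) \<le> (2 * K + 1)^p" for n
      using space_interval_AE
    proof eventually_elim
      case (elim x)
      have "\<bar>f x - r n x\<bar> \<le> 2 * K + 1" using rK[of x n] bd[of x] elim by auto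
      then show ?case by (simp add: power_mono)
    qed
  qed auto
  then have "(\<lambda>n. \<integral>x. \<bar>f x - r n x\<bar>^p \<partial>?M) \<longlonglongrightarrow> 0" by simp
  from eventually_happens'[OF sequentially_bot order_tendstoD(2)[OF this \<open>e > 0\<close>]]
  obtain n where n: "(\<integral>x. \<bar>f x - r n x\<bar>^p \<partial>?M) < e" by blast
  show ?thesis
  proof (rule that[OF rpoly[of n] rab[of n] _ n])
    show "D = 0" if "x \<in> {a, b}" "(r n has_real_derivative D) (at x)" for D x
      using rd[OF that] .
  qed
qed

text \<open>Truncation at height \<open>k\<close> reduces to the bounded case. The tolerance
  \<open>e / 2^(p+1)\<close> for each of the two errors absorbs the factor \<open>2^p\<close> of
  \<open>power_add_le_two_power\<close>.\<close>

lemma polynomial_dense: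
  fixes f :: "real \<Rightarrow> real"
  assumes "a < b" "p \<ge> 1" and meas: "f \<in> borel_measurable (lebesgue_on {a<..<b})"
    and int: "integrable (lebesgue_on {a<..<b}) (\<lambda>x. \<bar>f x\<bar>^p)" and "e > 0"
  obtains r where "real_polynomial_function r" "r a = 0" "r b = 0"
    "\<And>D x. x \<in> {a, b} \<Longrightarrow> (r has_real_derivative D) (at x) \<Longrightarrow> D = 0"
    "(\<integral>x. \<bar>f x - r x\<bar>^p \<partial>lebesgue_on {a<..<b}) < e"
proof -
  let ?M = "lebesgue_on {a<..<b}"
  define t where "t k x = max (- real k) (min (real k) (f x))" for k x
  have tm: "t k \<in> borel_measurable ?M" for k unfolding t_def using meas by simp
  have "(\<lambda>k. \<integral>x. \<bar>f x - t k x\<bar>^p \<partial>?M) \<longlonglongrightarrow> (\<integral>x. 0 \<partial>?M)"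
  proof (rule integral_dominated_convergence[where w="\<lambda>x. \<bar>f x\<bar>^p"])
    show "(\<lambda>x. \<bar>f x - t k x\<bar>^p) \<in> borel_measurable ?M" for k using meas tm by simp
    show "AE x in ?M. (\<lambda>k. \<bar>f x - t k x\<bar>^p) \<longlonglongrightarrow> 0"
    proof (rule AE_I2)
      fix x
      obtain k0 where "\<bar>f x\<bar> \<le> real k0" using real_arch_simple by blast
      then have "\<forall>\<^sub>F k in sequentially. \<bar>f x - t k x\<bar>^p = 0"
        using \<open>p \<ge> 1\<close> by (auto simp: eventually_sequentially t_def max_def min_def intro!: exI[of _ k0])
      then show "(\<lambda>k. \<bar>f x - t k x\<bar>^p) \<longlonglongrightarrow> 0" by (rule tendsto_eventually)
    qed
    show "AE x in ?M. norm (\<bar>f x - t k x\<bar>^p) \<le> \<bar>f x\<bar>^p" for k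
      by (rule AE_I2) (auto simp: t_def intro!: power_mono)
  qed (use int in auto)
  then have "(\<lambda>k. \<integral>x. \<bar>f x - t k x\<bar>^p \<partial>?M) \<longlonglongrightarrow> 0" by simp
  moreover have "e / 2^(p+1) > 0" using \<open>e > 0\<close> by simp
  ultimately obtain k where k: "(\<integral>x. \<bar>f x - t k x\<bar>^p \<partial>?M) < e / 2^(p+1)"
    using eventually_happens'[OF sequentially_bot order_tendstoD(2)] by blast
  have "\<bar>t k x\<bar> \<le> real k" for x by (auto simp: t_def)
  obtain r where r: "real_polynomial_function r" "r a = 0" "r b = 0"
    "\<And>D x. x \<in> {a, b} \<Longrightarrow> (r has_real_derivative D) (at x) \<Longrightarrow> D = 0"
    "(\<integral>x. \<bar>t k x - r x\<bar>^p \<partial>?M) < e / 2^(p+1)"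
    by (rule polynomial_dense_bounded[OF assms(1,2) tm \<open>\<And>x. \<bar>t k x\<bar> \<le> real k\<close> \<open>e / 2^(p+1) > 0\<close>]) blast
  have rm: "r \<in> borel_measurable ?M"
    by (intro continuous_on_measurable_interval continuous_on_polymonial_function
        r(1)[unfolded real_polynomial_function_eq])
  have i1: "integrable ?M (\<lambda>x. \<bar>f x - t k x\<bar>^p)"
    by (rule Bochner_Integration.integrable_bound[OF int])
      (use meas tm in \<open>auto simp: t_def intro!: power_mono\<close>)
  have "continuous_on {a..b} r"
    by (intro continuous_on_polymonial_function r(1)[unfolded real_polynomial_function_eq])
  then have "bounded (r ` {a..b})" by (intro compact_imp_bounded compact_continuous_image) auto
  then obtain B where B: "\<And>x. x \<in> {a..b} \<Longrightarrow> \<bar>r x\<bar> \<le> B"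
    unfolding bounded_iff by (metis imageI real_norm_def)
  have i2: "integrable ?M (\<lambda>x. \<bar>t k x - r x\<bar>^p)"
  proof (rule integrable_bounded_interval)
    show "AE x in ?M. \<bar>\<bar>t k x - r x\<bar>^p\<bar> \<le> (real k + B)^p"
    proof (rule AE_I2)
      fix x assume "x \<in> space ?M"
      then show "\<bar>\<bar>t k x - r x\<bar>^p\<bar> \<le> (real k + B)^p"
        using B[of x] \<open>\<bar>t k x\<bar> \<le> real k\<close> by (auto intro!: power_mono)
    qed
  qed (use rm tm in simp)
  have "(\<integral>x. \<bar>f x - r x\<bar>^p \<partial>?M) \<le> (\<integral>x. 2^p * (\<bar>f x - t k x\<bar>^p + \<bar>t k x - r x\<bar>^p) \<partial>?M)"
  proof (rule integral_mono_AE')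
    show "AE x in ?M. \<bar>f x - r x\<bar>^p \<le> 2^p * (\<bar>f x - t k x\<bar>^p + \<bar>t k x - r x\<bar>^p)"
    proof (rule AE_I2)
      fix x
      show "\<bar>f x - r x\<bar>^p \<le> 2^p * (\<bar>f x - t k x\<bar>^p + \<bar>t k x - r x\<bar>^p)"
        using power_add_le_two_power[of "f x - t k x" "t k x - r x" p] by simp
    qed
  qed (use i1 i2 in auto)
  also have "\<dots> = 2^p * ((\<integral>x. \<bar>f x - t k x\<bar>^p \<partial>?M) + (\<integral>x. \<bar>t k x - r x\<bar>^p \<partial>?M))"
    using i1 i2 by simp
  also have "\<dots> < 2^p * (e / 2^(p+1) + e / 2^(p+1))" using k r(5) by (intro mult_strict_left_mono) auto
  also have "\<dots> = e" by simp
  finally show ?thesis using that r by blast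
qed

section \<open>Test functions of class C1 and the fundamental lemma\<close>

lemma Cc1I:
  assumes d: "\<And>x. (f has_real_derivative f' x) (at x)" and c: "continuous_on UNIV f'"
    and z: "\<And>x. x \<notin> {a..b} \<Longrightarrow> f x = 0" and ab: "-l < a" "b < l"
  shows "f \<in> Cc1 l" "deriv f = f'"
proof -
  have "f C1_differentiable_on UNIV"
    unfolding C1_differentiable_on_def using d c
    by (auto simp: has_real_derivative_iff_has_vector_derivative)
  moreover have "{x. f x \<noteq> 0} \<subseteq> {a..b}" using z by blast
  then have "closure {x. f x \<noteq> 0} \<subseteq> {a..b}" by (rule closure_minimal) simp
  moreover from this have "compact (closure {x. f x \<noteq> 0})"
    using compact_Icc closed_closure compact_Int_closed by (metis inf.absorb_iff2)
  ultimately show "f \<in> Cc1 l" using ab by (auto simp: Cc1_def)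
  show "deriv f = f'" using d DERIV_imp_deriv by blast
qed

lemma Cc1_props:
  assumes "\<phi> \<in> Cc1 l"
  shows Cc1_deriv: "(\<phi> has_real_derivative deriv \<phi> x) (at x)"
    and Cc1_continuous_deriv: "continuous_on UNIV (deriv \<phi>)"
    and Cc1_zero: "x \<notin> {-l<..<l} \<Longrightarrow> \<phi> x = 0"
    and Cc1_continuous: "continuous_on UNIV \<phi>"
proof -
  obtain D where D: "\<And>x. (\<phi> has_real_derivative D x) (at x)" "continuous_on UNIV D"
    using assms by (auto simp: Cc1_def C1_differentiable_on_def has_real_derivative_iff_has_vector_derivative)
  then have "deriv \<phi> = D" using DERIV_imp_deriv by blast
  then show d: "(\<phi> has_real_derivative deriv \<phi> x) (at x)" for x using D by simp
  show "continuous_on UNIV (deriv \<phi>)" using D \<open>deriv \<phi> = D\<close> by simp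
  show "\<phi> x = 0" if "x \<notin> {-l<..<l}"
    using assms that closure_subset[of "{x. \<phi> x \<noteq> 0}"] by (auto simp: Cc1_def)
  show "continuous_on UNIV \<phi>"
    using d by (meson DERIV_isCont continuous_at_imp_continuous_on)
qed

lemma has_derivative_zero_extension:
  assumes d: "\<And>x. (r has_real_derivative r' x) (at x)" and "a < b"
    and z: "r a = 0" "r b = 0" "r' a = 0" "r' b = (0::real)"
  shows "((\<lambda>x. if x \<in> {a..b} then r x else 0) has_real_derivative
    (if x \<in> {a..b} then r' x else 0)) (at x)"
proof -
  let ?\<phi> = "\<lambda>x. if x \<in> {a..b} then r x else 0"
  consider "x < a \<or> x > b" | "a < x" "x < b" | "x = a \<or> x = b" by linarith
  then show ?thesis
  proof cases
    case 1
    then have "open (- {a..b})" "x \<in> - {a..b}" by auto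
    then have "\<forall>\<^sub>F y in nhds x. ?\<phi> y = 0"
      unfolding eventually_nhds by (intro exI[of _ "- {a..b}"]) auto
    moreover have "((\<lambda>y. 0) has_real_derivative 0) (at x)" by simp
    ultimately show ?thesis using 1 by (subst DERIV_cong_ev) auto
  next
    case 2
    then have "open {a<..<b}" "x \<in> {a<..<b}" by auto
    then have "\<forall>\<^sub>F y in nhds x. ?\<phi> y = r y"
      unfolding eventually_nhds by (intro exI[of _ "{a<..<b}"]) auto
    then show ?thesis using 2 d[of x] by (subst DERIV_cong_ev) auto
  next
    case 3
    \<comment> \<open>At an end point the difference quotient of the extension is either that of
      \<open>r\<close> or 0, so it is dominated by a quantity tending to 0.\<close>
    have "((\<lambda>y. (r y - r x) / (y - x)) \<longlongrightarrow> 0) (at x)"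
      using d[of x] 3 z by (auto simp: has_field_derivative_iff)
    then have "((\<lambda>y. (?\<phi> y - ?\<phi> x) / (y - x)) \<longlongrightarrow> 0) (at x)"
      by (rule tendsto_0_le[where K=1]) (use 3 z in \<open>auto intro!: always_eventually\<close>)
    then show ?thesis using 3 z by (auto simp: has_field_derivative_iff)
  qed
qed

lemma Cc1_zero_extension:
  assumes r: "real_polynomial_function r" and "a < b" "r a = 0" "r b = 0"
    and rd: "\<And>D x. x \<in> {a, b} \<Longrightarrow> (r has_real_derivative D) (at x) \<Longrightarrow> D = 0"
    and ab: "-l < a" "b < l"
  shows "(\<lambda>x. if x \<in> {a..b} then r x else 0) \<in> Cc1 l"
proof -
  obtain r' where r': "real_polynomial_function r'" "\<And>x. (r has_real_derivative r' x) (at x)"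
    using has_real_derivative_polynomial_function[OF r] by blast
  have z: "r' a = 0" "r' b = 0" using rd r' by blast+
  have "continuous_on UNIV (\<lambda>x. if x \<in> {a..b} then r' x else 0)"
  proof -
    \<comment> \<open>Since \<open>r'\<close> vanishes at both ends, its zero extension equals its
      composition with the clamp onto \<open>{a..b}\<close>, whose continuity is immediate.\<close>
    have "continuous_on UNIV (\<lambda>x. r' (max a (min b x)))"
      by (intro continuous_on_compose2[OF continuous_on_polymonial_function[OF r'(1)[unfolded real_polynomial_function_eq]]]
          continuous_intros) auto
    moreover have "(\<lambda>x. r' (max a (min b x))) = (\<lambda>x. if x \<in> {a..b} then r' x else 0)"
      using z \<open>a < b\<close> by (auto simp: fun_eq_iff max_def min_def)
    ultimately show ?thesis by (rule back_subst)
  qed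
  then show ?thesis
    by (intro Cc1I(1)[OF has_derivative_zero_extension[OF r'(2) \<open>a < b\<close>]])
      (use assms z in auto)
qed

lemma interval_restrict:
  fixes f :: "real \<Rightarrow> real"
  assumes "{a<..<b} \<subseteq> {c<..<d}"
  shows "integral\<^sup>L (lebesgue_on {a<..<b}) f
       = (\<integral>x. indicator {a<..<b} x * f x \<partial>lebesgue_on {c<..<d})"
    and "integrable (lebesgue_on {a<..<b}) f
       \<longleftrightarrow> integrable (lebesgue_on {c<..<d}) (\<lambda>x. indicator {a<..<b} x * f x)"
proof -
  have eq: "(\<lambda>x. indicator {c<..<d} x *\<^sub>R (indicator {a<..<b} x * f x))
      = (\<lambda>x. indicator {a<..<b} x *\<^sub>R f x)"
    using assms by (auto simp: indicator_def fun_eq_iff)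
  show "integral\<^sup>L (lebesgue_on {a<..<b}) f
       = (\<integral>x. indicator {a<..<b} x * f x \<partial>lebesgue_on {c<..<d})"
    using integral_restrict_space[of "{a<..<b}" lebesgue f]
      integral_restrict_space[of "{c<..<d}" lebesgue "\<lambda>x. indicator {a<..<b} x * f x"]
    unfolding eq by simp
  show "integrable (lebesgue_on {a<..<b}) f
       \<longleftrightarrow> integrable (lebesgue_on {c<..<d}) (\<lambda>x. indicator {a<..<b} x * f x)"
    using integrable_restrict_space[of "{a<..<b}" lebesgue f]
      integrable_restrict_space[of "{c<..<d}" lebesgue "\<lambda>x. indicator {a<..<b} x * f x"]
    unfolding eq by simp
qed

lemma integrable_subinterval_lebesgue:
  fixes f :: "real \<Rightarrow> real"
  assumes "{a<..<b} \<subseteq> {c<..<d}" "integrable (lebesgue_on {c<..<d}) f"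
  shows "integrable (lebesgue_on {a<..<b}) f"
proof -
  have ind: "(indicator {a<..<b} :: real \<Rightarrow> real) \<in> borel_measurable (lebesgue_on {c<..<d})"
    by (intro measurable_restrict_space1 borel_measurable_indicator) auto
  show ?thesis
    unfolding interval_restrict(2)[OF assms(1)]
  proof (rule Bochner_Integration.integrable_bound[OF assms(2)])
    show "(\<lambda>x. indicator {a<..<b} x * f x) \<in> borel_measurable (lebesgue_on {c<..<d})"
      using ind assms(2) by (intro borel_measurable_times) auto
  qed (auto simp: indicator_def)
qed

lemma measurable_subinterval_lebesgue:
  fixes f :: "real \<Rightarrow> real"
  assumes "{a<..<b} \<subseteq> {c<..<d}" "f \<in> borel_measurable (lebesgue_on {c<..<d})"
  shows "f \<in> borel_measurable (lebesgue_on {a<..<b})"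
  using measurable_restrict_mono assms by blast

text \<open>Test functions supported in \<open>{a..b}\<close> with \<open>-l < a\<close> and
  \<open>b < l\<close> give information on compact subintervals only; countably many of these
  exhaust the interval.\<close>

lemma AE_interval_exhaust:
  assumes "\<And>a b. -l < a \<Longrightarrow> a < b \<Longrightarrow> b < l \<Longrightarrow> AE x in lebesgue_on {a<..<b}. P x"
  shows "AE x in leb_I l. P x"
proof (cases "l > 0")
  case l: True
  define a where "a n = l / real (n + 2)" for n
  have "AE x in lebesgue. -l + a n < x \<and> x < l - a n \<longrightarrow> P x" for n
  proof (cases "-l + a n < l - a n")
    case True
    have "a n > 0" using l by (simp add: a_def)
    then show ?thesis using assms[of "-l + a n" "l - a n"] True by (auto simp: AE_restrict_space_iff)
  qed auto
  then have *: "AE x in lebesgue. \<forall>n. -l + a n < x \<and> x < l - a n \<longrightarrow> P x"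
    unfolding AE_all_countable by blast
  have ex: "\<exists>n. -l + a n < x \<and> x < l - a n" if "-l < x" "x < l" for x
  proof -
    have "(\<lambda>n. l / real (n + 2)) \<longlonglongrightarrow> 0"
      by (rule LIMSEQ_ignore_initial_segment[OF lim_const_over_n])
    then have "\<forall>\<^sub>F n in sequentially. a n < min (x + l) (l - x)"
      unfolding a_def by (rule order_tendstoD) (use that in auto)
    from eventually_happens'[OF sequentially_bot this] obtain n where "a n < min (x + l) (l - x)" by blast
    then show ?thesis by (intro exI[of _ n]) auto
  qed
  have "AE x in lebesgue. -l < x \<and> x < l \<longrightarrow> P x"
    using * by eventually_elim (use ex in blast)
  then show ?thesis by (auto simp: AE_restrict_space_iff)
qed (auto intro!: AE_I2)

lemma integrable_mult_square:
  fixes u v :: "'a \<Rightarrow> real"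
  assumes "u \<in> borel_measurable M" "v \<in> borel_measurable M"
    and "integrable M (\<lambda>x. (u x)^2)" "integrable M (\<lambda>x. (v x)^2)"
  shows "integrable M (\<lambda>x. u x * v x)"
proof (rule Bochner_Integration.integrable_bound)
  show "integrable M (\<lambda>x. (u x)^2 + (v x)^2)" using assms by simp
  show "AE x in M. norm (u x * v x) \<le> norm ((u x)^2 + (v x)^2)"
  proof (rule AE_I2)
    fix x
    have "0 \<le> (\<bar>u x\<bar> - \<bar>v x\<bar>)^2" by simp
    then have "2 * (\<bar>u x\<bar> * \<bar>v x\<bar>) \<le> (u x)^2 + (v x)^2"
      by (simp add: power2_diff)
    moreover have "0 \<le> \<bar>u x\<bar> * \<bar>v x\<bar>" by simp
    ultimately have "\<bar>u x * v x\<bar> \<le> (u x)^2 + (v x)^2" unfolding abs_mult by linarith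
    then show "norm (u x * v x) \<le> norm ((u x)^2 + (v x)^2)" by simp
  qed
qed (use assms in simp)

text \<open>The polynomials approximating \<open>w\<close> on a subinterval become test functions
  when extended by zero, so \<open>w\<close> is orthogonal to its own approximants. Hence the
  integral of \<open>w^2\<close> over the subinterval is at most that of \<open>(w - r)^2\<close>,
  which is arbitrarily small.\<close>

lemma fundamental_lemma:
  assumes wm: "w \<in> borel_measurable (leb_I l)" and w2: "integrable (leb_I l) (\<lambda>x. (w x)^2)"
    and orth: "\<And>\<phi>. \<phi> \<in> Cc1 l \<Longrightarrow> (\<integral>x. w x * \<phi> x \<partial>leb_I l) = 0"
  shows "AE x in leb_I l. w x = 0"
proof (rule AE_interval_exhaust)
  fix a b :: real assume ab: "-l < a" "a < b" "b < l"
  let ?M = "lebesgue_on {a<..<b}"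
  have sub: "{a<..<b} \<subseteq> {-l<..<l}" using ab by auto
  have wm': "w \<in> borel_measurable ?M" by (rule measurable_subinterval_lebesgue[OF sub wm])
  have w2': "integrable ?M (\<lambda>x. (w x)^2)" by (rule integrable_subinterval_lebesgue[OF sub w2])
  have "(\<integral>x. (w x)^2 \<partial>?M) \<le> 0 + e" if "e > 0" for e
  proof -
    have w2'': "integrable ?M (\<lambda>x. \<bar>w x\<bar>^2)" using w2' by simp
    obtain r where r: "real_polynomial_function r" "r a = 0" "r b = 0"
      "\<And>D x. x \<in> {a, b} \<Longrightarrow> (r has_real_derivative D) (at x) \<Longrightarrow> D = 0"
      "(\<integral>x. \<bar>w x - r x\<bar>^2 \<partial>?M) < e"
      by (rule polynomial_dense[where p=2, OF \<open>a < b\<close> _ wm' w2'' \<open>e > 0\<close>]) (simp, blast)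
    have cont: "continuous_on A r" for A
      by (intro continuous_on_polymonial_function r(1)[unfolded real_polynomial_function_eq])
    have rm: "r \<in> borel_measurable ?M" by (intro continuous_on_measurable_interval cont)
    have "bounded (r ` {a..b})" by (intro compact_imp_bounded compact_continuous_image cont) auto
    then obtain B where B: "\<And>x. x \<in> {a..b} \<Longrightarrow> \<bar>r x\<bar> \<le> B"
      unfolding bounded_iff by (metis imageI real_norm_def)
    have r2: "integrable ?M (\<lambda>x. (r x)^2)"
    proof (rule integrable_bounded_interval[where B="B^2"])
      show "AE x in ?M. \<bar>(r x)\<^sup>2\<bar> \<le> B\<^sup>2"
      proof (rule AE_I2)
        fix x assume "x \<in> space ?M"
        then have "\<bar>r x\<bar> \<le> \<bar>B\<bar>" using B[of x] by auto
        then show "\<bar>(r x)\<^sup>2\<bar> \<le> B\<^sup>2" by (simp add: abs_le_square_iff)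
      qed
    qed (use rm in simp)
    have wr: "integrable ?M (\<lambda>x. w x * r x)" by (rule integrable_mult_square[OF wm' rm w2' r2])
    have "0 = (\<integral>x. w x * (if x \<in> {a..b} then r x else 0) \<partial>leb_I l)"
      using orth[OF Cc1_zero_extension[OF r(1) \<open>a < b\<close> r(2,3,4) ab(1,3)]] by simp
    also have "\<dots> = (\<integral>x. indicator {a<..<b} x * (w x * r x) \<partial>leb_I l)"
      by (rule Bochner_Integration.integral_cong)
        (use r(2,3) in \<open>auto simp: indicator_def less_le\<close>)
    also have "\<dots> = (\<integral>x. w x * r x \<partial>?M)" by (rule interval_restrict(1)[OF sub, symmetric])
    finally have wr0: "(\<integral>x. w x * r x \<partial>?M) = 0" by simp
    \<comment> \<open>orthogonality to \<open>r\<close> removes the mixed term of \<open>(w - r)\<^sup>2\<close>\<close>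
    have "(\<integral>x. (w x)^2 \<partial>?M) \<le> (\<integral>x. (w x)^2 \<partial>?M) - 2 * (\<integral>x. w x * r x \<partial>?M) + (\<integral>x. (r x)^2 \<partial>?M)"
      using wr0 by simp
    also have "\<dots> = (\<integral>x. (w x)^2 - 2 * (w x * r x) + (r x)^2 \<partial>?M)"
      using wr w2' r2 by simp
    also have "\<dots> = (\<integral>x. \<bar>w x - r x\<bar>^2 \<partial>?M)" by (simp add: power2_diff algebra_simps)
    finally show ?thesis using r(5) by simp
  qed
  then have "(\<integral>x. (w x)^2 \<partial>?M) \<le> 0" by (rule field_le_epsilon)
  then have "(\<integral>x. (w x)^2 \<partial>?M) = 0" by (simp add: antisym integral_nonneg)
  then have "AE x in ?M. (w x)^2 = 0"
    using integral_nonneg_eq_0_iff_AE[OF w2'] by simp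
  then show "AE x in ?M. w x = 0" by simp
qed

section \<open>Weak derivatives in one dimension\<close>

lemma L2_bounded:
  assumes "u \<in> borel_measurable (leb_I l)" "AE x in leb_I l. \<bar>u x\<bar> \<le> B"
  shows "u \<in> L2 l"
proof -
  have "integrable (leb_I l) (\<lambda>x. (u x)^2)"
  proof (rule integrable_bounded_interval)
    show "AE x in leb_I l. \<bar>(u x)\<^sup>2\<bar> \<le> B\<^sup>2"
      using assms(2) by eventually_elim (metis abs_ge_zero abs_power2 power2_abs power_mono)
  qed (use assms in simp)
  then show ?thesis using assms by (simp add: L2_def)
qed

lemma L2_continuous:
  assumes "continuous_on {-l..l} u"
  shows "u \<in> L2 l"
proof -
  have "bounded (u ` {-l..l})" by (intro compact_imp_bounded compact_continuous_image assms) auto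
  then obtain B where B: "\<And>x. x \<in> {-l..l} \<Longrightarrow> \<bar>u x\<bar> \<le> B"
    unfolding bounded_iff by (metis imageI real_norm_def)
  show ?thesis
  proof (rule L2_bounded)
    show "u \<in> borel_measurable (leb_I l)"
      by (intro continuous_on_measurable_interval continuous_on_subset[OF assms]) auto
    show "AE x in leb_I l. \<bar>u x\<bar> \<le> B" by (rule AE_I2) (use B in auto)
  qed
qed

lemma L2_mult_integrable:
  assumes "u \<in> L2 l" "v \<in> L2 l"
  shows "integrable (leb_I l) (\<lambda>x. u x * v x)"
  using assms by (intro integrable_mult_square) (auto simp: L2_def)

lemma L2_diff:
  assumes "u \<in> L2 l" "v \<in> L2 l"
  shows "(\<lambda>x. u x - v x) \<in> L2 l"
proof -
  have "integrable (leb_I l) (\<lambda>x. (u x)^2 - 2 * (u x * v x) + (v x)^2)"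
    using assms L2_mult_integrable[OF assms] by (auto simp: L2_def)
  moreover have "(u x)^2 - 2 * (u x * v x) + (v x)^2 = (u x - v x)^2" for x
    by (simp add: power2_diff)
  ultimately show ?thesis using assms by (auto simp: L2_def)
qed

lemma Cc1_L2:
  assumes "\<phi> \<in> Cc1 l"
  shows "\<phi> \<in> L2 l" "deriv \<phi> \<in> L2 l"
  by (intro L2_continuous continuous_on_subset[OF Cc1_continuous[OF assms]]
      continuous_on_subset[OF Cc1_continuous_deriv[OF assms]]; simp)+

lemma has_weak_deriv_unique:
  assumes "v \<in> L2 l" "w \<in> L2 l" "has_weak_deriv l u v" "has_weak_deriv l u w"
  shows "AE x in leb_I l. v x = w x"
proof -
  have d: "(\<lambda>x. v x - w x) \<in> L2 l" by (rule L2_diff[OF assms(1,2)])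
  have "AE x in leb_I l. v x - w x = 0"
  proof (rule fundamental_lemma)
    fix \<phi> assume \<phi>: "\<phi> \<in> Cc1 l"
    have "(\<integral>x. (v x - w x) * \<phi> x \<partial>leb_I l) = (\<integral>x. v x * \<phi> x - w x * \<phi> x \<partial>leb_I l)"
      by (simp add: algebra_simps)
    also have "\<dots> = (\<integral>x. v x * \<phi> x \<partial>leb_I l) - (\<integral>x. w x * \<phi> x \<partial>leb_I l)"
      by (intro Bochner_Integration.integral_diff L2_mult_integrable assms Cc1_L2[OF \<phi>])
    also have "\<dots> = 0" using assms(3,4) \<phi> unfolding has_weak_deriv_def by fastforce
    finally show "(\<integral>x. (v x - w x) * \<phi> x \<partial>leb_I l) = 0" .
  qed (use d in \<open>auto simp: L2_def\<close>)
  then show ?thesis by simp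
qed

lemma has_weak_deriv_cong:
  assumes "u \<in> L2 l" "u' \<in> L2 l" "AE x in leb_I l. u x = u' x"
  shows "has_weak_deriv l u = has_weak_deriv l u'"
proof -
  have "(\<integral>x. u x * deriv \<phi> x \<partial>leb_I l) = (\<integral>x. u' x * deriv \<phi> x \<partial>leb_I l)" if "\<phi> \<in> Cc1 l" for \<phi>
    using L2_mult_integrable[OF assms(1) Cc1_L2(2)[OF that]]
      L2_mult_integrable[OF assms(2) Cc1_L2(2)[OF that]] assms(3)
    by (intro integral_cong_AE) auto
  then show ?thesis by (auto simp: has_weak_deriv_def fun_eq_iff)
qed

text \<open>Equality of functions, not merely almost everywhere: the choice in
  \<open>weak_deriv\<close> depends on \<open>u\<close> only through the predicate
  \<open>has_weak_deriv l u\<close>, and the two predicates coincide. This is what makes second weak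
  derivatives tractable.\<close>

lemma weak_deriv_cong:
  assumes "u \<in> L2 l" "u' \<in> L2 l" "AE x in leb_I l. u x = u' x"
  shows "weak_deriv l u = weak_deriv l u'"
  unfolding weak_deriv_def has_weak_deriv_cong[OF assms] ..

lemma weak_deriv_props:
  assumes "v \<in> L2 l" "has_weak_deriv l u v"
  shows weak_deriv_L2: "weak_deriv l u \<in> L2 l"
    and weak_deriv_has: "has_weak_deriv l u (weak_deriv l u)"
    and weak_deriv_AE: "AE x in leb_I l. weak_deriv l u x = v x"
proof -
  have *: "weak_deriv l u \<in> L2 l \<and> has_weak_deriv l u (weak_deriv l u)"
    unfolding weak_deriv_def by (rule someI[of _ v]) (use assms in simp)
  then show "weak_deriv l u \<in> L2 l" "has_weak_deriv l u (weak_deriv l u)" by auto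
  show "AE x in leb_I l. weak_deriv l u x = v x"
    using has_weak_deriv_unique * assms by blast
qed

lemma W12_weak_deriv:
  assumes "u \<in> W12 l"
  shows "weak_deriv l u \<in> L2 l" "has_weak_deriv l u (weak_deriv l u)"
  using assms weak_deriv_L2 weak_deriv_has by (auto simp: W12_def)

text \<open>The finite set \<open>S\<close> admits the corners at the ends of the layers.
  Integration by parts is the fundamental theorem of calculus for \<open>u * \<phi>\<close>, which
  tolerates finitely many exceptional points as long as the product is continuous.\<close>

lemma piecewise_has_weak_deriv:
  assumes "l > 0" and u: "continuous_on {-l..l} u" and S: "finite S"
    and d: "\<And>x. x \<in> {-l<..<l} - S \<Longrightarrow> (u has_real_derivative v x) (at x)"
    and B: "\<And>x. x \<in> {-l<..<l} - S \<Longrightarrow> \<bar>v x\<bar> \<le> B"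
  shows "v \<in> L2 l" "has_weak_deriv l u v"
proof -
  \<comment> \<open>\<open>v\<close> is given only as a pointwise derivative off \<open>S\<close>;
    that it is Henstock-Kurzweil integrable yields its measurability.\<close>
  have "(v has_integral (u l - u (-l))) {-l..l}"
    by (rule fundamental_theorem_of_calculus_interior_strong[OF S])
      (use d u \<open>l > 0\<close> in \<open>auto simp: has_real_derivative_iff_has_vector_derivative\<close>)
  then have "v \<in> borel_measurable (lebesgue_on {-l..l})"
    by (intro integrable_imp_measurable) auto
  then have vm: "v \<in> borel_measurable (leb_I l)"
    by (rule measurable_restrict_mono) auto
  have "AE x in lebesgue. x \<notin> S"
    using S by (intro AE_not_in) (simp add: negligible_finite flip: negligible_iff_null_sets)
  then have "AE x in leb_I l. \<bar>v x\<bar> \<le> B"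
    using B by (auto simp: AE_restrict_space_iff)
  then show v: "v \<in> L2 l" by (rule L2_bounded[OF vm])
  show "has_weak_deriv l u v"
    unfolding has_weak_deriv_def
  proof
    fix \<phi> assume \<phi>: "\<phi> \<in> Cc1 l"
    have i1: "integrable (leb_I l) (\<lambda>x. u x * deriv \<phi> x)"
      by (rule L2_mult_integrable[OF L2_continuous[OF u] Cc1_L2(2)[OF \<phi>]])
    have i2: "integrable (leb_I l) (\<lambda>x. v x * \<phi> x)"
      by (rule L2_mult_integrable[OF v Cc1_L2(1)[OF \<phi>]])
    have "((\<lambda>x. u x * deriv \<phi> x + v x * \<phi> x) has_integral (u l * \<phi> l - u (-l) * \<phi> (-l))) {-l..l}"
    proof (rule fundamental_theorem_of_calculus_interior_strong[OF S])
      show "((\<lambda>x. u x * \<phi> x) has_vector_derivative u x * deriv \<phi> x + v x * \<phi> x) (at x)"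
        if "x \<in> {-l<..<l} - S" for x
        using DERIV_mult[OF d[OF that] Cc1_deriv[OF \<phi>]]
        by (simp add: has_real_derivative_iff_has_vector_derivative algebra_simps)
      show "continuous_on {-l..l} (\<lambda>x. u x * \<phi> x)"
        by (intro continuous_intros u continuous_on_subset[OF Cc1_continuous[OF \<phi>]]) auto
    qed (use \<open>l > 0\<close> in auto)
    then have "integral {-l<..<l} (\<lambda>x. u x * deriv \<phi> x + v x * \<phi> x) = 0"
      using Cc1_zero[OF \<phi>] by (auto simp: integral_open_interval_real[symmetric] integral_unique)
    then have "(\<integral>x. u x * deriv \<phi> x + v x * \<phi> x \<partial>leb_I l) = 0"
      using i1 i2 by (subst lebesgue_integral_eq_integral) auto
    then show "(\<integral>x. u x * deriv \<phi> x \<partial>leb_I l) = - (\<integral>x. v x * \<phi> x \<partial>leb_I l)"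
      using i1 i2 by simp
  qed
qed

text \<open>The set where two continuous functions agree is closed. It contains almost every point
  of the open interval, hence all of it, hence also the end points.\<close>

lemma cont_rep_eq:
  assumes "l > 0" and u: "continuous_on {-l..l} u" and ae: "AE x in leb_I l. w x = u x"
    and x: "x \<in> {-l..l}"
  shows "cont_rep l w x = u x"
proof -
  let ?c = "cont_rep l w"
  have "continuous_on {-l..l} ?c \<and> (AE x in leb_I l. ?c x = w x)"
    unfolding cont_rep_def by (rule someI[of _ u]) (use u ae in \<open>auto elim: eventually_mono\<close>)
  then have c: "continuous_on {-l..l} ?c" and "AE x in leb_I l. ?c x = w x" by auto
  from this(2) ae have "AE x in leb_I l. ?c x = u x" by eventually_elim simp
  then have ae': "AE x in lebesgue. x \<in> {-l<..<l} \<longrightarrow> ?c x = u x"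
    by (simp add: AE_restrict_space_iff)
  \<comment> \<open>Composition with the clamp makes both functions continuous on the whole line, so
    that the agreement set \<open>C\<close> is closed in the line.\<close>
  define t where "t y = max (-l) (min l y)" for y
  define C where "C = {y. ?c (t y) = u (t y)}"
  have tc: "continuous_on UNIV t" unfolding t_def by (intro continuous_intros)
  have ti: "t ` UNIV \<subseteq> {-l..l}" using \<open>l > 0\<close> by (auto simp: t_def)
  have tid: "t y = y" if "y \<in> {-l..l}" for y using that by (auto simp: t_def)
  have "closed C" unfolding C_def
    by (intro closed_Collect_eq continuous_on_compose2[OF c tc] continuous_on_compose2[OF u tc] ti)
  have "AE x \<in> {-l<..<l} in lebesgue. x \<in> C"
    using ae' by eventually_elim (auto simp: C_def tid)
  then have "{-l<..<l} \<subseteq> C"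
    using mem_closed_if_AE_lebesgue_open[OF open_greaterThanLessThan \<open>closed C\<close>] by blast
  then have "closure {-l<..<l} \<subseteq> C" using \<open>closed C\<close> by (rule closure_minimal)
  then have "x \<in> C" using x \<open>l > 0\<close> by auto
  then show ?thesis using tid[OF x] by (simp add: C_def)
qed

text \<open>The interface between classical and weak calculus: a piecewise C1 angle and a
  \<open>g\<close> whose classical derivative is continuous and piecewise C1 lie in
  \<open>Y_C\<close>, and the derivatives in the energy may be replaced by the classical
  ones.\<close>

lemma Y_C_I:
  assumes l: "l > 0" and S: "finite S"
    and \<theta>: "continuous_on {-l..l} \<theta>"
    and g: "continuous_on {-l..l} g" and g': "continuous_on {-l..l} g'"
    and d\<theta>: "\<And>x. x \<in> {-l<..<l} - S \<Longrightarrow> (\<theta> has_real_derivative v x) (at x)"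
    and dg: "\<And>x. x \<in> {-l<..<l} \<Longrightarrow> (g has_real_derivative g' x) (at x)"
    and dg': "\<And>x. x \<in> {-l<..<l} - S \<Longrightarrow> (g' has_real_derivative w x) (at x)"
    and Bv: "\<And>x. x \<in> {-l<..<l} - S \<Longrightarrow> \<bar>v x\<bar> \<le> B"
    and Bw: "\<And>x. x \<in> {-l<..<l} - S \<Longrightarrow> \<bar>w x\<bar> \<le> B"
    and per: "\<theta> (-l) = \<theta> l" "g (-l) = g l" "g' (-l) = g' l"
  shows "(\<theta>, g) \<in> Y_C l"
    and "AE x in leb_I l. weak_deriv l \<theta> x = v x \<and> weak_deriv l g x = g' x
      \<and> weak_deriv l (weak_deriv l g) x = w x"
proof -
  note wd\<theta> = piecewise_has_weak_deriv[OF l \<theta> S d\<theta> Bv]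
  have "bounded (g' ` {-l..l})" by (intro compact_imp_bounded compact_continuous_image g') auto
  then obtain G where G: "\<And>x. x \<in> {-l..l} \<Longrightarrow> \<bar>g' x\<bar> \<le> G"
    unfolding bounded_iff by (metis imageI real_norm_def)
  have wdg: "g' \<in> L2 l" "has_weak_deriv l g g'"
    using piecewise_has_weak_deriv[OF l g finite.emptyI dg, of G] G by auto
  note wdg' = piecewise_has_weak_deriv[OF l g' S dg' Bw]
  note ae = weak_deriv_AE[OF wdg] and gl2 = weak_deriv_L2[OF wdg]
  \<comment> \<open>The inner derivative is some representative, equal to \<open>g'\<close> only
    almost everywhere; the outer one does not notice the difference.\<close>
  have eq: "weak_deriv l (weak_deriv l g) = weak_deriv l g'"
    by (rule weak_deriv_cong[OF gl2 wdg(1) ae])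
  have "has_weak_deriv l (weak_deriv l g) w"
    using wdg'(2) has_weak_deriv_cong[OF gl2 wdg(1) ae] by simp
  with gl2 wdg'(1) have "weak_deriv l g \<in> W12 l" by (auto simp: W12_def)
  moreover have "g \<in> W12 l" "\<theta> \<in> W12 l"
    using wd\<theta> wdg L2_continuous[OF g] L2_continuous[OF \<theta>] by (auto simp: W12_def)
  moreover have "cont_rep l \<theta> x = \<theta> x" "cont_rep l g x = g x"
    "cont_rep l (weak_deriv l g) x = g' x" if "x \<in> {-l..l}" for x
    using cont_rep_eq[OF l \<theta> _ that] cont_rep_eq[OF l g _ that] cont_rep_eq[OF l g' ae that] by auto
  ultimately show "(\<theta>, g) \<in> Y_C l" using per l by (auto simp: Y_C_def W22_def)
  show "AE x in leb_I l. weak_deriv l \<theta> x = v x \<and> weak_deriv l g x = g' x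
      \<and> weak_deriv l (weak_deriv l g) x = w x"
    using weak_deriv_AE[OF wd\<theta>] ae weak_deriv_AE[OF wdg'] by (simp add: eq)
qed

lemma polynomial_Y_C:
  assumes l: "l > 0" and p: "real_polynomial_function p" "real_polynomial_function q"
    and z: "p (-l) = 0" "p l = 0" "q (-l) = 0" "q l = 0"
    and d: "\<And>D x. x \<in> {-l, l} \<Longrightarrow> (q has_real_derivative D) (at x) \<Longrightarrow> D = 0"
  shows "(p, q) \<in> Y_C l"
proof -
  obtain p' where p': "real_polynomial_function p'" "\<And>x. (p has_real_derivative p' x) (at x)"
    using has_real_derivative_polynomial_function[OF p(1)] by blast
  obtain q' where q': "real_polynomial_function q'" "\<And>x. (q has_real_derivative q' x) (at x)"
    using has_real_derivative_polynomial_function[OF p(2)] by blast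
  obtain q'' where q'': "real_polynomial_function q''" "\<And>x. (q' has_real_derivative q'' x) (at x)"
    using has_real_derivative_polynomial_function[OF q'(1)] by blast
  have c: "continuous_on A r" if "real_polynomial_function r" for r and A :: "real set"
    by (intro continuous_on_polymonial_function that[unfolded real_polynomial_function_eq])
  have "bounded (p' ` {-l..l})" "bounded (q'' ` {-l..l})"
    by (intro compact_imp_bounded compact_continuous_image c p' q'' compact_Icc)+
  then obtain B1 B2 where B: "\<forall>x\<in>{-l..l}. \<bar>p' x\<bar> \<le> B1" "\<forall>x\<in>{-l..l}. \<bar>q'' x\<bar> \<le> B2"
    unfolding bounded_iff by (metis imageI real_norm_def)
  have "q' (-l) = 0" "q' l = 0" using d q'(2) by blast+
  then show ?thesis
    by (intro Y_C_I(1)[OF l finite.emptyI, of p q q' p' q'' "max B1 B2"] c p p' q' q'')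
      (use z B in \<open>auto simp: le_max_iff_disj\<close>)
qed

section \<open>Primitives as test functions, and functions with vanishing weak derivative\<close>

text \<open>To the left of \<open>a\<close> nothing has been integrated yet, and to the right of
  \<open>b\<close> the whole mean of \<open>q\<close> has, which is zero. Hence the primitive has
  compact support.\<close>

lemma primitive_Cc1:
  assumes ab: "-l < a" "a \<le> b" "b < l" and qc: "continuous_on UNIV q"
    and q0: "\<And>x. x \<notin> {a..b} \<Longrightarrow> q x = 0" and mean: "(\<integral>x. q x \<partial>leb_I l) = 0"
  shows "(\<lambda>x. integral {-l..x} q) \<in> Cc1 l" "deriv (\<lambda>x. integral {-l..x} q) = q"
    and "\<And>x. x \<notin> {a..b} \<Longrightarrow> integral {-l..x} q = 0"
proof -
  have one: "(\<lambda>x. 1) \<in> L2 l" by (intro L2_continuous) auto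
  have "q \<in> L2 l" by (intro L2_continuous continuous_on_subset[OF qc]) auto
  then have iq: "integrable (leb_I l) q" using L2_mult_integrable[OF one] by simp
  then have "integral {-l..l} q = 0"
    using mean by (simp add: lebesgue_integral_eq_integral integral_open_interval_real)
  define Q where "Q x = integral {-l..x} q" for x
  have int: "q integrable_on {y..z}" for y z
    by (intro integrable_continuous_real continuous_on_subset[OF qc]) auto
  have Qb: "Q x = 0" if "x \<notin> {a..b}" for x
  proof (cases "x < a")
    case True
    have "integral {-l..x} q = integral {-l..x} (\<lambda>_. 0)"
      by (rule Henstock_Kurzweil_Integration.integral_cong) (use q0 True in auto)
    then show ?thesis by (simp add: Q_def)
  next
    case False
    then have "x > b" using that by auto
    \<comment> \<open>\<open>x\<close> may lie beyond \<open>l\<close>, whereas the vanishing mean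
      is that over \<open>{-l..l}\<close>. Splitting at \<open>min x l\<close>, which is to the
      right of \<open>b\<close> in either case, compares the two integrals.\<close>
    then have "-l \<le> min x l" "b < min x l" using ab by auto
    have z: "integral {y..z} q = 0" if "b < y" for y z
    proof -
      have "integral {y..z} q = integral {y..z} (\<lambda>_. 0)"
        by (rule Henstock_Kurzweil_Integration.integral_cong) (use q0 that in auto)
      then show ?thesis by simp
    qed
    have "integral {-l..min x l} q + integral {min x l..x} q = integral {-l..x} q"
      "integral {-l..min x l} q + integral {min x l..l} q = integral {-l..l} q"
      by (intro Henstock_Kurzweil_Integration.integral_combine int; use \<open>-l \<le> min x l\<close> in simp)+
    then show ?thesis using z \<open>b < min x l\<close> \<open>integral {-l..l} q = 0\<close> by (simp add: Q_def)
  qed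
  have Qd: "(Q has_real_derivative q x) (at x)" for x
  proof (cases "x > -l")
    case True
    have "(Q has_vector_derivative q x) (at x within {-l..x+1})"
      unfolding Q_def using True by (intro integral_has_vector_derivative continuous_on_subset[OF qc]) auto
    then show ?thesis using True
      by (simp add: has_real_derivative_iff_has_vector_derivative at_within_Icc_at)
  next
    case False
    then have "x \<in> {..< a}" using ab by auto
    then have "\<forall>\<^sub>F y in nhds x. Q y = 0"
      unfolding eventually_nhds by (intro exI[of _ "{..< a}"]) (auto intro!: Qb)
    moreover have "q x = 0" using q0 False ab by auto
    ultimately show ?thesis by (subst DERIV_cong_ev[where g="\<lambda>_. 0"]) auto
  qed
  show "(\<lambda>x. integral {-l..x} q) \<in> Cc1 l" "deriv (\<lambda>x. integral {-l..x} q) = q"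
    using Cc1I[OF Qd qc Qb ab(1,3)] by (auto simp: Q_def)
  show "integral {-l..x} q = 0" if "x \<notin> {a..b}" for x using Qb[OF that] by (simp add: Q_def)
qed

text \<open>The additional bound \<open>c \<le> b\<close> lets one interval \<open>{-b..b}\<close>
  contain both the support of \<psi> and that of a second function.\<close>

lemma Cc1_support:
  assumes "l > 0" and \<psi>: "\<psi> \<in> Cc1 l"
  obtains b where "0 < b" "b < l" "c < l \<Longrightarrow> c \<le> b" "\<And>x. x \<notin> {-b..b} \<Longrightarrow> \<psi> x = 0"
proof -
  let ?K = "closure {x. \<psi> x \<noteq> 0}"
  have K: "compact ?K" "?K \<subseteq> {-l<..<l}" using \<psi> by (auto simp: Cc1_def)
  obtain m where m: "m < l" "\<And>x. x \<in> ?K \<Longrightarrow> \<bar>x\<bar> \<le> m"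
  proof (cases "?K = {}")
    case False
    have "continuous_on ?K (\<lambda>x. \<bar>x\<bar>)" by (intro continuous_intros)
    from continuous_attains_sup[OF K(1) False this]
    obtain m where m: "m \<in> ?K" "\<And>x. x \<in> ?K \<Longrightarrow> \<bar>x\<bar> \<le> \<bar>m\<bar>" by blast
    have "\<bar>m\<bar> < l" using m(1) K(2) by fastforce
    then show ?thesis using that m(2) by blast
  qed (use that[of 0] \<open>l > 0\<close> in auto)
  define c' where "c' = (if c < l then max c (l/2) else l/2)"
  show ?thesis
  proof (rule that[of "max m c'"])
    show "\<psi> x = 0" if "x \<notin> {- max m c'..max m c'}" for x
      using m(2)[of x] closure_subset[of "{x. \<psi> x \<noteq> 0}"] that by fastforce
  qed (use m \<open>l > 0\<close> in \<open>auto simp: c'_def\<close>)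
qed

text \<open>The du Bois-Reymond argument. From a test function \<psi> the multiple of a fixed bump
  \<rho> with the same integral is subtracted; the difference has a primitive that is again a test
  function. Testing the weak derivative with it shows that the integral of \<open>u * \<psi>\<close>
  is \<open>k\<close> times that of \<psi>, so \<open>u - k\<close> is orthogonal to all test
  functions.\<close>

lemma weak_deriv_AE_const:
  assumes l: "l > 0" and u: "u \<in> L2 l" and v: "v \<in> L2 l" and d: "has_weak_deriv l u v"
    and ae: "AE x in leb_I l. v x = 0"
  obtains k where "AE x in leb_I l. u x = k"
proof -
  \<comment> \<open>The double zeros at \<plusminus>\<open>l/2\<close> make the zero extension
    differentiable, and \<open>f 0 > 0\<close> keeps its mass \<open>R\<close> from
    vanishing.\<close>
  define f where "f x = (x - l/2)^2 * (x + l/2)^2" for x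
  define f' where "f' x = 2 * (x - l/2) * (x + l/2)^2 + 2 * (x - l/2)^2 * (x + l/2)" for x
  define \<rho> where "\<rho> x = (if x \<in> {-l/2..l/2} then f x else 0)" for x
  have "(f has_real_derivative f' x) (at x)" for x
    unfolding f_def f'_def by (rule derivative_eq_intros refl | simp)+
  from has_derivative_zero_extension[OF this, of "-l/2" "l/2"]
  have \<rho>d: "(\<rho> has_real_derivative (if x \<in> {-l/2..l/2} then f' x else 0)) (at x)" for x
    unfolding \<rho>_def using l by (auto simp: f_def f'_def)
  have \<rho>c: "continuous_on UNIV \<rho>" using \<rho>d by (meson DERIV_isCont continuous_at_imp_continuous_on)
  have \<rho>L2: "\<rho> \<in> L2 l" by (intro L2_continuous continuous_on_subset[OF \<rho>c]) auto
  have one: "(\<lambda>x. 1) \<in> L2 l" by (intro L2_continuous) auto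
  have i\<rho>: "integrable (leb_I l) \<rho>" using L2_mult_integrable[OF one \<rho>L2] by simp
  have \<rho>nn: "0 \<le> \<rho> x" for x by (auto simp: \<rho>_def f_def)
  define R where "R = (\<integral>x. \<rho> x \<partial>leb_I l)"
  have "R \<noteq> 0"
  proof
    assume "R = 0"
    then have "AE x in leb_I l. \<rho> x = 0"
      using integral_nonneg_eq_0_iff_AE[OF i\<rho>] \<rho>nn by (simp add: R_def)
    then have "cont_rep l \<rho> 0 = 0" by (intro cont_rep_eq[where u="\<lambda>_. 0"]) (use l in auto)
    moreover have "cont_rep l \<rho> 0 = \<rho> 0"
      by (intro cont_rep_eq continuous_on_subset[OF \<rho>c]) (use l in auto)
    ultimately show False using l by (auto simp: \<rho>_def f_def)
  qed
  define k where "k = (\<integral>x. u x * \<rho> x \<partial>leb_I l) / R"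
  have "AE x in leb_I l. u x - k = 0"
  proof (rule fundamental_lemma)
    have "(\<lambda>x. u x - k) \<in> L2 l" by (intro L2_diff[OF u] L2_continuous) auto
    then show "(\<lambda>x. u x - k) \<in> borel_measurable (leb_I l)" "integrable (leb_I l) (\<lambda>x. (u x - k)^2)"
      by (auto simp: L2_def)
    fix \<psi> assume \<psi>: "\<psi> \<in> Cc1 l"
    have i\<psi>: "integrable (leb_I l) \<psi>" using L2_mult_integrable[OF one Cc1_L2(1)[OF \<psi>]] by simp
    obtain b where b: "0 < b" "b < l" "l / 2 \<le> b" "\<And>x. x \<notin> {-b..b} \<Longrightarrow> \<psi> x = 0"
      by (rule Cc1_support[OF l \<psi>, of "l/2"]) (use l in auto)
    define c where "c = (\<integral>x. \<psi> x \<partial>leb_I l) / R"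
    define q where "q x = \<psi> x - c * \<rho> x" for x
    have qc: "continuous_on UNIV q"
      unfolding q_def by (intro continuous_intros \<rho>c Cc1_continuous[OF \<psi>])
    have q0: "q x = 0" if "x \<notin> {-b..b}" for x using b that by (auto simp: q_def \<rho>_def)
    have "(\<integral>x. q x \<partial>leb_I l) = 0"
      unfolding q_def using i\<psi> i\<rho> \<open>R \<noteq> 0\<close> by (simp add: c_def flip: R_def)
    note this
    moreover have "-l < -b" "-b \<le> b" using b by auto
    ultimately have Q: "(\<lambda>x. integral {-l..x} q) \<in> Cc1 l" "deriv (\<lambda>x. integral {-l..x} q) = q"
      using primitive_Cc1[OF _ _ b(2) qc q0] by blast+
    define Q where "Q x = integral {-l..x} q" for x
    have QC: "Q \<in> Cc1 l" "deriv Q = q" using Q unfolding Q_def by auto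
    have "(\<integral>x. u x * q x \<partial>leb_I l) = - (\<integral>x. v x * Q x \<partial>leb_I l)"
      using d QC by (auto simp: has_weak_deriv_def)
    also have "(\<integral>x. v x * Q x \<partial>leb_I l) = 0"
      by (rule integral_eq_zero_AE) (use ae in \<open>auto elim: eventually_mono\<close>)
    finally have "0 = (\<integral>x. u x * q x \<partial>leb_I l)" by simp
    also have "\<dots> = (\<integral>x. u x * \<psi> x - c * (u x * \<rho> x) \<partial>leb_I l)"
      by (simp add: q_def algebra_simps)
    also have "\<dots> = (\<integral>x. u x * \<psi> x \<partial>leb_I l) - c * (\<integral>x. u x * \<rho> x \<partial>leb_I l)"
      using L2_mult_integrable[OF u Cc1_L2(1)[OF \<psi>]] L2_mult_integrable[OF u \<rho>L2] by simp
    also have "c * (\<integral>x. u x * \<rho> x \<partial>leb_I l) = k * (\<integral>x. \<psi> x \<partial>leb_I l)"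
      by (simp add: c_def k_def)
    finally have "(\<integral>x. u x * \<psi> x \<partial>leb_I l) - k * (\<integral>x. \<psi> x \<partial>leb_I l) = 0" by simp
    moreover have "(\<integral>x. (u x - k) * \<psi> x \<partial>leb_I l) = (\<integral>x. u x * \<psi> x - k * \<psi> x \<partial>leb_I l)"
      by (simp add: algebra_simps)
    ultimately show "(\<integral>x. (u x - k) * \<psi> x \<partial>leb_I l) = 0"
      using L2_mult_integrable[OF u Cc1_L2(1)[OF \<psi>]] i\<psi> by simp
  qed
  then show ?thesis using that[of k] by simp
qed

section \<open>Total variation of two-valued functions\<close>

text \<open>A continuous bump cannot be supported in a merely measurable set \<open>A\<close>, but
  it can carry nearly all of its mass there: take the positive part of a polynomial close to the
  indicator of \<open>A\<close> in the L1 norm, and normalise.\<close>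

lemma bump_concentrated:
  fixes e :: real
  assumes ab: "-l < a" "a < b" "b < l" and A: "A \<in> sets (leb_I l)" "A \<subseteq> {a<..<b}"
    and pos: "\<not> (AE x in leb_I l. x \<notin> A)" and "e > 0"
  obtains \<rho> where "continuous_on UNIV \<rho>" "\<And>x. 0 \<le> \<rho> x" "\<And>x. x \<notin> {a..b} \<Longrightarrow> \<rho> x = 0"
    "(\<integral>x. \<rho> x \<partial>leb_I l) = 1" "(\<integral>x. indicator (- A) x * \<rho> x \<partial>leb_I l) \<le> e"
proof -
  let ?f = "indicator A :: real \<Rightarrow> real"
  have sub: "{a<..<b} \<subseteq> {-l<..<l}" using ab by auto
  have fm: "?f \<in> borel_measurable (leb_I l)" using A by simp
  have fi: "integrable (leb_I l) ?f"
    by (rule integrable_bounded_interval[OF fm, of 1]) (auto simp: indicator_def)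
  define m where "m = (\<integral>x. ?f x \<partial>leb_I l)"
  have "m \<noteq> 0"
  proof
    assume "m = 0"
    then have "AE x in leb_I l. ?f x = 0"
      using integral_nonneg_eq_0_iff_AE[OF fi] by (simp add: m_def)
    then show False using pos by (simp add: indicator_eq_0_iff)
  qed
  moreover have "0 \<le> m" unfolding m_def by (rule integral_nonneg_AE) auto
  ultimately have m: "0 < m" by simp
  \<comment> \<open>The first bound keeps the mass \<open>c\<close> before normalisation at least
    \<open>m / 2\<close>; then the second, \<open>m * e / 2\<close>, is at most
    \<open>c * e\<close>, so after division by \<open>c\<close> the mass outside \<open>A\<close> is
    at most \<open>e\<close>.\<close>
  define e' where "e' = min (m / 2) (m * e / 2)"
  have e': "0 < e'" using m \<open>e > 0\<close> by (auto simp: e'_def)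
  have fm': "?f \<in> borel_measurable (lebesgue_on {a<..<b})"
    by (rule measurable_subinterval_lebesgue[OF sub fm])
  have fi': "integrable (lebesgue_on {a<..<b}) (\<lambda>x. \<bar>?f x\<bar>^1)"
    using integrable_subinterval_lebesgue[OF sub fi] by simp
  obtain r where r: "real_polynomial_function r" "r a = 0" "r b = 0"
    "(\<integral>x. \<bar>?f x - r x\<bar>^1 \<partial>lebesgue_on {a<..<b}) < e'"
    by (rule polynomial_dense[where p=1, OF ab(2) _ fm' fi' e']) (simp, blast)
  define \<rho> where "\<rho> x = max 0 (r (max a (min b x)))" for x
  have \<rho>c: "continuous_on UNIV \<rho>" unfolding \<rho>_def
    by (intro continuous_intros
        continuous_on_compose2[OF continuous_on_polymonial_function[OF r(1)[unfolded real_polynomial_function_eq]]]) auto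
  have \<rho>0: "\<rho> x = 0" if "x \<notin> {a..b}" for x using that r ab by (auto simp: \<rho>_def max_def min_def)
  have \<rho>r: "\<rho> x = max 0 (r x)" if "x \<in> {a..b}" for x using that by (auto simp: \<rho>_def max_def min_def)
  have \<rho>nn: "0 \<le> \<rho> x" for x by (simp add: \<rho>_def)
  have one: "(\<lambda>x. 1) \<in> L2 l" by (intro L2_continuous) auto
  have "\<rho> \<in> L2 l" by (intro L2_continuous continuous_on_subset[OF \<rho>c]) auto
  then have i\<rho>: "integrable (leb_I l) \<rho>" using L2_mult_integrable[OF one] by simp
  have ic: "integrable (leb_I l) (\<lambda>x. indicator (- A) x * \<rho> x)"
  proof (rule Bochner_Integration.integrable_bound[OF i\<rho>])
    have "(\<lambda>x. indicator (- A) x * \<rho> x) = (\<lambda>x. \<rho> x - ?f x * \<rho> x)"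
      by (auto simp: indicator_def)
    then show "(\<lambda>x. indicator (- A) x * \<rho> x) \<in> borel_measurable (leb_I l)"
      using fm i\<rho> by simp
  qed (auto simp: indicator_def)
  have rm: "r \<in> borel_measurable (lebesgue_on {a<..<b})"
    by (intro continuous_on_measurable_interval continuous_on_polymonial_function
        r(1)[unfolded real_polynomial_function_eq])
  have ifr: "integrable (lebesgue_on {a<..<b}) (\<lambda>x. \<bar>?f x - r x\<bar>)"
  proof -
    have "bounded (r ` {a..b})"
      by (intro compact_imp_bounded compact_continuous_image continuous_on_polymonial_function
          r(1)[unfolded real_polynomial_function_eq]) auto
    then obtain B where B: "\<And>x. x \<in> {a..b} \<Longrightarrow> \<bar>r x\<bar> \<le> B"
      unfolding bounded_iff by (metis imageI real_norm_def)
    have "integrable (lebesgue_on {a<..<b}) r"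
      by (rule integrable_bounded_interval[OF rm, of B]) (rule AE_I2, use B in auto)
    then show ?thesis using fi' by (intro integrable_abs Bochner_Integration.integrable_diff) auto
  qed
  have err: "(\<integral>x. \<bar>?f x - \<rho> x\<bar> \<partial>leb_I l) < e'"
  proof -
    have "(\<integral>x. \<bar>?f x - \<rho> x\<bar> \<partial>leb_I l)
        = (\<integral>x. indicator {a<..<b} x * \<bar>?f x - \<rho> x\<bar> \<partial>leb_I l)"
    proof (rule Bochner_Integration.integral_cong)
      fix x
      show "\<bar>?f x - \<rho> x\<bar> = indicator {a<..<b} x * \<bar>?f x - \<rho> x\<bar>"
      proof (cases "x \<in> {a<..<b}")
        case False
        then have "x \<notin> {a..b} \<or> x = a \<or> x = b" by auto
        then have "\<rho> x = 0" using \<rho>0[of x] \<rho>r[of a] \<rho>r[of b] r(2,3) ab by auto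
        moreover have "x \<notin> A" using False A(2) by blast
        ultimately show ?thesis by simp
      qed simp
    qed simp
    also have "\<dots> = (\<integral>x. \<bar>?f x - \<rho> x\<bar> \<partial>lebesgue_on {a<..<b})"
      by (rule interval_restrict(1)[OF sub, symmetric])
    \<comment> \<open>The indicator is nonnegative, so passing to the positive part of
      \<open>r\<close> only brings the approximation closer.\<close>
    also have "\<dots> \<le> (\<integral>x. \<bar>?f x - r x\<bar> \<partial>lebesgue_on {a<..<b})"
      by (rule integral_mono_AE'[OF ifr]) (auto intro!: AE_I2 simp: \<rho>r indicator_def)
    finally show ?thesis using r(4) by simp
  qed
  have ife: "integrable (leb_I l) (\<lambda>x. \<bar>?f x - \<rho> x\<bar>)" using fi i\<rho> by auto
  define c where "c = (\<integral>x. \<rho> x \<partial>leb_I l)"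
  have "m - c = (\<integral>x. ?f x - \<rho> x \<partial>leb_I l)" using fi i\<rho> by (simp add: m_def c_def)
  also have "\<dots> \<le> (\<integral>x. \<bar>?f x - \<rho> x\<bar> \<partial>leb_I l)"
    by (rule integral_mono) (use ife fi i\<rho> in auto)
  finally have c: "m / 2 \<le> c" using err e'_def by linarith
  then have "c > 0" using m by linarith
  have "(\<integral>x. indicator (- A) x * \<rho> x \<partial>leb_I l) \<le> (\<integral>x. \<bar>?f x - \<rho> x\<bar> \<partial>leb_I l)"
    by (rule integral_mono[OF ic ife]) (use \<rho>nn in \<open>auto simp: indicator_def\<close>)
  then have "(\<integral>x. indicator (- A) x * \<rho> x \<partial>leb_I l) \<le> m * e / 2" using err e'_def by linarith
  also have "\<dots> \<le> c * e" using c \<open>e > 0\<close> by (simp add: mult_right_mono)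
  finally have bd: "(\<integral>x. indicator (- A) x * \<rho> x \<partial>leb_I l) / c \<le> e"
    using \<open>c > 0\<close> by (simp add: divide_le_eq mult.commute)
  show ?thesis
  proof (rule that[of "\<lambda>x. \<rho> x / c"])
    show "continuous_on UNIV (\<lambda>x. \<rho> x / c)" using \<open>c > 0\<close> by (intro continuous_intros \<rho>c) auto
    show "(\<integral>x. \<rho> x / c \<partial>leb_I l) = 1" using \<open>c > 0\<close> by (simp add: c_def)
    show "(\<integral>x. indicator (- A) x * (\<rho> x / c) \<partial>leb_I l) \<le> e" using bd by simp
  qed (use \<open>c > 0\<close> \<rho>0 \<rho>nn in auto)
qed

text \<open>The test function is the primitive of \<open>\<rho>1 - \<rho>2\<close>, where \<open>\<rho>1\<close> and \<open>\<rho>2\<close> are bumps of mass 1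
  concentrated on \<open>{u = q}\<close> and \<open>{u = p}\<close>. It is bounded by 1 however the two bumps overlap,
  because both cumulative masses lie in \<open>[0, 1]\<close>.\<close>

lemma two_value_test:
  fixes u :: "real \<Rightarrow> real" and e p q :: real
  assumes ab: "-l < a" "a < b" "b < l" and um: "u \<in> borel_measurable (leb_I l)"
    and two: "AE x in leb_I l. u x \<in> {p, q}" and "p < q"
    and mixp: "\<not> (AE x in leb_I l. a < x \<and> x < b \<longrightarrow> u x \<noteq> p)"
    and mixq: "\<not> (AE x in leb_I l. a < x \<and> x < b \<longrightarrow> u x \<noteq> q)" and "e > 0"
  obtains \<phi> where "\<phi> \<in> Cc1 l" "\<And>x. \<bar>\<phi> x\<bar> \<le> 1" "\<And>x. x \<notin> {a..b} \<Longrightarrow> \<phi> x = 0"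
    "q - p - e \<le> (\<integral>x. u x * deriv \<phi> x \<partial>leb_I l)"
proof -
  define A where "A s = {x. a < x \<and> x < b \<and> u x = s}" for s
  have As: "A s \<in> sets (leb_I l)" for s
  proof -
    have "A s = (u -` {s} \<inter> space (leb_I l)) \<inter> {a<..<b}" using ab by (auto simp: A_def)
    moreover have "u -` {s} \<inter> space (leb_I l) \<in> sets (leb_I l)" using um by (rule borel_measurable_vimage)
    moreover have "{a<..<b} \<in> sets (leb_I l)" using ab by (auto simp: sets_restrict_space_iff)
    ultimately show ?thesis by auto
  qed
  have Asub: "A s \<subseteq> {a<..<b}" for s by (auto simp: A_def)
  \<comment> \<open>Each bump has mass at most \<open>d\<close> off its target set, and there
    \<open>u\<close> is wrong by at most \<open>q - p\<close>; the two losses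
    \<open>(q - p) * d\<close> add up to \<open>e\<close>.\<close>
  define d where "d = e / (2 * (q - p))"
  have "d > 0" using \<open>e > 0\<close> \<open>p < q\<close> by (simp add: d_def)
  have pos: "\<not> (AE x in leb_I l. x \<notin> A s)" if "\<not> (AE x in leb_I l. a < x \<and> x < b \<longrightarrow> u x \<noteq> s)" for s
  proof
    assume "AE x in leb_I l. x \<notin> A s"
    then have "AE x in leb_I l. a < x \<and> x < b \<longrightarrow> u x \<noteq> s"
      by eventually_elim (auto simp: A_def)
    then show False using that by blast
  qed
  obtain \<rho>1 where
    1: "continuous_on UNIV \<rho>1" "\<And>x. 0 \<le> \<rho>1 x" "\<And>x. x \<notin> {a..b} \<Longrightarrow> \<rho>1 x = 0"
      "(\<integral>x. \<rho>1 x \<partial>leb_I l) = 1" "(\<integral>x. indicator (- A q) x * \<rho>1 x \<partial>leb_I l) \<le> d"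
    by (rule bump_concentrated[OF ab As Asub pos[OF mixq] \<open>d > 0\<close>]) blast
  obtain \<rho>2 where
    2: "continuous_on UNIV \<rho>2" "\<And>x. 0 \<le> \<rho>2 x" "\<And>x. x \<notin> {a..b} \<Longrightarrow> \<rho>2 x = 0"
      "(\<integral>x. \<rho>2 x \<partial>leb_I l) = 1" "(\<integral>x. indicator (- A p) x * \<rho>2 x \<partial>leb_I l) \<le> d"
    by (rule bump_concentrated[OF ab As Asub pos[OF mixp] \<open>d > 0\<close>]) blast
  define r where "r x = \<rho>1 x - \<rho>2 x" for x
  have rc: "continuous_on UNIV r" unfolding r_def by (intro continuous_intros 1 2)
  have r0: "r x = 0" if "x \<notin> {a..b}" for x using 1 2 that by (simp add: r_def)
  have one: "(\<lambda>x. 1) \<in> L2 l" by (intro L2_continuous) auto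
  have L: "\<rho>1 \<in> L2 l" "\<rho>2 \<in> L2 l"
    by (intro L2_continuous continuous_on_subset[OF 1(1)] continuous_on_subset[OF 2(1)]; simp)+
  then have i: "integrable (leb_I l) \<rho>1" "integrable (leb_I l) \<rho>2"
    using L2_mult_integrable[OF one] by simp_all
  have "(\<integral>x. r x \<partial>leb_I l) = 0" using i 1(4) 2(4) by (simp add: r_def)
  note \<phi> = primitive_Cc1[OF ab(1) less_imp_le[OF ab(2)] ab(3) rc r0 this]
  have "u \<in> L2 l"
    by (rule L2_bounded[OF um, of "max \<bar>p\<bar> \<bar>q\<bar>"]) (use two in \<open>auto elim: eventually_mono\<close>)
  then have iu: "integrable (leb_I l) (\<lambda>x. u x * \<rho>1 x)" "integrable (leb_I l) (\<lambda>x. u x * \<rho>2 x)"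
    using L2_mult_integrable L by blast+
  have ic: "integrable (leb_I l) (\<lambda>x. indicator (- A s) x * \<rho> x)"
    if "integrable (leb_I l) \<rho>" for s and \<rho> :: "real \<Rightarrow> real"
  proof (rule Bochner_Integration.integrable_bound[OF that])
    have "(\<lambda>x. indicator (- A s) x * \<rho> x) = (\<lambda>x. \<rho> x - indicator (A s) x * \<rho> x)"
      by (auto simp: indicator_def)
    then show "(\<lambda>x. indicator (- A s) x * \<rho> x) \<in> borel_measurable (leb_I l)"
      using As that by simp
  qed (auto simp: indicator_def)
  have "q - (q - p) * d \<le> q * (\<integral>x. \<rho>1 x \<partial>leb_I l) - (q - p) * (\<integral>x. indicator (- A q) x * \<rho>1 x \<partial>leb_I l)"
    using 1(4,5) \<open>p < q\<close> by (simp add: mult_left_mono)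
  also have "\<dots> = (\<integral>x. q * \<rho>1 x - (q - p) * (indicator (- A q) x * \<rho>1 x) \<partial>leb_I l)"
    using i ic by simp
  also have "\<dots> \<le> (\<integral>x. u x * \<rho>1 x \<partial>leb_I l)"
  proof (rule integral_mono_AE)
    show "AE x in leb_I l. q * \<rho>1 x - (q - p) * (indicator (- A q) x * \<rho>1 x) \<le> u x * \<rho>1 x"
      using two
    proof eventually_elim
      case (elim x)
      consider "x \<in> A q" | "x \<notin> {a..b} \<or> x = a \<or> x = b \<or> u x = p" "x \<notin> A q"
        using elim by (force simp: A_def)
      then show ?case
      proof cases
        case 1
        then show ?thesis by (simp add: A_def)
      next
        case 2
        then have "indicator (- A q) x = (1::real)" by simp
        moreover have "p * \<rho>1 x \<le> u x * \<rho>1 x"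
          using elim \<open>p < q\<close> 1(2)[of x] by (intro mult_right_mono) auto
        ultimately show ?thesis by (simp add: algebra_simps)
      qed
    qed
  qed (use i ic iu in auto)
  finally have one': "q - (q - p) * d \<le> (\<integral>x. u x * \<rho>1 x \<partial>leb_I l)" .
  have "(\<integral>x. u x * \<rho>2 x \<partial>leb_I l) \<le> (\<integral>x. p * \<rho>2 x + (q - p) * (indicator (- A p) x * \<rho>2 x) \<partial>leb_I l)"
  proof (rule integral_mono_AE)
    show "AE x in leb_I l. u x * \<rho>2 x \<le> p * \<rho>2 x + (q - p) * (indicator (- A p) x * \<rho>2 x)"
      using two
    proof eventually_elim
      case (elim x)
      show ?case
      proof (cases "x \<in> A p")
        case True
        then show ?thesis by (simp add: A_def)
      next
        case False
        then have "indicator (- A p) x = (1::real)" by simp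
        moreover have "u x * \<rho>2 x \<le> q * \<rho>2 x"
          using elim \<open>p < q\<close> 2(2)[of x] by (intro mult_right_mono) auto
        ultimately show ?thesis by (simp add: algebra_simps)
      qed
    qed
  qed (use i ic iu in auto)
  also have "\<dots> = p * (\<integral>x. \<rho>2 x \<partial>leb_I l) + (q - p) * (\<integral>x. indicator (- A p) x * \<rho>2 x \<partial>leb_I l)"
    using i ic by simp
  also have "\<dots> \<le> p + (q - p) * d"
    using 2(4,5) \<open>p < q\<close> by (simp add: mult_left_mono)
  finally have two': "(\<integral>x. u x * \<rho>2 x \<partial>leb_I l) \<le> p + (q - p) * d" .
  have "(q - p) * d = e / 2" using \<open>p < q\<close> by (simp add: d_def field_simps)
  moreover have "(\<integral>x. u x * r x \<partial>leb_I l) = (\<integral>x. u x * \<rho>1 x \<partial>leb_I l) - (\<integral>x. u x * \<rho>2 x \<partial>leb_I l)"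
    using iu by (simp add: r_def right_diff_distrib)
  ultimately have main: "q - p - e \<le> (\<integral>x. u x * r x \<partial>leb_I l)" using one' two' by linarith
  have int: "f integrable_on {y..z}" if "continuous_on UNIV f" for f :: "real \<Rightarrow> real" and y z
    by (intro integrable_continuous_real continuous_on_subset[OF that]) auto
  have "\<bar>integral {-l..x} r\<bar> \<le> 1" for x
  proof (cases "x \<in> {a..b}")
    case True
    have "0 \<le> integral {-l..x} f \<and> integral {-l..x} f \<le> 1"
      if "continuous_on UNIV f" "\<And>x. 0 \<le> f x" "integrable (leb_I l) f" "(\<integral>x. f x \<partial>leb_I l) = 1" for f :: "real \<Rightarrow> real"
    proof -
      have "integral {-l..x} f \<le> integral {-l..l} f"
        by (rule integral_subset_le[OF _ int[OF that(1)] int[OF that(1)]]) (use True ab that(2) in auto)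
      also have "\<dots> = 1"
        using that(4) lebesgue_integral_eq_integral[OF that(3)] integral_open_interval_real[of "-l" l f]
        by simp
      finally show ?thesis
        using Henstock_Kurzweil_Integration.integral_nonneg[OF int[OF that(1)]] that(2) by blast
    qed
    from this[OF 1(1,2) i(1) 1(4)] this[OF 2(1,2) i(2) 2(4)]
    have "0 \<le> integral {-l..x} \<rho>1" "integral {-l..x} \<rho>1 \<le> 1"
      "0 \<le> integral {-l..x} \<rho>2" "integral {-l..x} \<rho>2 \<le> 1" by auto
    moreover have "integral {-l..x} r = integral {-l..x} \<rho>1 - integral {-l..x} \<rho>2"
      unfolding r_def by (intro Henstock_Kurzweil_Integration.integral_diff int 1 2)
    ultimately show ?thesis by linarith
  qed (use \<phi>(3) in simp)
  then show ?thesis using that[of "\<lambda>x. integral {-l..x} r"] \<phi> main by auto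
qed

section \<open>Lower bound for the total variation by counting points\<close>

lemma eventually_at_right_0_less: "c > 0 \<Longrightarrow> \<forall>\<^sub>F x in at_right 0. x < (c::real)"
  unfolding eventually_at_right_field by blast

lemma finite_separation:
  fixes F :: "real set"
  assumes "finite F" "F \<subseteq> {a<..<b}"
  obtains d where "d > 0" "\<And>t. t \<in> F \<Longrightarrow> a + 2 * d < t \<and> t < b - 2 * d"
    "\<And>s t. s \<in> F \<Longrightarrow> t \<in> F \<Longrightarrow> s < t \<Longrightarrow> s + 2 * d < t"
proof -
  have "\<forall>\<^sub>F d in at_right 0. \<forall>t\<in>F. a + 2 * d < t \<and> t < b - 2 * d \<and> (\<forall>s\<in>F. s < t \<longrightarrow> s + 2 * d < t)"
  proof (intro eventually_ball_finite assms ballI eventually_conj)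
    fix t assume "t \<in> F"
    then have "(t - a) / 2 > 0" "(b - t) / 2 > 0" using assms(2) by auto
    from this[THEN eventually_at_right_0_less]
    show "\<forall>\<^sub>F d in at_right 0. a + 2 * d < t" "\<forall>\<^sub>F d in at_right 0. t < b - 2 * d"
      by (auto elim: eventually_mono)
    fix s
    show "\<forall>\<^sub>F d in at_right 0. s < t \<longrightarrow> s + 2 * d < t"
    proof (cases "s < t")
      case True
      then have "(t - s) / 2 > 0" by simp
      from eventually_at_right_0_less[OF this] show ?thesis by (auto elim!: eventually_mono)
    qed auto
  qed
  moreover have "\<forall>\<^sub>F d in at_right (0::real). 0 < d" by (rule eventually_at_right_less)
  ultimately have "\<forall>\<^sub>F d in at_right 0. 0 < d \<and> (\<forall>t\<in>F. a + 2 * d < t \<and> t < b - 2 * d \<and> (\<forall>s\<in>F. s < t \<longrightarrow> s + 2 * d < t))"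
    by eventually_elim auto
  from eventually_happens'[OF trivial_limit_at_right_real this] show ?thesis using that by blast
qed

text \<open>Near each point of \<open>F\<close> the function takes both values on sets of positive
  measure, for otherwise it would be a.e. constant there. So \<open>two_value_test\<close> applies
  on each \<open>{t-d..t+d}\<close>. These intervals are disjoint, whence the sum of the test
  functions is still bounded by 1 while their contributions add.\<close>

lemma total_variation_lower_bound:
  fixes u :: "real \<Rightarrow> real" and p q :: real
  assumes um: "u \<in> borel_measurable (leb_I l)" and two: "AE x in leb_I l. u x \<in> {p, q}" and "p < q"
    and F: "finite F" "F \<subseteq> {-l<..<l}"
    and mix: "\<And>t \<delta> c. t \<in> F \<Longrightarrow> \<delta> > 0 \<Longrightarrow> \<not> (AE x in leb_I l. \<bar>x - t\<bar> < \<delta> \<longrightarrow> u x = c)"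
  shows "ennreal (card F * (q - p)) \<le> total_variation l u"
proof (rule ennreal_le_epsilon)
  fix e :: real assume "e > 0"
  obtain d where d: "d > 0" "\<And>t. t \<in> F \<Longrightarrow> -l + 2 * d < t \<and> t < l - 2 * d"
    "\<And>s t. s \<in> F \<Longrightarrow> t \<in> F \<Longrightarrow> s < t \<Longrightarrow> s + 2 * d < t"
    using finite_separation[OF F] by blast
  \<comment> \<open>The \<open>+ 1\<close> covers empty \<open>F\<close> and leaves a total error of
    at most \<open>e\<close>.\<close>
  define e' where "e' = e / (card F + 1)"
  have "e' > 0" using \<open>e > 0\<close> by (simp add: e'_def)
  have "\<exists>\<phi>. \<phi> \<in> Cc1 l \<and> (\<forall>x. \<bar>\<phi> x\<bar> \<le> 1) \<and> (\<forall>x. x \<notin> {t-d..t+d} \<longrightarrow> \<phi> x = 0) \<and>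
    q - p - e' \<le> (\<integral>x. u x * deriv \<phi> x \<partial>leb_I l)" if t: "t \<in> F" for t
  proof -
    have mp: "\<not> (AE x in leb_I l. t - d < x \<and> x < t + d \<longrightarrow> u x \<noteq> p)"
    proof
      assume "AE x in leb_I l. t - d < x \<and> x < t + d \<longrightarrow> u x \<noteq> p"
      with two have "AE x in leb_I l. \<bar>x - t\<bar> < d \<longrightarrow> u x = q" by eventually_elim auto
      then show False using mix t d(1) by blast
    qed
    have mq: "\<not> (AE x in leb_I l. t - d < x \<and> x < t + d \<longrightarrow> u x \<noteq> q)"
    proof
      assume "AE x in leb_I l. t - d < x \<and> x < t + d \<longrightarrow> u x \<noteq> q"
      with two have "AE x in leb_I l. \<bar>x - t\<bar> < d \<longrightarrow> u x = p" by eventually_elim auto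
      then show False using mix t d(1) by blast
    qed
    show ?thesis
      by (rule two_value_test[OF _ _ _ um two \<open>p < q\<close> mp mq \<open>e' > 0\<close>]) (use d(1) d(2)[OF t] in auto)
  qed
  then have "\<forall>t\<in>F. \<exists>\<phi>. \<phi> \<in> Cc1 l \<and> (\<forall>x. \<bar>\<phi> x\<bar> \<le> 1) \<and> (\<forall>x. x \<notin> {t-d..t+d} \<longrightarrow> \<phi> x = 0) \<and>
    q - p - e' \<le> (\<integral>x. u x * deriv \<phi> x \<partial>leb_I l)" by blast
  from bchoice[OF this] obtain \<phi> where \<phi>0: "\<forall>t\<in>F. \<phi> t \<in> Cc1 l \<and> (\<forall>x. \<bar>\<phi> t x\<bar> \<le> 1)
    \<and> (\<forall>x. x \<notin> {t-d..t+d} \<longrightarrow> \<phi> t x = 0)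
    \<and> q - p - e' \<le> (\<integral>x. u x * deriv (\<phi> t) x \<partial>leb_I l)" by blast
  then have \<phi>: "\<And>t. t \<in> F \<Longrightarrow> \<phi> t \<in> Cc1 l" "\<And>t x. t \<in> F \<Longrightarrow> \<bar>\<phi> t x\<bar> \<le> 1"
    "\<And>t x. t \<in> F \<Longrightarrow> x \<notin> {t-d..t+d} \<Longrightarrow> \<phi> t x = 0"
    "\<And>t. t \<in> F \<Longrightarrow> q - p - e' \<le> (\<integral>x. u x * deriv (\<phi> t) x \<partial>leb_I l)" by blast+
  define \<psi> where "\<psi> x = (\<Sum>t\<in>F. \<phi> t x)" for x
  define \<psi>' where "\<psi>' x = (\<Sum>t\<in>F. deriv (\<phi> t) x)" for x
  have "(\<psi> has_real_derivative \<psi>' x) (at x)" for x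
    unfolding \<psi>_def \<psi>'_def by (intro DERIV_sum Cc1_deriv[where l=l] \<phi>)
  moreover have "continuous_on UNIV \<psi>'"
    unfolding \<psi>'_def by (intro continuous_on_sum Cc1_continuous_deriv[where l=l] \<phi>)
  moreover have "\<psi> x = 0" if "x \<notin> {-l+d..l-d}" for x
    unfolding \<psi>_def
  proof (rule sum.neutral, rule ballI)
    fix t assume "t \<in> F"
    then show "\<phi> t x = 0" using d(2)[of t] that by (intro \<phi>(3)) auto
  qed
  ultimately have \<psi>: "\<psi> \<in> Cc1 l" "deriv \<psi> = \<psi>'"
    using Cc1I[of \<psi> \<psi>' "-l+d" "l-d" l] d(1) by auto
  have bd: "\<bar>\<psi> x\<bar> \<le> 1" for x
  proof (cases "\<exists>t\<in>F. x \<in> {t-d..t+d}")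
    case True
    then obtain t where t: "t \<in> F" "x \<in> {t-d..t+d}" by blast
    have "\<psi> x = \<phi> t x + (\<Sum>s\<in>F-{t}. \<phi> s x)"
      unfolding \<psi>_def using F t by (simp add: sum.remove)
    also have "(\<Sum>s\<in>F-{t}. \<phi> s x) = 0"
    proof (rule sum.neutral, rule ballI)
      fix s assume s: "s \<in> F - {t}"
      then have "s < t \<or> t < s" by auto
      then show "\<phi> s x = 0" using d(3)[of s t] d(3)[of t s] s t by (intro \<phi>(3)) auto
    qed
    finally show ?thesis using \<phi>(2)[OF t(1)] by simp
  next
    case False
    then have "\<psi> x = 0" unfolding \<psi>_def by (intro sum.neutral ballI \<phi>(3)) auto
    then show ?thesis by simp
  qed
  have uL: "u \<in> L2 l"
    by (rule L2_bounded[OF um, of "max \<bar>p\<bar> \<bar>q\<bar>"]) (use two in \<open>auto elim: eventually_mono\<close>)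
  have "card F * (q - p) - e \<le> card F * (q - p) - card F * e'"
    using \<open>e > 0\<close> by (simp add: e'_def field_simps)
  also have "\<dots> = (\<Sum>t\<in>F. q - p - e')" by (simp add: algebra_simps)
  also have "\<dots> \<le> (\<Sum>t\<in>F. \<integral>x. u x * deriv (\<phi> t) x \<partial>leb_I l)" by (intro sum_mono \<phi>)
  also have "\<dots> = (\<integral>x. (\<Sum>t\<in>F. u x * deriv (\<phi> t) x) \<partial>leb_I l)"
    by (intro Bochner_Integration.integral_sum[symmetric] L2_mult_integrable[OF uL] Cc1_L2 \<phi>)
  also have "\<dots> = (\<integral>x. u x * deriv \<psi> x \<partial>leb_I l)"
    by (simp add: \<psi>(2) \<psi>'_def sum_distrib_left)
  finally have "ennreal (card F * (q - p)) \<le> ennreal ((\<integral>x. u x * deriv \<psi> x \<partial>leb_I l) + e)"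
    by (intro ennreal_leI) simp
  \<comment> \<open>\<open>ennreal\<close> truncates a negative integral to 0, so it is additive
    only for nonnegative summands; hence the case distinction.\<close>
  also have "\<dots> \<le> ennreal (\<integral>x. u x * deriv \<psi> x \<partial>leb_I l) + ennreal e"
  proof (cases "0 \<le> (\<integral>x. u x * deriv \<psi> x \<partial>leb_I l)")
    case True
    then show ?thesis using \<open>e > 0\<close> by simp
  next
    case False
    then show ?thesis by (intro add_increasing ennreal_leI) auto
  qed
  also have "ennreal (\<integral>x. u x * deriv \<psi> x \<partial>leb_I l) \<le> total_variation l u"
    unfolding total_variation_def by (intro SUP_upper) (use \<psi> bd in auto)
  finally show "ennreal (card F * (q - p)) \<le> total_variation l u + ennreal e"
    by (simp add: add_right_mono)
qed

section \<open>Essential jumps and step functions\<close>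

lemma AE_leb_I_iff: "(AE x in leb_I l. P x) \<longleftrightarrow> (AE x in lebesgue. -l < x \<and> x < l \<longrightarrow> P x)"
  by (simp add: AE_restrict_space_iff)

lemma AE_interval_witness:
  fixes p q :: real
  assumes "p < q" "AE y in lebesgue. p < y \<and> y < q \<longrightarrow> P y"
  obtains y where "p < y" "y < q" "P y"
proof (rule ccontr)
  assume "\<not> thesis"
  then have "AE y\<in>{p<..<q} in lebesgue. y \<in> {}" using assms(2) that by (auto elim: eventually_mono)
  then have "(p + q) / 2 \<in> {}"
    by (rule mem_closed_if_AE_lebesgue_open[OF open_greaterThanLessThan closed_empty]) (use assms(1) in auto)
  then show False by simp
qed

lemma AE_lebesgue_negligible:
  assumes "AE x in lebesgue. P x"
  shows "negligible {x. \<not> P x}"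
proof -
  from assms obtain N where "N \<in> null_sets lebesgue" "{x. \<not> P x} \<subseteq> N"
    by (auto simp: eventually_ae_filter)
  then show ?thesis using negligible_subset negligible_iff_null_sets by metis
qed

text \<open>Two overlapping neighbourhoods share an open interval, so their constants agree: the
  local value \<open>c\<close> is itself a locally constant function, hence constant on the
  connected interval. The exceptional set is locally negligible, therefore negligible.\<close>

lemma AE_locally_constant:
  fixes u :: "real \<Rightarrow> real"
  assumes loc: "\<And>x. a < x \<Longrightarrow> x < b \<Longrightarrow> \<exists>\<delta>>0. \<exists>c. AE y in lebesgue. \<bar>y - x\<bar> < \<delta> \<longrightarrow> u y = c"
  obtains k where "AE y in lebesgue. a < y \<and> y < b \<longrightarrow> u y = k"
proof -
  have "\<exists>\<delta> c. \<delta> > 0 \<and> (AE y in lebesgue. \<bar>y - x\<bar> < \<delta> \<longrightarrow> u y = c)" if "x \<in> {a<..<b}" for x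
    using loc[of x] that by auto
  then obtain \<delta> c where \<delta>: "\<And>x. x \<in> {a<..<b} \<Longrightarrow> \<delta> x > 0"
    and c: "\<And>x. x \<in> {a<..<b} \<Longrightarrow> AE y in lebesgue. \<bar>y - x\<bar> < \<delta> x \<longrightarrow> u y = c x" by metis
  have "\<forall>\<^sub>F y in at x within {a<..<b}. c x = c y" if x: "x \<in> {a<..<b}" for x
    unfolding eventually_at
  proof (intro exI[of _ "\<delta> x"] conjI \<delta> x ballI impI)
    fix y assume y: "y \<in> {a<..<b}" "y \<noteq> x \<and> dist y x < \<delta> x"
    define p where "p = max (x - \<delta> x) (y - \<delta> y)"
    define q where "q = min (x + \<delta> x) (y + \<delta> y)"
    have "p < q" using \<delta>[OF x] \<delta>[OF y(1)] y(2) by (auto simp: p_def q_def dist_real_def)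
    have "AE z in lebesgue. p < z \<and> z < q \<longrightarrow> c x = c y"
      using c[OF x] c[OF y(1)] by eventually_elim (auto simp: p_def q_def)
    then show "c x = c y" by (rule AE_interval_witness[OF \<open>p < q\<close>])
  qed
  then have const: "c x = c y" if "x \<in> {a<..<b}" "y \<in> {a<..<b}" for x y
    using connected_local_const[OF connected_Ioo that] by blast
  define k where "k = c ((a + b) / 2)"
  define S where "S = {y. a < y \<and> y < b \<and> u y \<noteq> k}"
  have "negligible S"
    unfolding locally_negligible_alt[of S]
  proof
    fix x assume "x \<in> S"
    then have x: "x \<in> {a<..<b}" by (auto simp: S_def)
    then have "c x = k" unfolding k_def by (intro const) auto
    have "negligible {y. \<not> (\<bar>y - x\<bar> < \<delta> x \<longrightarrow> u y = c x)}"
      by (rule AE_lebesgue_negligible[OF c[OF x]])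
    then have "negligible (S \<inter> ball x (\<delta> x))"
      by (rule negligible_subset) (auto simp: S_def \<open>c x = k\<close> dist_real_def)
    then show "\<exists>U. openin (top_of_set S) U \<and> x \<in> U \<and> negligible U"
      using \<open>x \<in> S\<close> \<delta>[OF x] by (intro exI[of _ "S \<inter> ball x (\<delta> x)"]) (auto intro: openin_open_Int)
  qed
  then have "AE y in lebesgue. y \<notin> S" by (intro AE_not_in) (simp add: negligible_iff_null_sets)
  then have "AE y in lebesgue. a < y \<and> y < b \<longrightarrow> u y = k" by eventually_elim (auto simp: S_def)
  then show ?thesis using that by blast
qed

text \<open>Discontinuity in a form that ignores null sets and presupposes no one-sided limits, so
  that it makes sense before the function is known to be a step function.\<close>

definition jumps :: "real \<Rightarrow> (real \<Rightarrow> real) \<Rightarrow> real set" where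
  "jumps l u = {t. -l < t \<and> t < l \<and> (\<forall>\<delta>>0. \<forall>c. \<not> (AE x in leb_I l. \<bar>x - t\<bar> < \<delta> \<longrightarrow> u x = c))}"

lemma not_jump:
  assumes "-l < x" "x < l" "x \<notin> jumps l u"
  obtains \<delta> c where "\<delta> > 0" "AE y in lebesgue. \<bar>y - x\<bar> < \<delta> \<longrightarrow> u y = c"
proof -
  obtain \<delta> c where \<delta>: "\<delta> > 0" "AE y in leb_I l. \<bar>y - x\<bar> < \<delta> \<longrightarrow> u y = c"
    using assms by (auto simp: jumps_def)
  define e where "e = Min {\<delta>, x + l, l - x}"
  have e: "e > 0" "e \<le> \<delta>" "e \<le> x + l" "e \<le> l - x" using \<delta>(1) assms(1,2) by (auto simp: e_def)
  have "AE y in lebesgue. \<bar>y - x\<bar> < e \<longrightarrow> u y = c"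
    using \<delta>(2) unfolding AE_leb_I_iff by eventually_elim (use e in auto)
  then show ?thesis using that e(1) by blast
qed

text \<open>The sign product \<open>P\<close> over all jumps changes sign exactly where \<theta>
  does. So the product of the two is locally constant even at the jumps, hence a.e. equal to one
  constant \<open>k\<close>. Off the jumps \<open>P\<close> squares to 1, which gives back \<theta>
  as \<open>k * P\<close> and forces \<open>k\<close> to be \<plusminus>\<beta>.\<close>

lemma two_valued_structure:
  fixes \<theta> :: "real \<Rightarrow> real"
  assumes "l > 0" "\<beta> > 0" and two: "AE x in leb_I l. \<theta> x \<in> {-\<beta>, \<beta>}" and fin: "finite (jumps l \<theta>)"
  obtains s where "s \<in> {-\<beta>, \<beta>}" "AE x in leb_I l. \<theta> x = s * (\<Prod>t\<in>jumps l \<theta>. sgn (t - x))"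
proof -
  let ?J = "jumps l \<theta>"
  define P where "P A x = (\<Prod>t\<in>A. sgn (t - x))" for A and x :: real
  have Pconst: "P A y = P A x" if "\<And>t. t \<in> A \<Longrightarrow> d \<le> dist x t" "\<bar>y - x\<bar> < d" for A x y d
    unfolding P_def
  proof (rule prod.cong)
    fix t assume "t \<in> A"
    from that(1)[OF this] show "sgn (t - y) = sgn (t - x)"
      using that(2) by (auto simp: sgn_if dist_real_def)
  qed simp
  have two': "AE x in lebesgue. -l < x \<and> x < l \<longrightarrow> \<theta> x \<in> {-\<beta>, \<beta>}"
    using two by (simp add: AE_leb_I_iff)
  \<comment> \<open>Supplies the one-sided values at a jump: between consecutive jumps \<theta> is
    constant. Two equal values on the sides of \<open>x\<close> would contradict that
    \<open>x\<close> is a jump, so they are opposite.\<close>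
  have side: "\<exists>c\<in>{-\<beta>, \<beta>}. AE y in lebesgue. p < y \<and> y < q \<longrightarrow> \<theta> y = c"
    if pq: "p < q" "-l \<le> p" "q \<le> l" "\<And>t. t \<in> ?J \<Longrightarrow> t \<le> p \<or> q \<le> t" for p q
  proof -
    obtain c where c: "AE y in lebesgue. p < y \<and> y < q \<longrightarrow> \<theta> y = c"
    proof (rule AE_locally_constant)
      fix x assume "p < x" "x < q"
      then have "-l < x" "x < l" "x \<notin> ?J" using pq(2,3) pq(4)[of x] by linarith+
      then show "\<exists>\<delta>>0. \<exists>c. AE y in lebesgue. \<bar>y - x\<bar> < \<delta> \<longrightarrow> \<theta> y = c"
        by (rule not_jump) blast
    qed blast
    have "AE y in lebesgue. p < y \<and> y < q \<longrightarrow> \<theta> y = c \<and> \<theta> y \<in> {-\<beta>, \<beta>}"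
      using c two' by eventually_elim (use that in auto)
    then obtain y where "\<theta> y = c \<and> \<theta> y \<in> {-\<beta>, \<beta>}"
      by (rule AE_interval_witness[OF \<open>p < q\<close>]) blast
    then have "c \<in> {-\<beta>, \<beta>}" by auto
    then show ?thesis using c by blast
  qed
  obtain k where k: "AE y in lebesgue. -l < y \<and> y < l \<longrightarrow> \<theta> y * P ?J y = k"
  proof (rule AE_locally_constant)
    fix x assume x: "-l < x" "x < l"
    obtain d0 where d0: "d0 > 0" "\<And>t. t \<in> ?J - {x} \<Longrightarrow> d0 \<le> dist x t"
      using finite_set_avoid[of ?J x] fin by auto
    show "\<exists>\<delta>>0. \<exists>c. AE y in lebesgue. \<bar>y - x\<bar> < \<delta> \<longrightarrow> \<theta> y * P ?J y = c"
    proof (cases "x \<in> ?J")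
      case False
      obtain \<delta> c where \<delta>: "\<delta> > 0" "AE y in lebesgue. \<bar>y - x\<bar> < \<delta> \<longrightarrow> \<theta> y = c"
        using not_jump[OF x False] by blast
      have "P ?J y = P ?J x" if "\<bar>y - x\<bar> < d0" for y
        by (rule Pconst[OF d0(2) that]) (use False in auto)
      then have "AE y in lebesgue. \<bar>y - x\<bar> < min d0 \<delta> \<longrightarrow> \<theta> y * P ?J y = c * P ?J x"
        using \<delta>(2) by (auto elim: eventually_mono)
      then show ?thesis using d0(1) \<delta>(1) by (intro exI[of _ "min d0 \<delta>"]) auto
    next
      case True
      define d where "d = Min {d0, x + l, l - x}"
      have d: "d > 0" "d \<le> d0" "d \<le> x + l" "d \<le> l - x" using d0(1) x by (auto simp: d_def)
      have away: "t \<le> x - d \<or> t = x \<or> x + d \<le> t" if "t \<in> ?J" for t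
      proof (cases "t = x")
        case False
        then have "d0 \<le> \<bar>x - t\<bar>" using d0(2)[of t] that by (simp add: dist_real_def)
        then show ?thesis using d(2) by linarith
      qed simp
      obtain c1 where c1: "c1 \<in> {-\<beta>, \<beta>}" "AE y in lebesgue. x - d < y \<and> y < x \<longrightarrow> \<theta> y = c1"
        using side[of "x - d" x] d away by force
      obtain c2 where c2: "c2 \<in> {-\<beta>, \<beta>}" "AE y in lebesgue. x < y \<and> y < x + d \<longrightarrow> \<theta> y = c2"
        using side[of x "x + d"] d away by force
      have nx: "AE y in lebesgue. y \<noteq> x"
        using AE_not_in[of "{x}" lebesgue] by (simp add: negligible_iff_null_sets[symmetric])
      have "c1 \<noteq> c2"
      proof
        assume "c1 = c2"
        have "AE y in leb_I l. \<bar>y - x\<bar> < d \<longrightarrow> \<theta> y = c1"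
          unfolding AE_leb_I_iff using c1(2) c2(2) nx
          by eventually_elim (auto simp: \<open>c1 = c2\<close> abs_if split: if_splits)
        then show False using True d(1) by (auto simp: jumps_def)
      qed
      then have c21: "c2 = - c1" using c1(1) c2(1) by auto
      have P1: "P ?J y = sgn (x - y) * P (?J - {x}) y" for y
        unfolding P_def using fin True by (rule prod.remove)
      have P2: "P (?J - {x}) y = P (?J - {x}) x" if "\<bar>y - x\<bar> < d" for y
        by (rule Pconst[OF d0(2)]) (use that d in auto)
      have "AE y in lebesgue. \<bar>y - x\<bar> < d \<longrightarrow> \<theta> y * P ?J y = c1 * P (?J - {x}) x"
        using c1(2) c2(2) nx
      proof eventually_elim
        case (elim y)
        show ?case
        proof (intro impI)
          assume y: "\<bar>y - x\<bar> < d"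
          have "\<theta> y * sgn (x - y) = c1"
            using elim y c21 by (cases "y < x") auto
          then show "\<theta> y * P ?J y = c1 * P (?J - {x}) x"
            unfolding P1 P2[OF y] by (metis mult.assoc)
        qed
      qed
      then show ?thesis using d(1) by blast
    qed
  qed blast
  have nJ: "AE y in lebesgue. y \<notin> ?J"
    using fin by (intro AE_not_in) (simp add: negligible_finite flip: negligible_iff_null_sets)
  have PP: "P ?J y * P ?J y = 1" if "y \<notin> ?J" for y
  proof -
    have "P ?J y * P ?J y = (\<Prod>t\<in>?J. sgn (t - y) * sgn (t - y))"
      unfolding P_def by (rule prod.distrib[symmetric])
    also have "\<dots> = 1" by (rule prod.neutral) (use that in \<open>auto simp: sgn_if\<close>)
    finally show ?thesis .
  qed
  have "AE y in lebesgue. -l < y \<and> y < l \<longrightarrow> \<theta> y = k * P ?J y \<and> k * k = \<beta> * \<beta>"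
    using k two' nJ
  proof eventually_elim
    case (elim y)
    show ?case
    proof (intro impI)
      assume y: "-l < y \<and> y < l"
      have k: "k = \<theta> y * P ?J y" using elim y by simp
      have "\<theta> y * \<theta> y = \<beta> * \<beta>" using elim y by auto
      moreover have "k * k = \<theta> y * \<theta> y * (P ?J y * P ?J y)" "k * P ?J y = \<theta> y * (P ?J y * P ?J y)"
        unfolding k by (simp_all add: ac_simps)
      ultimately show "\<theta> y = k * P ?J y \<and> k * k = \<beta> * \<beta>" using PP elim by simp
    qed
  qed
  then have *: "AE y in leb_I l. \<theta> y = k * P ?J y \<and> k * k = \<beta> * \<beta>" unfolding AE_leb_I_iff .
  have "-l < l" using \<open>l > 0\<close> by simp
  then obtain y where "\<theta> y = k * P ?J y \<and> k * k = \<beta> * \<beta>"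
    by (rule AE_interval_witness[OF _ *[unfolded AE_leb_I_iff]]) blast
  then have "k * k = \<beta> * \<beta>" by simp
  then have "k \<in> {-\<beta>, \<beta>}" by (auto simp: square_eq_iff)
  moreover have "AE y in leb_I l. \<theta> y = k * P ?J y" using * by (auto elim: eventually_mono)
  ultimately show ?thesis using that by (simp add: P_def)
qed

text \<open>Every finite subset costs \<open>q - p\<close> per point, so the finite total variation
  bounds its cardinality uniformly; an infinite set would have arbitrarily large finite
  subsets.\<close>

lemma finite_jumps:
  fixes u :: "real \<Rightarrow> real" and p q :: real
  assumes um: "u \<in> borel_measurable (leb_I l)" and two: "AE x in leb_I l. u x \<in> {p, q}" and "p < q"
    and tv: "total_variation l u < \<infinity>"
  shows "finite (jumps l u)" "ennreal (card (jumps l u) * (q - p)) \<le> total_variation l u"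
proof -
  have bound: "ennreal (card F * (q - p)) \<le> total_variation l u" if "finite F" "F \<subseteq> jumps l u" for F
    by (rule total_variation_lower_bound[OF um two \<open>p < q\<close> that(1)])
      (use that(2) in \<open>auto simp: jumps_def subset_iff\<close>)
  show fin: "finite (jumps l u)"
  proof (rule ccontr)
    assume inf: "infinite (jumps l u)"
    obtain r where r: "total_variation l u = ennreal r" "0 \<le> r"
      using tv by (cases "total_variation l u") auto
    obtain n where n: "r < real n * (q - p)" using reals_Archimedean3[of "q - p"] \<open>p < q\<close> by auto
    obtain F where "finite F" "card F = n" "F \<subseteq> jumps l u"
      using infinite_arbitrarily_large[OF inf] by blast
    from bound[OF this(1,3)] show False using n r \<open>card F = n\<close> by (simp add: ennreal_le_iff)
  qed
  show "ennreal (card (jumps l u) * (q - p)) \<le> total_variation l u" by (rule bound[OF fin order_refl])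
qed

section \<open>Transition layers\<close>

text \<open>Separation of variables: \<open>q\<close> inverts the travel time \<open>X\<close>, the
  primitive of \<open>1 / V\<close>. The lower bound \<open>m\<close> on \<open>V\<close> keeps the
  total time \<open>T\<close> finite; this is where positivity after regularisation enters.\<close>

lemma profile_exists:
  fixes V :: "real \<Rightarrow> real"
  assumes "a < b" and V: "continuous_on {a..b} V" and m: "m > 0" "\<And>s. s \<in> {a..b} \<Longrightarrow> m \<le> V s"
  obtains T q where "T > 0" "T \<le> (b - a) / m" "continuous_on {0..T} q" "q 0 = a" "q T = b"
    "\<And>x. x \<in> {0..T} \<Longrightarrow> q x \<in> {a..b}"
    "\<And>x. x \<in> {0<..<T} \<Longrightarrow> (q has_real_derivative V (q x)) (at x)"
proof -
  have Vpos: "V s > 0" if "s \<in> {a..b}" for s using m that by force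
  define X where "X s = integral {a..s} (\<lambda>t. 1 / V t)" for s
  have c: "continuous_on {a..b} (\<lambda>t. 1 / V t)"
    by (intro continuous_intros V) (use Vpos in force)
  have Xd: "(X has_real_derivative 1 / V s) (at s within {a..b})" if "s \<in> {a..b}" for s
    unfolding X_def by (rule integral_has_real_derivative[OF c that])
  have Xd': "(X has_real_derivative 1 / V s) (at s)" if "s \<in> {a<..<b}" for s
    using Xd[of s] that by (simp add: at_within_Icc_at)
  have Xc: "continuous_on {a..b} X" using Xd by (rule DERIV_continuous_on)
  have mono: "X s < X t" if "a \<le> s" "s < t" "t \<le> b" for s t
  proof (rule DERIV_pos_imp_increasing_open[OF \<open>s < t\<close>])
    show "\<exists>y. (X has_real_derivative y) (at x) \<and> 0 < y" if "s < x" "x < t" for x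
      using Xd'[of x] Vpos[of x] that \<open>a \<le> s\<close> \<open>t \<le> b\<close> by (intro exI[of _ "1 / V x"]) auto
    show "continuous_on {s..t} X" by (rule continuous_on_subset[OF Xc]) (use that in auto)
  qed
  have inj: "inj_on X {a..b}"
    by (rule linorder_inj_onI) (use mono in force)+
  define T where "T = X b"
  have X0: "X a = 0" by (simp add: X_def)
  have T0: "T > 0" using mono[of a b] \<open>a < b\<close> X0 by (simp add: T_def)
  have img: "X ` {a..b} = {0..T}"
  proof
    show "X ` {a..b} \<subseteq> {0..T}"
    proof (rule image_subsetI)
      fix s assume "s \<in> {a..b}"
      then show "X s \<in> {0..T}"
        using mono[of a s] mono[of s b] X0 by (cases "s = a"; cases "s = b") (auto simp: T_def)
    qed
    show "{0..T} \<subseteq> X ` {a..b}"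
    proof
      fix y assume "y \<in> {0..T}"
      then have "\<exists>x. a \<le> x \<and> x \<le> b \<and> X x = y"
        by (intro IVT' Xc) (use X0 \<open>a < b\<close> in \<open>auto simp: T_def\<close>)
      then show "y \<in> X ` {a..b}" by auto
    qed
  qed
  define q where "q = the_inv_into {a..b} X"
  have qX: "q (X s) = s" if "s \<in> {a..b}" for s
    unfolding q_def by (rule the_inv_into_f_f[OF inj that])
  have Xq: "X (q y) = y" if "y \<in> {0..T}" for y
    unfolding q_def by (rule f_the_inv_into_f[OF inj]) (use that img in auto)
  have qin: "q y \<in> {a..b}" if "y \<in> {0..T}" for y
    unfolding q_def by (rule the_inv_into_into[OF inj _ order_refl]) (use that img in auto)
  have qc: "continuous_on {0..T} q"
    unfolding q_def img[symmetric] by (rule continuous_on_inv_into[OF Xc compact_Icc inj])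
  have q0: "q 0 = a" "q T = b" using qX[of a] qX[of b] \<open>a < b\<close> X0 by (auto simp: T_def)
  have "T \<le> integral {a..b} (\<lambda>_. 1 / m)"
    unfolding T_def X_def
    by (intro integral_le integrable_continuous_real c) (use m in \<open>auto intro!: divide_left_mono mult_pos_pos Vpos\<close>)
  then have Tle: "T \<le> (b - a) / m" using \<open>a < b\<close> by simp
  have "(q has_real_derivative V (q x)) (at x)" if x: "x \<in> {0<..<T}" for x
  proof -
    have qa: "q x \<noteq> a" using Xq[of x] X0 x by auto
    have qb: "q x \<noteq> b" using Xq[of x] x by (auto simp: T_def)
    have qx: "q x \<in> {a<..<b}" using qin[of x] qa qb x by auto
    have "(q has_real_derivative inverse (1 / V (q x))) (at x)"
    proof (rule DERIV_inverse_function[of X "1 / V (q x)" q x 0 T, OF Xd'[OF qx]])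
      show "1 / V (q x) \<noteq> 0" using Vpos[of "q x"] qx by auto
      show "0 < x" "x < T" using x by auto
      show "X (q y) = y" if "0 < y" "y < T" for y using Xq that by simp
      show "isCont q x" using continuous_on_interior[OF qc, of x] x by simp
    qed
    then show ?thesis by simp
  qed
  then show ?thesis using that T0 Tle qc q0 qin by blast
qed

section \<open>The potential, the cost of a transition, and a single layer\<close>

lemma W_even: "W \<sigma> D2 (- t) = W \<sigma> D2 t"
  by (simp add: W_def W_unnorm_def)

lemma W_continuous: "continuous_on A (W \<sigma> D2)"
  unfolding W_def W_unnorm_def by (intro continuous_intros) auto

lemma W_beta:
  assumes "\<sigma> > 0" "D2 > 0"
  shows "W \<sigma> D2 (beta \<sigma> D2) = 0" "W \<sigma> D2 (- beta \<sigma> D2) = 0"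
  using beta_props(3)[OF assms] by auto

lemma Phi_eq_integral:
  assumes "\<sigma> > 0" "D2 > 0" "- beta \<sigma> D2 \<le> s"
  shows "Phi \<sigma> D2 s = 2 * integral {- beta \<sigma> D2..s} (\<lambda>t. sqrt (W \<sigma> D2 t))"
proof -
  have c: "continuous_on A (\<lambda>t. sqrt (W \<sigma> D2 t))" for A by (intro continuous_intros W_continuous)
  show ?thesis
    unfolding Phi_def using assms(3) borel_integrable_atLeastAtMost'[OF c]
    by (subst interval_integral_eq_integral) auto
qed

text \<open>The integrand is continuous and nonnegative, and it does not vanish at 0, because the
  zeros of \<open>W\<close> in [-\<pi>,\<pi>] are \<plusminus>\<beta> and \<beta> is
  positive.\<close>

lemma Phi_beta_pos:
  assumes "\<sigma> > 0" "D2 > 0"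
  shows "Phi \<sigma> D2 (beta \<sigma> D2) > 0" "Phi \<sigma> D2 (- beta \<sigma> D2) = 0"
proof -
  let ?b = "beta \<sigma> D2" and ?f = "\<lambda>t. sqrt (W \<sigma> D2 t)"
  note b = beta_props[OF assms]
  show "Phi \<sigma> D2 (- ?b) = 0" using Phi_eq_integral[OF assms, of "- ?b"] by simp
  have c: "continuous_on {- ?b..?b} ?f" by (intro continuous_intros W_continuous)
  have nn: "0 \<le> ?f t" for t using W_nonneg[OF assms] by simp
  have "integral {- ?b..?b} ?f \<noteq> 0"
  proof
    assume "integral {- ?b..?b} ?f = 0"
    then have "(?f has_integral 0) {- ?b..?b}"
      using integrable_integral[OF integrable_continuous_real[OF c]] by simp
    then have "?f 0 = 0"
      using has_integral_0_cbox_imp_0[of "- ?b" "?b" ?f 0] c nn b(1) by auto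
    then have "0 \<in> {- ?b, ?b}" unfolding b(3)[symmetric] by simp
    then show False using b(1) by auto
  qed
  moreover have "0 \<le> integral {- ?b..?b} ?f"
    by (rule Henstock_Kurzweil_Integration.integral_nonneg[OF integrable_continuous_real[OF c] nn])
  ultimately show "Phi \<sigma> D2 ?b > 0"
    using b(1) by (subst Phi_eq_integral[OF assms]) auto
qed

text \<open>The profile for the speed \<open>sqrt (W + \<rho>^2)\<close>, which is at least \<rho>,
  takes time at most \<open>2 * \<beta> / \<rho>\<close>; rescaling by \<epsilon> multiplies this by
  \<epsilon>.\<close>

lemma layer_exists:
  assumes \<sigma>: "\<sigma> > 0" "D2 > 0" and \<epsilon>: "\<epsilon> > 0" and \<rho>: "\<rho> > 0"
  obtains \<delta> h where "\<delta> > 0" "\<delta> \<le> 2 * beta \<sigma> D2 * \<epsilon> / \<rho>" "continuous_on UNIV h"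
    "\<And>x. x \<ge> 0 \<Longrightarrow> h x = beta \<sigma> D2" "\<And>x. x \<le> -\<delta> \<Longrightarrow> h x = - beta \<sigma> D2"
    "\<And>x. \<bar>h x\<bar> \<le> beta \<sigma> D2"
    "\<And>x. x \<in> {-\<delta><..<0} \<Longrightarrow> (h has_real_derivative sqrt (W \<sigma> D2 (h x) + \<rho>^2) / \<epsilon>) (at x)"
proof -
  let ?b = "beta \<sigma> D2"
  have b: "?b > 0" using beta_props[OF \<sigma>] by simp
  define V where "V s = sqrt (W \<sigma> D2 s + \<rho>^2)" for s
  have "continuous_on {-?b..?b} V" unfolding V_def by (intro continuous_intros W_continuous)
  moreover have "\<rho> \<le> V s" for s
    unfolding V_def using W_nonneg[OF \<sigma>, of s] by (intro real_le_rsqrt) simp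
  ultimately obtain T q where T: "T > 0" "T \<le> (?b - (-?b)) / \<rho>" and q: "continuous_on {0..T} q"
    "q 0 = -?b" "q T = ?b" "\<And>x. x \<in> {0..T} \<Longrightarrow> q x \<in> {-?b..?b}"
    "\<And>x. x \<in> {0<..<T} \<Longrightarrow> (q has_real_derivative V (q x)) (at x)"
    using profile_exists[of "-?b" ?b V \<rho>] b \<rho> by auto
  \<comment> \<open>Clamped time: the profile runs on \<open>[-\<epsilon> T, 0]\<close> and rests in
    the wells outside, so the layer ends exactly at 0.\<close>
  define \<tau> where "\<tau> x = max 0 (min T (x / \<epsilon> + T))" for x
  have \<tau>: "\<tau> x \<in> {0..T}" for x using T by (auto simp: \<tau>_def)
  have \<tau>1: "\<tau> x = T" if "x \<ge> 0" for x
  proof -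
    have "x / \<epsilon> \<ge> 0" using that \<epsilon> by simp
    then show ?thesis using T(1) by (simp add: \<tau>_def)
  qed
  have \<tau>0: "\<tau> x = 0" if "x \<le> - (\<epsilon> * T)" for x
  proof -
    have "x / \<epsilon> \<le> -T" using that \<epsilon> by (simp add: divide_le_eq mult.commute)
    then show ?thesis using T(1) by (simp add: \<tau>_def)
  qed
  define h where "h x = q (\<tau> x)" for x
  show ?thesis
  proof (rule that[of "\<epsilon> * T" h])
    show "\<epsilon> * T > 0" using T \<epsilon> by simp
    show "\<epsilon> * T \<le> 2 * ?b * \<epsilon> / \<rho>" using mult_left_mono[OF T(2), of \<epsilon>] \<epsilon> by (simp add: mult.commute)
    have "continuous_on UNIV \<tau>" unfolding \<tau>_def using \<epsilon> by (intro continuous_intros) auto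
    then show "continuous_on UNIV h"
      unfolding h_def by (rule continuous_on_compose2[OF q(1)]) (use \<tau> in auto)
    show "h x = ?b" if "x \<ge> 0" for x using \<tau>1[OF that] q by (simp add: h_def)
    show "h x = -?b" if "x \<le> - (\<epsilon> * T)" for x using \<tau>0[OF that] q by (simp add: h_def)
    show "\<bar>h x\<bar> \<le> ?b" for x using q(4)[OF \<tau>[of x]] by (auto simp: h_def abs_le_iff)
    show "(h has_real_derivative sqrt (W \<sigma> D2 (h x) + \<rho>^2) / \<epsilon>) (at x)" if x: "x \<in> {- (\<epsilon> * T)<..<0}" for x
    proof -
      have \<tau>eq: "\<tau> y = y / \<epsilon> + T" "\<tau> y \<in> {0<..<T}" if "y \<in> {- (\<epsilon> * T)<..<0}" for y
      proof -
        have "- T < y / \<epsilon>" "y / \<epsilon> < 0" using that \<epsilon> by (auto simp: less_divide_eq mult.commute divide_less_0_iff)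
        then show "\<tau> y = y / \<epsilon> + T" "\<tau> y \<in> {0<..<T}" by (auto simp: \<tau>_def)
      qed
      have "((\<lambda>y. q (y / \<epsilon> + T)) has_real_derivative V (q (x / \<epsilon> + T)) * (1 / \<epsilon>)) (at x)"
        by (rule DERIV_chain2[OF q(5)]) (use \<tau>eq[OF x] \<epsilon> in \<open>auto intro!: derivative_eq_intros\<close>)
      moreover have "\<forall>\<^sub>F y in nhds x. h y = q (y / \<epsilon> + T)"
        unfolding eventually_nhds h_def
        by (intro exI[of _ "{- (\<epsilon> * T)<..<0}"]) (use \<tau>eq x in auto)
      ultimately have "(h has_real_derivative V (q (x / \<epsilon> + T)) * (1 / \<epsilon>)) (at x)"
        by (subst DERIV_cong_ev) auto
      then show ?thesis using \<tau>eq[OF x] by (simp add: h_def V_def)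
    qed
  qed
qed

text \<open>With \<open>V = sqrt (W + \<rho>^2)\<close> the equation
  \<open>h' = V h / \<epsilon>\<close> turns the integrand into \<open>2 * V h * h'\<close>, an
  exact derivative, as in the Modica-Mortola argument. The integral is therefore twice that of
  \<open>V\<close> over \<open>{-\<beta>..\<beta>}\<close>, and
  \<open>V \<le> sqrt W + \<rho>\<close> gives the excess
  \<open>4 * \<beta> * \<rho>\<close>.\<close>

lemma layer_energy:
  assumes \<sigma>: "\<sigma> > 0" "D2 > 0" and \<epsilon>: "\<epsilon> > 0" and \<rho>: "\<rho> > 0" and \<delta>: "\<delta> > 0"
    and hc: "continuous_on UNIV h" and h0: "h 0 = beta \<sigma> D2" "h (-\<delta>) = - beta \<sigma> D2"
    and hb: "\<And>x. \<bar>h x\<bar> \<le> beta \<sigma> D2"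
    and hd: "\<And>x. x \<in> {-\<delta><..<0} \<Longrightarrow> (h has_real_derivative sqrt (W \<sigma> D2 (h x) + \<rho>^2) / \<epsilon>) (at x)"
  shows "integral {t-\<delta>..t} (\<lambda>x. 2 * (W \<sigma> D2 (h (x - t)) + \<rho>^2) / \<epsilon>)
    \<le> Phi \<sigma> D2 (beta \<sigma> D2) + 4 * beta \<sigma> D2 * \<rho>"
proof -
  let ?b = "beta \<sigma> D2"
  have b: "?b > 0" using beta_props[OF \<sigma>] by simp
  define V where "V s = sqrt (W \<sigma> D2 s + \<rho>^2)" for s
  have Vc: "continuous_on A V" for A unfolding V_def by (intro continuous_intros W_continuous)
  have Vi: "V integrable_on {x..y}" for x y by (intro integrable_continuous_real Vc)
  have V2: "V s * V s = W \<sigma> D2 s + \<rho>^2" for s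
    unfolding V_def using W_nonneg[OF \<sigma>, of s] by simp
  \<comment> \<open>Starting below -\<beta> makes both wells interior points, where \<Psi> has a
    two-sided derivative as the chain rule requires.\<close>
  define \<Psi> where "\<Psi> s = integral {-?b-1..s} V" for s
  have \<Psi>d: "(\<Psi> has_real_derivative V s) (at s)" if "\<bar>s\<bar> \<le> ?b" for s
  proof -
    have "-?b - 1 < s" "s < ?b + 1" using that by auto
    then show ?thesis
      using integral_has_real_derivative[OF Vc, of s "-?b-1" "?b+1"]
      by (simp add: at_within_Icc_at \<Psi>_def[abs_def])
  qed
  have hi: "((\<lambda>x. 2 * (W \<sigma> D2 (h (x - t)) + \<rho>^2) / \<epsilon>) has_integral (2 * \<Psi> (h (t - t)) - 2 * \<Psi> (h (t - \<delta> - t)))) {t-\<delta>..t}"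
  proof (rule fundamental_theorem_of_calculus_interior)
    have hct: "continuous_on A (\<lambda>x. h (x - t))" for A
      by (intro continuous_on_compose2[OF hc] continuous_intros) auto
    have "continuous_on {-?b..?b} \<Psi>"
    proof (rule DERIV_continuous_on)
      fix s assume "s \<in> {-?b..?b}"
      then show "(\<Psi> has_real_derivative V s) (at s within {-?b..?b})"
        by (intro has_field_derivative_at_within[OF \<Psi>d]) auto
    qed
    moreover have "h x \<in> {-?b..?b}" for x using hb[of x] by auto
    ultimately have "continuous_on {t-\<delta>..t} (\<lambda>x. \<Psi> (h (x - t)))"
      by (intro continuous_on_compose2[OF _ hct]) auto
    then show "continuous_on {t-\<delta>..t} (\<lambda>x. 2 * \<Psi> (h (x - t)))" by (intro continuous_intros)
    fix x assume x: "x \<in> {t-\<delta><..<t}"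
    have "((\<lambda>x. h (x - t)) has_real_derivative (V (h (x - t)) / \<epsilon>) * 1) (at x)"
      unfolding V_def by (rule DERIV_chain2[OF hd]) (use x in \<open>auto intro!: derivative_eq_intros\<close>)
    then have "((\<lambda>x. 2 * \<Psi> (h (x - t))) has_real_derivative 2 * (V (h (x - t)) * ((V (h (x - t)) / \<epsilon>) * 1))) (at x)"
      by (intro DERIV_cmult DERIV_chain2[where f=\<Psi> and g="\<lambda>x. h (x - t)"] \<Psi>d hb)
    moreover have "2 * (V (h (x - t)) * ((V (h (x - t)) / \<epsilon>) * 1)) = 2 * (W \<sigma> D2 (h (x - t)) + \<rho>^2) / \<epsilon>"
      unfolding V2[symmetric] by simp
    ultimately have "((\<lambda>x. 2 * \<Psi> (h (x - t))) has_real_derivative 2 * (W \<sigma> D2 (h (x - t)) + \<rho>^2) / \<epsilon>) (at x)"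
      by (simp only:)
    then show "((\<lambda>x. 2 * \<Psi> (h (x - t))) has_vector_derivative 2 * (W \<sigma> D2 (h (x - t)) + \<rho>^2) / \<epsilon>) (at x)"
      by (simp only: has_real_derivative_iff_has_vector_derivative)
  qed (use \<delta> in simp)
  have "integral {t-\<delta>..t} (\<lambda>x. 2 * (W \<sigma> D2 (h (x - t)) + \<rho>^2) / \<epsilon>) = 2 * (\<Psi> ?b - \<Psi> (-?b))"
    unfolding integral_unique[OF hi] using h0 by simp
  also have "\<Psi> ?b - \<Psi> (-?b) = integral {-?b..?b} V"
    using Henstock_Kurzweil_Integration.integral_combine[OF _ _ Vi, of "-?b-1" "-?b" ?b] b by (simp add: \<Psi>_def)
  also have "\<dots> \<le> integral {-?b..?b} (\<lambda>s. sqrt (W \<sigma> D2 s) + \<rho>)"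
  proof (rule integral_le[OF Vi])
    show "(\<lambda>s. sqrt (W \<sigma> D2 s) + \<rho>) integrable_on {-?b..?b}"
      by (intro integrable_continuous_real continuous_intros W_continuous)
    show "V s \<le> sqrt (W \<sigma> D2 s) + \<rho>" for s
      unfolding V_def using sqrt_add_le_add_sqrt[OF W_nonneg[OF \<sigma>, of s], of "\<rho>^2"] \<rho> by simp
  qed
  also have "\<dots> = integral {-?b..?b} (\<lambda>s. sqrt (W \<sigma> D2 s)) + integral {-?b..?b} (\<lambda>_. \<rho>)"
    by (intro Henstock_Kurzweil_Integration.integral_add integrable_continuous_real continuous_intros W_continuous)
  also have "integral {-?b..?b} (\<lambda>_. \<rho>) = 2 * ?b * \<rho>" using b by simp
  finally show ?thesis using Phi_eq_integral[OF \<sigma>, of ?b] b by simp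
qed

section \<open>Superposition of layers\<close>

lemma DERIV_locally_const:
  assumes "\<forall>\<^sub>F y in nhds x. f y = f x"
  shows "(f has_real_derivative 0) (at x)"
proof -
  have "((\<lambda>y. f x) has_real_derivative 0) (at x)" by simp
  then show ?thesis using DERIV_cong_ev[OF refl assms refl] by blast
qed

text \<open>Each factor \<open>- h (x - t) / \<beta>\<close> runs from 1 to -1, a continuous version
  of \<open>sgn (t - x)\<close>. The layers are disjoint, so near any point of an open layer, or
  outside the closed layers, all factors but at most one are locally \<plusminus>1. Inside a layer
  \<open>f\<close> is thus \<plusminus>\<open>h (x - t)\<close>; absolute values suffice for the
  energy because \<open>W\<close> is even.\<close>

lemma transition_product:
  fixes h :: "real \<Rightarrow> real" and T :: "real set"
  assumes T: "finite T" and \<beta>: "\<beta> > 0" and s: "s \<in> {-\<beta>, \<beta>}" and \<delta>: "\<delta> > 0"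
    and h1: "\<And>x. x \<ge> 0 \<Longrightarrow> h x = \<beta>" and h0: "\<And>x. x \<le> -\<delta> \<Longrightarrow> h x = -\<beta>"
    and hb: "\<And>x. \<bar>h x\<bar> \<le> \<beta>"
    and hd: "\<And>x. x \<in> {-\<delta><..<0} \<Longrightarrow> (h has_real_derivative H x) (at x)"
    and sep: "\<And>s t. s \<in> T \<Longrightarrow> t \<in> T \<Longrightarrow> s < t \<Longrightarrow> s + \<delta> < t"
  defines "f \<equiv> \<lambda>x. s * (\<Prod>t\<in>T. - h (x - t) / \<beta>)"
  shows transition_bound: "\<bar>f x\<bar> \<le> \<beta>"
    and transition_in: "t \<in> T \<Longrightarrow> x \<in> {t-\<delta><..<t} \<Longrightarrow>
        \<exists>D. (f has_real_derivative D) (at x) \<and> \<bar>D\<bar> = \<bar>H (x - t)\<bar> \<and> \<bar>f x\<bar> = \<bar>h (x - t)\<bar>"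
    and transition_out: "(\<And>t. t \<in> T \<Longrightarrow> x \<notin> {t-\<delta>..t}) \<Longrightarrow>
        (f has_real_derivative 0) (at x) \<and> f x = s * (\<Prod>t\<in>T. sgn (t - x)) \<and> \<bar>f x\<bar> = \<beta>"
    and transition_left: "(\<And>t. t \<in> T \<Longrightarrow> x \<le> t - \<delta>) \<Longrightarrow> f x = s"
    and transition_right: "(\<And>t. t \<in> T \<Longrightarrow> t \<le> x) \<Longrightarrow> f x = s * (-1) ^ card T"
proof -
  have sb: "\<bar>s\<bar> = \<beta>" using s \<beta> by auto
  show "\<bar>f x\<bar> \<le> \<beta>"
  proof -
    have "\<bar>\<Prod>t\<in>T. - h (x - t) / \<beta>\<bar> = (\<Prod>t\<in>T. \<bar>h (x - t)\<bar> / \<beta>)"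
      using \<beta> by (simp add: abs_prod)
    also have "\<dots> \<le> 1" by (rule prod_le_1) (use hb \<beta> in auto)
    finally show ?thesis unfolding f_def abs_mult sb using \<beta> by (simp add: mult_left_le)
  qed
  have out: "\<forall>\<^sub>F y in nhds x. - h (y - t) / \<beta> = sgn (t - x)" if "x \<notin> {t-\<delta>..t}" for x t
  proof (cases "x < t - \<delta>")
    case True
    then have "open {..<t-\<delta>}" "x \<in> {..<t-\<delta>}" by auto
    moreover have "\<forall>y\<in>{..<t-\<delta>}. - h (y - t) / \<beta> = sgn (t - x)"
      using True \<delta> \<beta> by (auto simp: h0 sgn_if)
    ultimately show ?thesis unfolding eventually_nhds by blast
  next
    case False
    then have "open {t<..}" "x \<in> {t<..}" using that by auto
    moreover have "\<forall>y\<in>{t<..}. - h (y - t) / \<beta> = sgn (t - x)"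
      using False that \<delta> \<beta> by (auto simp: h1 sgn_if)
    ultimately show ?thesis unfolding eventually_nhds by blast
  qed
  show "(f has_real_derivative 0) (at x) \<and> f x = s * (\<Prod>t\<in>T. sgn (t - x)) \<and> \<bar>f x\<bar> = \<beta>"
    if xo: "\<And>t. t \<in> T \<Longrightarrow> x \<notin> {t-\<delta>..t}"
  proof -
    have "\<forall>\<^sub>F y in nhds x. \<forall>t\<in>T. - h (y - t) / \<beta> = sgn (t - x)"
      by (intro eventually_ball_finite[OF T] ballI out xo)
    then have ev: "\<forall>\<^sub>F y in nhds x. f y = s * (\<Prod>t\<in>T. sgn (t - x))"
      by eventually_elim (auto simp: f_def intro!: prod.cong)
    then have fx: "f x = s * (\<Prod>t\<in>T. sgn (t - x))" by (rule eventually_nhds_x_imp_x)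
    have "\<bar>\<Prod>t\<in>T. sgn (t - x)\<bar> = (\<Prod>t\<in>T. \<bar>sgn (t - x)\<bar>)" by (rule abs_prod)
    also have "\<dots> = 1" by (rule prod.neutral) (use xo \<delta> in \<open>force simp: sgn_if\<close>)
    finally have "\<bar>f x\<bar> = \<beta>" unfolding fx abs_mult sb by simp
    moreover have "(f has_real_derivative 0) (at x)"
      by (rule DERIV_locally_const) (use ev fx in simp)
    ultimately show ?thesis using fx by blast
  qed
  show "\<exists>D. (f has_real_derivative D) (at x) \<and> \<bar>D\<bar> = \<bar>H (x - t)\<bar> \<and> \<bar>f x\<bar> = \<bar>h (x - t)\<bar>"
    if t: "t \<in> T" and x: "x \<in> {t-\<delta><..<t}"
  proof -
    have xo: "x \<notin> {r-\<delta>..r}" if "r \<in> T - {t}" for r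
      using sep[of r t] sep[of t r] that t x by (cases r t rule: linorder_cases) auto
    \<comment> \<open>Collects everything except the active factor; it has modulus 1 since
      \<bar>\<open>s\<close>\<bar> = \<beta>.\<close>
    define \<kappa> where "\<kappa> = s * (- 1 / \<beta>) * (\<Prod>r\<in>T-{t}. sgn (r - x))"
    have "\<bar>\<Prod>r\<in>T-{t}. sgn (r - x)\<bar> = (\<Prod>r\<in>T-{t}. \<bar>sgn (r - x)\<bar>)" by (rule abs_prod)
    also have "\<dots> = 1" by (rule prod.neutral) (use xo \<delta> in \<open>force simp: sgn_if\<close>)
    finally have \<kappa>: "\<bar>\<kappa>\<bar> = 1" unfolding \<kappa>_def abs_mult sb using \<beta> by simp
    have "\<forall>\<^sub>F y in nhds x. \<forall>r\<in>T-{t}. - h (y - r) / \<beta> = sgn (r - x)"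
      by (intro eventually_ball_finite ballI out xo) (use T in auto)
    then have ev: "\<forall>\<^sub>F y in nhds x. f y = \<kappa> * h (y - t)"
    proof eventually_elim
      case (elim y)
      have "(\<Prod>r\<in>T. - h (y - r) / \<beta>) = (- h (y - t) / \<beta>) * (\<Prod>r\<in>T-{t}. - h (y - r) / \<beta>)"
        by (rule prod.remove[OF T t])
      also have "(\<Prod>r\<in>T-{t}. - h (y - r) / \<beta>) = (\<Prod>r\<in>T-{t}. sgn (r - x))"
        using elim by (intro prod.cong) auto
      finally show ?case by (simp add: f_def \<kappa>_def)
    qed
    have "((\<lambda>y. h (y - t)) has_real_derivative H (x - t) * 1) (at x)"
      by (rule DERIV_chain2[OF hd]) (use x in \<open>auto intro!: derivative_eq_intros\<close>)
    then have "((\<lambda>y. \<kappa> * h (y - t)) has_real_derivative \<kappa> * H (x - t)) (at x)"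
      by (auto intro: DERIV_cmult)
    then have "(f has_real_derivative \<kappa> * H (x - t)) (at x)"
      using DERIV_cong_ev[OF refl ev refl] by blast
    moreover have "f x = \<kappa> * h (x - t)" using ev by (rule eventually_nhds_x_imp_x)
    ultimately show ?thesis using \<kappa> by (intro exI[of _ "\<kappa> * H (x - t)"]) (auto simp: abs_mult)
  qed
  show "f x = s" if "\<And>t. t \<in> T \<Longrightarrow> x \<le> t - \<delta>"
  proof -
    have "(\<Prod>t\<in>T. - h (x - t) / \<beta>) = 1"
      by (rule prod.neutral) (use that \<beta> in \<open>auto simp: h0 le_diff_eq algebra_simps\<close>)
    then show ?thesis by (simp add: f_def)
  qed
  show "f x = s * (-1) ^ card T" if "\<And>t. t \<in> T \<Longrightarrow> t \<le> x"
  proof -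
    have "(\<Prod>t\<in>T. - h (x - t) / \<beta>) = (\<Prod>t\<in>T. -1)"
      by (rule prod.cong) (use that \<beta> in \<open>auto simp: h1\<close>)
    then show ?thesis by (simp add: f_def)
  qed
qed

lemma integral_indicator_Ioo:
  fixes f :: "real \<Rightarrow> real"
  assumes sub: "{a<..<b} \<subseteq> {-l<..<l}" and c: "continuous_on {a..b} f"
  shows "integrable (leb_I l) (\<lambda>x. indicator {a<..<b} x * f x)"
    and "(\<integral>x. indicator {a<..<b} x * f x \<partial>leb_I l) = integral {a..b} f"
proof -
  have "bounded (f ` {a..b})" by (intro compact_imp_bounded compact_continuous_image c) auto
  then obtain B where B: "\<And>x. x \<in> {a..b} \<Longrightarrow> \<bar>f x\<bar> \<le> B"
    unfolding bounded_iff by (metis imageI real_norm_def)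
  have i: "integrable (lebesgue_on {a<..<b}) f"
  proof (rule integrable_bounded_interval)
    show "f \<in> borel_measurable (lebesgue_on {a<..<b})"
      by (intro continuous_on_measurable_interval continuous_on_subset[OF c]) auto
    show "AE x in lebesgue_on {a<..<b}. \<bar>f x\<bar> \<le> B" by (rule AE_I2) (use B in auto)
  qed
  then show "integrable (leb_I l) (\<lambda>x. indicator {a<..<b} x * f x)"
    using interval_restrict(2)[OF sub] by blast
  show "(\<integral>x. indicator {a<..<b} x * f x \<partial>leb_I l) = integral {a..b} f"
    unfolding interval_restrict(1)[OF sub, symmetric]
    using lebesgue_integral_eq_integral[OF i] by (simp add: integral_open_interval_real)
qed

section \<open>Recovery sequence\<close>

text \<open>For finite \<open>T\<close>, \<open>s\<close> is the value to the left of all of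
  \<open>T\<close>, and each point of \<open>T\<close> is a change of sign. On \<open>T\<close>
  itself the value is 0, so statements about \<bar>\<open>s\<close>\<bar> hold off this null
  set.\<close>

definition step_fun :: "real \<Rightarrow> real set \<Rightarrow> real \<Rightarrow> real"
  where "step_fun s T x = s * (\<Prod>t\<in>T. sgn (t - x))"

lemma abs_step_fun:
  assumes "finite T"
  shows "x \<notin> T \<Longrightarrow> \<bar>step_fun s T x\<bar> = \<bar>s\<bar>" "\<bar>step_fun s T x\<bar> \<le> \<bar>s\<bar>"
proof -
  have eq: "\<bar>\<Prod>t\<in>T. sgn (t - x)\<bar> = (\<Prod>t\<in>T. \<bar>sgn (t - x)\<bar>)" by (rule abs_prod)
  show "\<bar>step_fun s T x\<bar> = \<bar>s\<bar>" if "x \<notin> T"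
  proof -
    have "(\<Prod>t\<in>T. \<bar>sgn (t - x)\<bar>) = 1" by (rule prod.neutral) (use that in \<open>auto simp: sgn_if\<close>)
    then show ?thesis by (simp add: step_fun_def abs_mult eq)
  qed
  have "(\<Prod>t\<in>T. \<bar>sgn (t - x)\<bar>) \<le> 1" by (rule prod_le_1) (auto simp: sgn_if)
  then show "\<bar>step_fun s T x\<bar> \<le> \<bar>s\<bar>" by (simp add: step_fun_def abs_mult eq mult_left_le)
qed

lemma step_fun_measurable: "step_fun s T \<in> borel_measurable borel"
proof -
  have "sgn (t - x) = indicator {..<t} x - indicator {t<..} x" for t x :: real
    by (auto simp: sgn_if indicator_def)
  then have "step_fun s T = (\<lambda>x. s * (\<Prod>t\<in>T. indicator {..<t} x - indicator {t<..} x))"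
    by (simp add: step_fun_def fun_eq_iff)
  also have "\<dots> \<in> borel_measurable borel" by measurable
  finally show ?thesis .
qed

lemma step_fun_locally_const:
  assumes "finite T" "x \<notin> T"
  shows "\<forall>\<^sub>F y in nhds x. step_fun s T y = step_fun s T x"
proof -
  have "\<forall>\<^sub>F y in nhds x. \<forall>t\<in>T. sgn (t - y) = sgn (t - x)"
  proof (intro eventually_ball_finite assms(1) ballI)
    fix t assume "t \<in> T"
    then consider "t < x" | "x < t" using assms(2) by (cases t x rule: linorder_cases) auto
    then show "\<forall>\<^sub>F y in nhds x. sgn (t - y) = sgn (t - x)"
    proof cases
      case 1
      then show ?thesis unfolding eventually_nhds by (intro exI[of _ "{t<..}"]) (auto simp: sgn_if)
    next
      case 2
      then show ?thesis unfolding eventually_nhds by (intro exI[of _ "{..<t}"]) (auto simp: sgn_if)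
    qed
  qed
  then show ?thesis by eventually_elim (auto simp: step_fun_def)
qed

text \<open>The energy density and the error are controlled through majorants \<open>e\<close> and
  \<open>D\<close>, sums of functions carried by single layers. Their integrals are computed layer
  by layer, and the off-layer contribution is zero because \<open>f\<close> rests in a well
  there.\<close>

lemma recovery_angle:
  assumes \<sigma>: "\<sigma> > 0" "D2 > 0" and "l > 0" and r: "r > 0"
    and T: "finite T" "T \<subseteq> {-l<..l}" "even (card T)" and s: "s \<in> {- beta \<sigma> D2, beta \<sigma> D2}"
    and sep: "\<And>t. t \<in> T \<Longrightarrow> -l + d < t" "\<And>t t'. t \<in> T \<Longrightarrow> t' \<in> T \<Longrightarrow> t < t' \<Longrightarrow> t + d < t'"
    and small: "2 * beta \<sigma> D2 * r^3 \<le> d"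
  shows "\<exists>f v S (B :: real) e D. continuous_on UNIV f \<and> finite S \<and> f (-l) = f l
    \<and> (\<forall>x. x \<notin> S \<longrightarrow> (f has_real_derivative v x) (at x) \<and> \<bar>v x\<bar> \<le> B
        \<and> r^4 * (v x)^2 + W \<sigma> D2 (f x) / r^4 \<le> e x \<and> \<bar>f x - step_fun s T x\<bar> \<le> D x)
    \<and> integrable (leb_I l) e
    \<and> (\<integral>x. e x \<partial>leb_I l) \<le> card T * (Phi \<sigma> D2 (beta \<sigma> D2) + 4 * beta \<sigma> D2 * r)
    \<and> integrable (leb_I l) D
    \<and> (\<integral>x. D x \<partial>leb_I l) \<le> card T * (2 * beta \<sigma> D2 * (2 * beta \<sigma> D2 * r^3))"
proof -
  let ?b = "beta \<sigma> D2" and ?W = "W \<sigma> D2"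
  have b: "?b > 0" using beta_props[OF \<sigma>] by simp
  have r4: "r^4 > 0" using r by simp
  obtain \<delta> h where \<delta>: "\<delta> > 0" "\<delta> \<le> 2 * ?b * r^4 / r" and hc: "continuous_on UNIV h"
    and h1: "\<And>x. x \<ge> 0 \<Longrightarrow> h x = ?b" and h0: "\<And>x. x \<le> -\<delta> \<Longrightarrow> h x = - ?b"
    and hb: "\<And>x. \<bar>h x\<bar> \<le> ?b"
    and hd: "\<And>x. x \<in> {-\<delta><..<0} \<Longrightarrow> (h has_real_derivative sqrt (?W (h x) + r^2) / r^4) (at x)"
    using layer_exists[OF \<sigma> r4 r] by metis
  have \<delta>r: "\<delta> \<le> 2 * ?b * r^3" using \<delta>(2) r by (simp add: power4_eq_xxxx power3_eq_cube)
  then have \<delta>d: "\<delta> \<le> d" using small by simp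
  define H where "H x = sqrt (?W (h x) + r^2) / r^4" for x
  have sep': "t + \<delta> < t'" if "t \<in> T" "t' \<in> T" "t < t'" for t t'
    using sep(2)[OF that] \<delta>d by simp
  have hd': "\<And>x. x \<in> {-\<delta><..<0} \<Longrightarrow> (h has_real_derivative H x) (at x)"
    using hd by (simp add: H_def)
  define f where "f = (\<lambda>x. s * (\<Prod>t\<in>T. - h (x - t) / ?b))"
  have tr1: "\<bar>f x\<bar> \<le> ?b" for x
    unfolding f_def
    by (rule transition_bound[OF T(1) b s \<delta>(1)]) (fact h1 h0 hb hd' sep')+
  have tr2: "\<exists>D. (f has_real_derivative D) (at x) \<and> \<bar>D\<bar> = \<bar>H (x - t)\<bar> \<and> \<bar>f x\<bar> = \<bar>h (x - t)\<bar>"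
    if "t \<in> T" "x \<in> {t-\<delta><..<t}" for t x
    unfolding f_def
    by (rule transition_in[OF T(1) b s \<delta>(1)]) (fact h1 h0 hb hd' sep' that)+
  have tr3: "(f has_real_derivative 0) (at x) \<and> f x = s * (\<Prod>t\<in>T. sgn (t - x)) \<and> \<bar>f x\<bar> = ?b"
    if "\<And>t. t \<in> T \<Longrightarrow> x \<notin> {t-\<delta>..t}" for x
    unfolding f_def
    by (rule transition_out[OF T(1) b s \<delta>(1)]) (fact h1 h0 hb hd' sep' that)+
  have tr4: "f x = s" if "\<And>t. t \<in> T \<Longrightarrow> x \<le> t - \<delta>" for x
    unfolding f_def
    by (rule transition_left[OF T(1) b s \<delta>(1)]) (fact h1 h0 hb hd' sep' that)+
  have tr5: "f x = s * (-1) ^ card T" if "\<And>t. t \<in> T \<Longrightarrow> t \<le> x" for x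
    unfolding f_def
    by (rule transition_right[OF T(1) b s \<delta>(1)]) (fact h1 h0 hb hd' sep' that)+
  \<comment> \<open>The two ends of each layer, where \<open>f\<close> may have corners.\<close>
  define S where "S = T \<union> (\<lambda>t. t - \<delta>) ` T"
  define v where "v = deriv f"
  \<comment> \<open>On a layer \<open>r^4 * v^2\<close> equals \<open>(W + r^2) / r^4\<close>, so
    the density is \<open>(2 * W + r^2) / r^4\<close>; rounding \<open>r^2\<close> up to
    \<open>2 * r^2\<close> gives the integrand of \<open>layer_energy\<close>.\<close>
  define E where "E t x = indicator {t-\<delta><..<t} x * (2 * (?W (h (x - t)) + r^2) / r^4)" for t x
  define K where "K t x = indicator {t-\<delta><..<t} x * (2 * ?b)" for t x :: real
  define e where "e x = (\<Sum>t\<in>T. E t x)" for x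
  define D where "D x = (\<Sum>t\<in>T. K t x)" for x
  have Wnn: "0 \<le> ?W y" for y using W_nonneg[OF \<sigma>] .
  have "compact (?W ` {-?b..?b})" by (intro compact_continuous_image W_continuous) auto
  then have "bounded (?W ` {-?b..?b})" by (rule compact_imp_bounded)
  then obtain M where M: "\<And>y. y \<in> {-?b..?b} \<Longrightarrow> \<bar>?W y\<bar> \<le> M"
    unfolding bounded_iff by (metis imageI real_norm_def)
  define B where "B = sqrt (M + r^2) / r^4"
  have M0: "0 \<le> M" using M[of 0] b by force
  have B0: "0 \<le> B" using r M0 by (simp add: B_def)
  have Enn: "0 \<le> E t x" for t x using Wnn[of "h (x - t)"] by (simp add: E_def indicator_def)
  have Knn: "0 \<le> K t x" for t x using b by (simp add: K_def indicator_def)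
  have cases: "(\<exists>t\<in>T. x \<in> {t-\<delta><..<t}) \<or> (\<forall>t\<in>T. x \<notin> {t-\<delta>..t})" if "x \<notin> S" for x
  proof (rule ccontr)
    assume "\<not> ?thesis"
    then obtain t where t: "t \<in> T" "x \<in> {t-\<delta>..t}" "x \<notin> {t-\<delta><..<t}" by blast
    then have "x = t \<or> x = t - \<delta>" by auto
    then show False using t(1) that by (auto simp: S_def)
  qed
  have main: "(f has_real_derivative v x) (at x) \<and> \<bar>v x\<bar> \<le> B
      \<and> r^4 * (v x)^2 + ?W (f x) / r^4 \<le> e x \<and> \<bar>f x - step_fun s T x\<bar> \<le> D x" if x: "x \<notin> S" for x
    using cases[OF x]
  proof
    assume "\<exists>t\<in>T. x \<in> {t-\<delta><..<t}"
    then obtain t where t: "t \<in> T" "x \<in> {t-\<delta><..<t}" by blast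
    from tr2[OF this] obtain D' where D': "(f has_real_derivative D') (at x)"
      "\<bar>D'\<bar> = \<bar>H (x - t)\<bar>" "\<bar>f x\<bar> = \<bar>h (x - t)\<bar>" by blast
    have v: "v x = D'" unfolding v_def using D'(1) by (rule DERIV_imp_deriv)
    have Wf: "?W (f x) = ?W (h (x - t))"
      using D'(3) W_even[of \<sigma> D2] by (metis abs_eq_iff)
    have "(v x)^2 = (H (x - t))^2" using D'(2) v by (metis power2_abs)
    also have "\<dots> = (?W (h (x - t)) + r^2) / (r^4)^2"
      using Wnn[of "h (x - t)"] by (simp add: H_def power_divide)
    finally have vx: "(v x)^2 = (?W (h (x - t)) + r^2) / (r^4)^2" .
    have "a * (c / a^2) = c / a" if "a > 0" for a c :: real
      using that by (simp add: power2_eq_square)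
    from this[OF r4] have v2: "r^4 * (v x)^2 = (?W (h (x - t)) + r^2) / r^4"
      unfolding vx .
    have "r^4 * (v x)^2 + ?W (f x) / r^4 = (2 * ?W (h (x - t)) + r^2) / r^4"
      unfolding v2 Wf by (simp add: add_divide_distrib)
    also have "\<dots> \<le> 2 * (?W (h (x - t)) + r^2) / r^4"
      using r by (intro divide_right_mono) auto
    also have "\<dots> = E t x" using t(2) by (simp add: E_def)
    also have "\<dots> \<le> e x" unfolding e_def by (rule member_le_sum[OF t(1) Enn T(1)])
    finally have 1: "r^4 * (v x)^2 + ?W (f x) / r^4 \<le> e x" .
    have "\<bar>f x - step_fun s T x\<bar> \<le> 2 * ?b"
      using tr1[of x] abs_step_fun(2)[OF T(1), of s x] s b by auto
    also have "\<dots> = K t x" using t(2) by (simp add: K_def)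
    also have "\<dots> \<le> D x" unfolding D_def by (rule member_le_sum[OF t(1) Knn T(1)])
    finally have 2: "\<bar>f x - step_fun s T x\<bar> \<le> D x" .
    have "h (x - t) \<in> {-?b..?b}" using hb[of "x - t"] by auto
    from M[OF this] have "\<bar>H (x - t)\<bar> \<le> B"
      unfolding H_def B_def using Wnn[of "h (x - t)"] r
      by (auto intro!: divide_right_mono simp: abs_of_nonneg)
    then show ?thesis using 1 2 D' v by simp
  next
    assume "\<forall>t\<in>T. x \<notin> {t-\<delta>..t}"
    then have o: "(f has_real_derivative 0) (at x)" "f x = step_fun s T x" "\<bar>f x\<bar> = ?b"
      using tr3[of x] by (auto simp: step_fun_def)
    have "v x = 0" unfolding v_def using o(1) by (rule DERIV_imp_deriv)
    moreover have "f x = ?b \<or> f x = - ?b" using o(3) by linarith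
    then have "?W (f x) = 0" using W_beta[OF \<sigma>] by auto
    moreover have "0 \<le> e x" "0 \<le> D x" unfolding e_def D_def by (intro sum_nonneg Enn Knn)+
    ultimately show ?thesis using o B0 by simp
  qed
  have sub: "{t-\<delta><..<t} \<subseteq> {-l<..<l}" if "t \<in> T" for t
    using sep(1)[OF that] \<delta>d T(2) that by auto
  have cE: "continuous_on {t-\<delta>..t} (\<lambda>x. 2 * (?W (h (x - t)) + r^2) / r^4)" for t
    by (intro continuous_intros continuous_on_compose2[OF W_continuous[of UNIV]]
        continuous_on_compose2[OF hc]) (use r in auto)
  have iE: "integrable (leb_I l) (E t)" "(\<integral>x. E t x \<partial>leb_I l) \<le> Phi \<sigma> D2 ?b + 4 * ?b * r"
    if "t \<in> T" for t
    using integral_indicator_Ioo[OF sub[OF that] cE]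
      layer_energy[OF \<sigma> r4 r \<delta>(1) hc h1[of 0] h0[of "-\<delta>"] hb hd, of t]
    unfolding E_def by auto
  have iK: "integrable (leb_I l) (K t)" "(\<integral>x. K t x \<partial>leb_I l) \<le> 2 * ?b * (2 * ?b * r^3)"
    if "t \<in> T" for t
  proof -
    have "integral {t-\<delta>..t} (\<lambda>_. 2 * ?b) = 2 * ?b * \<delta>" using \<delta>(1) by simp
    also have "\<dots> \<le> 2 * ?b * (2 * ?b * r^3)" using \<delta>r b by (intro mult_left_mono) auto
    finally show "integrable (leb_I l) (K t)" "(\<integral>x. K t x \<partial>leb_I l) \<le> 2 * ?b * (2 * ?b * r^3)"
      using integral_indicator_Ioo[OF sub[OF that], of "\<lambda>_. 2 * ?b"] unfolding K_def by auto
  qed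
  show ?thesis
  proof (intro exI conjI)
    show "\<forall>x. x \<notin> S \<longrightarrow> (f has_real_derivative v x) (at x) \<and> \<bar>v x\<bar> \<le> B
        \<and> r^4 * (v x)^2 + ?W (f x) / r^4 \<le> e x \<and> \<bar>f x - step_fun s T x\<bar> \<le> D x"
      using main by blast
    show "continuous_on UNIV f"
      unfolding f_def by (intro continuous_intros continuous_on_compose2[OF hc]) (use b in auto)
    show "finite S" using T(1) by (simp add: S_def)
    have "f (-l) = s"
    proof (rule tr4)
      fix t assume "t \<in> T"
      then show "-l \<le> t - \<delta>" using sep(1)[of t] \<delta>d by simp
    qed
    \<comment> \<open>This includes the case \<open>l \<in> T\<close>, where the layer is completed
      exactly at \<open>l\<close>. Even cardinality then gives periodicity.\<close>
    moreover have "f l = s * (-1) ^ card T" by (rule tr5) (use T(2) in auto)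
    ultimately show "f (-l) = f l" using T(3) by simp
    show "integrable (leb_I l) e" unfolding e_def by (intro Bochner_Integration.integrable_sum iE)
    have "(\<integral>x. e x \<partial>leb_I l) = (\<Sum>t\<in>T. \<integral>x. E t x \<partial>leb_I l)"
      unfolding e_def by (intro Bochner_Integration.integral_sum iE)
    also have "\<dots> \<le> card T * (Phi \<sigma> D2 ?b + 4 * ?b * r)"
      using sum_bounded_above[of T "\<lambda>t. \<integral>x. E t x \<partial>leb_I l"] iE(2) by simp
    finally show "(\<integral>x. e x \<partial>leb_I l) \<le> card T * (Phi \<sigma> D2 ?b + 4 * ?b * r)" .
    show "integrable (leb_I l) D" unfolding D_def by (intro Bochner_Integration.integrable_sum iK)
    have "(\<integral>x. D x \<partial>leb_I l) = (\<Sum>t\<in>T. \<integral>x. K t x \<partial>leb_I l)"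
      unfolding D_def by (intro Bochner_Integration.integral_sum iK)
    also have "\<dots> \<le> card T * (2 * ?b * (2 * ?b * r^3))"
      using sum_bounded_above[of T "\<lambda>t. \<integral>x. K t x \<partial>leb_I l"] iK(2) by simp
    finally show "(\<integral>x. D x \<partial>leb_I l) \<le> card T * (2 * ?b * (2 * ?b * r^3))" .
  qed
qed

section \<open>The companion function of the angle and the energy of the pair\<close>

lemma abs_sin_diff_le: "\<bar>sin x - sin y\<bar> \<le> \<bar>x - y\<bar>" for x y :: real
proof -
  have "\<bar>sin x - sin y\<bar> = 2 * (\<bar>sin ((x - y) / 2)\<bar> * \<bar>cos ((x + y) / 2)\<bar>)"
    by (simp add: sin_diff_sin abs_mult)
  also have "\<dots> \<le> 2 * (\<bar>(x - y) / 2\<bar> * 1)"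
    by (intro mult_left_mono mult_mono abs_sin_x_le_abs_x) auto
  finally show ?thesis by simp
qed

lemma integrable_on_bounded_borel:
  fixes f :: "real \<Rightarrow> real"
  assumes "f \<in> borel_measurable borel" "\<And>x. \<bar>f x\<bar> \<le> B"
  shows "f integrable_on {a..b}" "integrable (leb_I l) f"
proof -
  have m: "f \<in> borel_measurable (lebesgue_on A)" for A
    using assms(1) by (intro measurable_restrict_space1 measurable_completion) simp
  show "f integrable_on {a..b}"
    by (rule measurable_bounded_by_integrable_imp_integrable[OF m, of "\<lambda>_. B"]) (use assms(2) in auto)
  show "integrable (leb_I l) f"
    by (rule integrable_bounded_interval[OF m]) (use assms(2) in auto)
qed

text \<open>\<open>R\<close> bounds the L1 distance of \<open>f\<close> from the step function,
  hence also that of the sines, and every other error is expressed through it. The derivative of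
  \<gamma> is \<open>m - sin f\<close>, so \<open>\<gamma>' + sin f\<close> is the constant
  \<open>m\<close>, the first energy term is zero, and the terms in \<open>m\<close> are at most a
  constant times \<open>m^2 / r^4\<close>.\<close>

lemma recovery_pair:
  assumes \<sigma>: "\<sigma> > 0" "D2 > 0" and l: "l > 0" and r: "r > 0"
    and T: "finite T" "T \<subseteq> {-l<..l}" "even (card T)" and s: "s \<in> {- beta \<sigma> D2, beta \<sigma> D2}"
    and sep: "\<And>t. t \<in> T \<Longrightarrow> -l + d < t" "\<And>t t'. t \<in> T \<Longrightarrow> t' \<in> T \<Longrightarrow> t < t' \<Longrightarrow> t + d < t'"
    and small: "2 * beta \<sigma> D2 * r^3 \<le> d"
    and \<theta>: "\<theta> \<in> borel_measurable (leb_I l)" "AE x in leb_I l. \<theta> x = step_fun s T x"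
      "(\<integral>x. \<theta> x \<partial>leb_I l) = 0"
    and g: "AE x in leb_I l. g x = k - integral {-l..x} (\<lambda>y. sin (step_fun s T y))"
    and gm: "g \<in> borel_measurable (leb_I l)"
  defines "R \<equiv> card T * (2 * beta \<sigma> D2 * (2 * beta \<sigma> D2 * r^3))"
  shows "\<exists>f \<gamma>. (f, \<gamma>) \<in> Y_C l \<and> norm_L1 l (\<lambda>x. f x - \<theta> x) \<le> R
    \<and> norm_L2 l (\<lambda>x. \<gamma> x - g x) \<le> 2 * R * sqrt (2 * l)
    \<and> F_C \<sigma> D1 D2 l (r^4) f \<gamma> \<le> ennreal ((5 * D2 + 1) * (R / (2 * l))^2 / r^4 * (2 * l)
        + card T * (Phi \<sigma> D2 (beta \<sigma> D2) + 4 * beta \<sigma> D2 * r))"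
proof -
  let ?b = "beta \<sigma> D2" and ?W = "W \<sigma> D2" and ?st = "step_fun s T"
  have b: "?b > 0" using beta_props[OF \<sigma>] by simp
  have sb: "\<bar>s\<bar> = ?b" using s b by auto
  have "\<exists>f v S (B :: real) e D. continuous_on UNIV f \<and> finite S \<and> f (-l) = f l
    \<and> (\<forall>x. x \<notin> S \<longrightarrow> (f has_real_derivative v x) (at x) \<and> \<bar>v x\<bar> \<le> B
        \<and> r^4 * (v x)^2 + ?W (f x) / r^4 \<le> e x \<and> \<bar>f x - ?st x\<bar> \<le> D x)
    \<and> integrable (leb_I l) e
    \<and> (\<integral>x. e x \<partial>leb_I l) \<le> card T * (Phi \<sigma> D2 ?b + 4 * ?b * r)
    \<and> integrable (leb_I l) D \<and> (\<integral>x. D x \<partial>leb_I l) \<le> R"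
    unfolding R_def by (rule recovery_angle[OF \<sigma> l r T s, of d]) (fact sep small)+
  then obtain f v S B e D where fc: "continuous_on UNIV f" and S: "finite S" and fper: "f (-l) = f l"
    and f: "\<forall>x. x \<notin> S \<longrightarrow> (f has_real_derivative v x) (at x) \<and> \<bar>v x\<bar> \<le> B
        \<and> r^4 * (v x)^2 + ?W (f x) / r^4 \<le> e x \<and> \<bar>f x - ?st x\<bar> \<le> D x"
    and ie: "integrable (leb_I l) e" "(\<integral>x. e x \<partial>leb_I l) \<le> card T * (Phi \<sigma> D2 ?b + 4 * ?b * r)"
    and iD: "integrable (leb_I l) D" "(\<integral>x. D x \<partial>leb_I l) \<le> R"
    by (elim exE conjE)
  from f have fd: "\<And>x. x \<notin> S \<Longrightarrow> (f has_real_derivative v x) (at x)"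
    and vB: "\<And>x. x \<notin> S \<Longrightarrow> \<bar>v x\<bar> \<le> B"
    and en: "\<And>x. x \<notin> S \<Longrightarrow> r^4 * (v x)^2 + ?W (f x) / r^4 \<le> e x"
    and fD: "\<And>x. x \<notin> S \<Longrightarrow> \<bar>f x - ?st x\<bar> \<le> D x"
    by blast+
  have nS: "AE x in lebesgue. x \<notin> S" and nT: "AE x in lebesgue. x \<notin> T"
    using S T(1) by (auto intro!: AE_not_in simp: negligible_finite simp flip: negligible_iff_null_sets)
  then have nS': "AE x in leb_I l. x \<notin> S" and nT': "AE x in leb_I l. x \<notin> T"
    by (auto simp: AE_leb_I_iff elim: eventually_mono)
  have R0: "0 \<le> R" unfolding R_def using b r by simp
  have fcA: "continuous_on A f" for A by (rule continuous_on_subset[OF fc]) simp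
  have fm: "f \<in> borel_measurable borel" using fc by (rule borel_measurable_continuous_onI)
  have fml: "f \<in> borel_measurable (leb_I l)" by (rule continuous_on_measurable_interval[OF fcA])
  have stm: "(\<lambda>x. sin (?st x)) \<in> borel_measurable borel" using step_fun_measurable[of s T] by simp
  have sfm: "(\<lambda>x. sin (f x)) \<in> borel_measurable borel" using fm by simp
  have isf: "integrable (leb_I l) (\<lambda>x. sin (f x))" "(\<lambda>x. sin (f x)) integrable_on {x..y}" for x y
    using integrable_on_bounded_borel[OF sfm, of 1] by auto
  have ist: "integrable (leb_I l) (\<lambda>x. sin (?st x))" "(\<lambda>x. sin (?st x)) integrable_on {x..y}" for x y
    using integrable_on_bounded_borel[OF stm, of 1] by auto
  have sml: "(\<lambda>x. sin (?st x)) \<in> borel_measurable (leb_I l)" using ist(1) by simp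
  have f\<theta>: "AE x in leb_I l. \<bar>f x - \<theta> x\<bar> \<le> D x"
    using \<theta>(2) nS' by eventually_elim (use fD in auto)
  have L1: "norm_L1 l (\<lambda>x. f x - \<theta> x) \<le> R"
  proof -
    have "norm_L1 l (\<lambda>x. f x - \<theta> x) \<le> (\<integral>x. D x \<partial>leb_I l)"
      unfolding norm_L1_def
    proof (rule integral_mono_AE[OF _ iD(1) f\<theta>])
      show "integrable (leb_I l) (\<lambda>x. \<bar>f x - \<theta> x\<bar>)"
        by (rule Bochner_Integration.integrable_bound[OF iD(1)])
          (use fml \<theta>(1) f\<theta> in \<open>auto elim: eventually_mono\<close>)
    qed
    then show ?thesis using iD(2) by simp
  qed
  have fst: "AE x in leb_I l. \<bar>sin (f x) - sin (?st x)\<bar> \<le> D x"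
    using nS' by eventually_elim (use fD abs_sin_diff_le order_trans in blast)
  \<comment> \<open>On the two values \<plusminus>\<beta> the sine is linear with slope
    \<open>sin \<beta> / \<beta>\<close>, so the constraint on the integral of \<theta> passes to
    its sine.\<close>
  have int_st: "(\<integral>x. sin (?st x) \<partial>leb_I l) = 0"
  proof -
    have "(\<integral>x. sin (?st x) \<partial>leb_I l) = (\<integral>x. sin ?b / ?b * \<theta> x \<partial>leb_I l)"
    proof (rule integral_cong_AE[OF sml])
      show "AE x in leb_I l. sin (?st x) = sin ?b / ?b * \<theta> x"
        using \<theta>(2) nT'
      proof eventually_elim
        case (elim x)
        have "\<bar>?st x\<bar> = ?b" using abs_step_fun(1)[OF T(1) elim(2)] sb by simp
        then have "?st x = ?b \<or> ?st x = - ?b" by linarith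
        then show ?case using elim(1) b by auto
      qed
    qed (use \<theta>(1) in simp)
    then show ?thesis using \<theta>(3) by simp
  qed
  have iabs: "integrable (leb_I l) (\<lambda>x. \<bar>sin (f x) - sin (?st x)\<bar>)"
    using isf(1) ist(1) by auto
  have diffR: "(\<integral>x. \<bar>sin (f x) - sin (?st x)\<bar> \<partial>leb_I l) \<le> R"
    using integral_mono_AE[OF iabs iD(1) fst] iD(2) by simp
  \<comment> \<open>The mean of \<open>sin f\<close>: precisely the constant that makes the integral
    of \<open>g'\<close> over the interval vanish, that is, \<gamma> periodic.\<close>
  define m where "m = (\<integral>x. sin (f x) \<partial>leb_I l) / (2 * l)"
  have "(\<integral>x. sin (f x) \<partial>leb_I l) = (\<integral>x. sin (f x) - sin (?st x) \<partial>leb_I l)"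
    using isf(1) ist(1) int_st by simp
  then have "\<bar>\<integral>x. sin (f x) \<partial>leb_I l\<bar> \<le> (\<integral>x. \<bar>sin (f x) - sin (?st x)\<bar> \<partial>leb_I l)"
    by (metis integral_abs_bound)
  then have "\<bar>\<integral>x. sin (f x) \<partial>leb_I l\<bar> \<le> R" using diffR by linarith
  then have mR: "\<bar>m\<bar> \<le> R / (2 * l)" unfolding m_def using l by (simp add: divide_right_mono)
  have m_const: "(\<integral>x. c \<partial>leb_I l) = 2 * l * c" for c :: real
    using l by (simp add: measure_restrict_space)
  \<comment> \<open>The crude bound by 1 lets \<open>m^4\<close> be absorbed by \<open>m^2\<close>
    in the quartic term.\<close>
  have "\<bar>\<integral>x. sin (f x) \<partial>leb_I l\<bar> \<le> (\<integral>x. \<bar>sin (f x)\<bar> \<partial>leb_I l)" by (rule integral_abs_bound)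
  also have "\<dots> \<le> (\<integral>x. 1 \<partial>leb_I l)"
    by (rule integral_mono) (use isf(1) integrable_on_bounded_borel(2)[of "\<lambda>_. 1" 1 l] in auto)
  finally have m1: "\<bar>m\<bar> \<le> 1" unfolding m_def m_const using l by (simp add: divide_le_eq_1)
  define g' where "g' x = m - sin (f x)" for x
  define \<gamma> where "\<gamma> x = k + integral {-l..x} g'" for x
  define w where "w x = - cos (f x) * v x" for x
  have g'c: "continuous_on A g'" for A unfolding g'_def by (intro continuous_intros fcA)
  have g'i: "g' integrable_on {x..y}" for x y by (intro integrable_continuous_real g'c)
  have \<gamma>c: "continuous_on {-l..l} \<gamma>"
    unfolding \<gamma>_def by (intro continuous_intros indefinite_integral_continuous_1 g'i)
  have \<gamma>d: "(\<gamma> has_real_derivative g' x) (at x)" if "x \<in> {-l<..<l}" for x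
  proof -
    have "((\<lambda>x. integral {-l..x} g') has_real_derivative g' x) (at x within {-l..l})"
      by (rule integral_has_real_derivative[OF g'c]) (use that in auto)
    then have "((\<lambda>x. integral {-l..x} g') has_real_derivative g' x) (at x)"
      using that by (simp add: at_within_Icc_at)
    then show ?thesis unfolding \<gamma>_def by (auto intro!: derivative_eq_intros)
  qed
  have g'd: "(g' has_real_derivative w x) (at x)" if "x \<notin> S" for x
    unfolding g'_def w_def using DERIV_diff[OF DERIV_const DERIV_fun_sin[OF fd[OF that]], of m] by simp
  have \<gamma>per: "\<gamma> (-l) = \<gamma> l"
  proof -
    have "integral {-l..l} g' = integral {-l..l} (\<lambda>_. m) - integral {-l..l} (\<lambda>x. sin (f x))"
      unfolding g'_def by (intro Henstock_Kurzweil_Integration.integral_diff isf) auto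
    also have "integral {-l..l} (\<lambda>x. sin (f x)) = (\<integral>x. sin (f x) \<partial>leb_I l)"
      using lebesgue_integral_eq_integral[OF isf(1)] by (simp add: integral_open_interval_real)
    finally show ?thesis using l by (simp add: \<gamma>_def m_def)
  qed
  have wB: "\<bar>w x\<bar> \<le> B" if "x \<notin> S" for x
  proof -
    have "\<bar>w x\<bar> \<le> 1 * \<bar>v x\<bar>" unfolding w_def abs_mult by (intro mult_right_mono) auto
    then show ?thesis using vB[OF that] by simp
  qed
  have Y: "(f, \<gamma>) \<in> Y_C l" and wd: "AE x in leb_I l. weak_deriv l f x = v x \<and> weak_deriv l \<gamma> x = g' x
      \<and> weak_deriv l (weak_deriv l \<gamma>) x = w x"
    using Y_C_I[OF l S fcA \<gamma>c g'c, of v w B] fd \<gamma>d g'd vB wB fper \<gamma>per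
    by (auto simp: g'_def)
  \<comment> \<open>Both functions start from \<open>k\<close>. One \<open>R\<close> comes from
    \<open>2 * l * \<bar>m\<bar>\<close>, the other from the difference of the sines.\<close>
  have close: "\<bar>\<gamma> x - (k - integral {-l..x} (\<lambda>y. sin (?st y)))\<bar> \<le> 2 * R" if x: "x \<in> {-l..l}" for x
  proof -
    let ?K = "\<lambda>y. \<bar>m\<bar> + \<bar>sin (f y) - sin (?st y)\<bar>"
    have Ki: "integrable (leb_I l) ?K" "?K integrable_on {y..z}" for y z
    proof -
      have "?K \<in> borel_measurable borel" using fm stm by simp
      moreover have "\<bar>?K y\<bar> \<le> \<bar>m\<bar> + 2" for y
        using abs_sin_le_one[of "f y"] abs_sin_le_one[of "?st y"] by linarith
      ultimately show "integrable (leb_I l) ?K" "?K integrable_on {y..z}"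
        using integrable_on_bounded_borel by blast+
    qed
    have "\<gamma> x - (k - integral {-l..x} (\<lambda>y. sin (?st y))) = integral {-l..x} (\<lambda>y. g' y + sin (?st y))"
      unfolding \<gamma>_def by (subst Henstock_Kurzweil_Integration.integral_add[OF g'i ist(2)]) simp
    also have "\<bar>\<dots>\<bar> \<le> integral {-l..x} ?K"
    proof -
      have "(\<lambda>y. g' y + sin (?st y)) integrable_on {-l..x}"
        by (rule Henstock_Kurzweil_Integration.integrable_add[OF g'i ist(2)])
      from Henstock_Kurzweil_Integration.integral_norm_bound_integral[OF this Ki(2)]
      show ?thesis by (force simp: g'_def)
    qed
    also have "\<dots> \<le> integral {-l..l} ?K"
      by (rule integral_subset_le[OF _ Ki(2) Ki(2)]) (use x in auto)
    also have "\<dots> = (\<integral>y. ?K y \<partial>leb_I l)"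
      using lebesgue_integral_eq_integral[OF Ki(1)] by (simp add: integral_open_interval_real)
    also have "\<dots> = 2 * l * \<bar>m\<bar> + (\<integral>y. \<bar>sin (f y) - sin (?st y)\<bar> \<partial>leb_I l)"
    proof -
      have "integrable (leb_I l) (\<lambda>_. \<bar>m\<bar>)"
        by (rule integrable_on_bounded_borel(2)[where B="\<bar>m\<bar>"]) auto
      from Bochner_Integration.integral_add[OF this iabs] show ?thesis unfolding m_const .
    qed
    also have "\<dots> \<le> 2 * R" using diffR mR l by (simp add: field_simps)
    finally show ?thesis .
  qed
  have "\<bar>\<gamma> x - g x\<bar> \<le> 2 * R" if "g x = k - integral {-l..x} (\<lambda>y. sin (step_fun s T y))" "x \<in> {-l..l}" for x
    using close[OF that(2)] that(1) by simp
  then have ae2: "AE x in leb_I l. \<bar>\<gamma> x - g x\<bar> \<le> 2 * R"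
    using g space_interval_AE[of "-l" l] by (auto elim: eventually_elim2)
  have L2: "norm_L2 l (\<lambda>x. \<gamma> x - g x) \<le> 2 * R * sqrt (2 * l)"
  proof -
    have "(\<integral>x. (\<gamma> x - g x)^2 \<partial>leb_I l) \<le> (\<integral>x. (2 * R)^2 \<partial>leb_I l)"
    proof (rule integral_mono_AE')
      show "integrable (leb_I l) (\<lambda>x. (2 * R)^2)"
        by (rule integrable_on_bounded_borel(2)[where B="\<bar>(2 * R)^2\<bar>"]) auto
      show "AE x in leb_I l. (\<gamma> x - g x)^2 \<le> (2 * R)^2"
        using ae2 by eventually_elim (metis abs_ge_zero power2_abs power_mono)
    qed auto
    then have "norm_L2 l (\<lambda>x. \<gamma> x - g x) \<le> sqrt ((2 * R)^2 * (2 * l))"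
      unfolding norm_L2_def m_const by (simp add: mult.commute)
    also have "\<dots> = 2 * R * sqrt (2 * l)" unfolding real_sqrt_mult[of "(2 * R)^2"] real_sqrt_abs using R0 by simp
    finally show ?thesis .
  qed
  \<comment> \<open>\<open>5 * D2 + 1\<close> adds \<open>D2\<close> for the quartic term (its
    factor 1/2 rounded up), 1 for the quadratic term and \<open>4 * D2\<close> for the one weighted
    by the sine.\<close>
  define C where "C = (5 * D2 + 1) * (R / (2 * l))^2 / r^4"
  have C0: "0 \<le> C" unfolding C_def using \<sigma> by simp
  have dens: "D1 * r^4 * (w x + cos (f x) * v x)^2 + D2 / (2 * r^4) * (g' x + sin (f x))^4
        + 1 / r^4 * (g' x + sin (f x))^2 + 4 * D2 / r^4 * (g' x + sin (f x))^2 * sin (f x / 2)^4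
        + r^4 * (v x)^2 + 1 / r^4 * ?W (f x) \<le> C + e x" if x: "x \<notin> S" for x
  proof -
    have mm: "m^2 \<le> (R / (2 * l))^2" using mR by (metis abs_ge_zero power2_abs power_mono)
    have m2: "m^2 \<le> 1" using m1 by (simp add: abs_square_le_1)
    have m4: "m^4 \<le> m^2" using mult_right_mono[OF m2, of "m^2"] by (simp add: power4_eq_xxxx power2_eq_square)
    have s4: "sin (f x / 2)^4 \<le> 1"
      using power_mono[OF abs_sin_le_one[of "f x / 2"], of 4] by simp
    have "D2 / (2 * r^4) * m^4 + 1 / r^4 * m^2 + 4 * D2 / r^4 * m^2 * sin (f x / 2)^4
        \<le> D2 / r^4 * m^2 + 1 / r^4 * m^2 + 4 * D2 / r^4 * m^2 * 1"
    proof (intro add_mono order_refl)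
      have "D2 / (2 * r^4) * m^4 \<le> D2 / (2 * r^4) * m^2" using m4 \<sigma> r by (intro mult_left_mono) auto
      also have "\<dots> \<le> D2 / r^4 * m^2" using \<sigma> r by (intro mult_right_mono frac_le) auto
      finally show "D2 / (2 * r^4) * m^4 \<le> D2 / r^4 * m^2" .
      show "4 * D2 / r^4 * m^2 * sin (f x / 2)^4 \<le> 4 * D2 / r^4 * m^2 * 1"
        using s4 \<sigma> r by (intro mult_left_mono) auto
    qed
    also have "\<dots> = (5 * D2 + 1) * m^2 / r^4" by (simp add: add_divide_distrib ring_distribs)
    also have "\<dots> \<le> C" unfolding C_def using mm \<sigma> r by (intro divide_right_mono mult_left_mono) auto
    finally show ?thesis using en[OF x] by (simp add: g'_def w_def)
  qed
  have enn: "0 \<le> e x" if "x \<notin> S" for x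
  proof -
    have "0 \<le> r^4 * (v x)^2 + ?W (f x) / r^4" using W_nonneg[OF \<sigma>, of "f x"] r by simp
    then show ?thesis using en[OF that] by simp
  qed
  have iC: "integrable (leb_I l) (\<lambda>x. C + e x)"
  proof -
    have "integrable (leb_I l) (\<lambda>_. C)"
      by (rule integrable_on_bounded_borel(2)[where B="\<bar>C\<bar>"]) auto
    then show ?thesis using ie(1) by (rule Bochner_Integration.integrable_add)
  qed
  have "F_C \<sigma> D1 D2 l (r^4) f \<gamma> \<le> (\<integral>\<^sup>+x. ennreal (C + e x) \<partial>leb_I l)"
    unfolding F_C_def Let_def
  proof (rule nn_integral_mono_AE)
    show "AE x in leb_I l. ennreal (
          D1 * r^4 * (weak_deriv l (weak_deriv l \<gamma>) x + cos (f x) * weak_deriv l f x)^2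
        + D2 / (2 * r^4) * (weak_deriv l \<gamma> x + sin (f x))^4
        + 1 / r^4 * (weak_deriv l \<gamma> x + sin (f x))^2
        + 4 * D2 / r^4 * (weak_deriv l \<gamma> x + sin (f x))^2 * sin (f x / 2)^4
        + r^4 * (weak_deriv l f x)^2
        + 1 / r^4 * W \<sigma> D2 (f x)) \<le> ennreal (C + e x)"
      using wd nS'
    proof eventually_elim
      case (elim x)
      then have 1: "weak_deriv l f x = v x" "weak_deriv l \<gamma> x = g' x"
        "weak_deriv l (weak_deriv l \<gamma>) x = w x" by auto
      show ?case unfolding 1 by (rule ennreal_leI[OF dens[OF elim(2)]])
    qed
  qed
  also have "\<dots> = ennreal (\<integral>x. C + e x \<partial>leb_I l)"
  proof (rule nn_integral_eq_integral[OF iC])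
    show "AE x in leb_I l. 0 \<le> C + e x" using nS' by eventually_elim (use enn C0 in simp)
  qed
  also have "\<dots> \<le> ennreal (C * (2 * l) + card T * (Phi \<sigma> D2 ?b + 4 * ?b * r))"
  proof (rule ennreal_leI)
    have "integrable (leb_I l) (\<lambda>_. C)"
      by (rule integrable_on_bounded_borel(2)[where B="\<bar>C\<bar>"]) auto
    from Bochner_Integration.integral_add[OF this ie(1)]
    have "(\<integral>x. C + e x \<partial>leb_I l) = 2 * l * C + (\<integral>x. e x \<partial>leb_I l)" unfolding m_const .
    then show "(\<integral>x. C + e x \<partial>leb_I l) \<le> C * (2 * l) + card T * (Phi \<sigma> D2 ?b + 4 * ?b * r)"
      using ie(2) by simp
  qed
  finally have "F_C \<sigma> D1 D2 l (r^4) f \<gamma> \<le> ennreal (C * (2 * l) + card T * (Phi \<sigma> D2 ?b + 4 * ?b * r))" .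
  then show ?thesis using Y L1 L2 unfolding C_def by blast
qed

section \<open>Approximation in the case of infinite limit energy\<close>

lemma density_Y_C:
  assumes l: "l > 0" and \<theta>: "\<theta> \<in> L1 l" and g: "g \<in> L2 l"
  obtains \<theta>s gs :: "nat \<Rightarrow> real \<Rightarrow> real" where "\<And>j. (\<theta>s j, gs j) \<in> Y_C l"
    "(\<lambda>j. norm_L1 l (\<lambda>x. \<theta>s j x - \<theta> x)) \<longlonglongrightarrow> 0"
    "(\<lambda>j. norm_L2 l (\<lambda>x. gs j x - g x)) \<longlonglongrightarrow> 0"
proof -
  have ex: "\<exists>p q. (p, q) \<in> Y_C l \<and> norm_L1 l (\<lambda>x. p x - \<theta> x) \<le> 1 / real (Suc j)
      \<and> norm_L2 l (\<lambda>x. q x - g x) \<le> sqrt (1 / real (Suc j))" for j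
  proof -
    have ll: "-l < l" using l by simp
    have \<theta>m: "\<theta> \<in> borel_measurable (leb_I l)" and \<theta>i: "integrable (leb_I l) (\<lambda>x. \<bar>\<theta> x\<bar>^1)"
      using \<theta> by (auto simp: L1_def)
    have gm: "g \<in> borel_measurable (leb_I l)" and gi: "integrable (leb_I l) (\<lambda>x. \<bar>g x\<bar>^2)"
      using g by (auto simp: L2_def)
    have e: "1 / real (Suc j) > 0" by simp
    obtain p where p: "real_polynomial_function p" "p (-l) = 0" "p l = 0"
      "(\<integral>x. \<bar>\<theta> x - p x\<bar>^1 \<partial>leb_I l) < 1 / real (Suc j)"
      by (rule polynomial_dense[where p=1, OF ll _ \<theta>m \<theta>i e]) (simp, blast)
    obtain q where q: "real_polynomial_function q" "q (-l) = 0" "q l = 0"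
      "\<And>D x. x \<in> {-l, l} \<Longrightarrow> (q has_real_derivative D) (at x) \<Longrightarrow> D = 0"
      "(\<integral>x. \<bar>g x - q x\<bar>^2 \<partial>leb_I l) < 1 / real (Suc j)"
      by (rule polynomial_dense[where p=2, OF ll _ gm gi e]) (simp, blast)
    have "(p, q) \<in> Y_C l" by (rule polynomial_Y_C[OF l p(1) q(1) p(2,3) q(2,3)]) (rule q(4))
    moreover have "norm_L1 l (\<lambda>x. p x - \<theta> x) \<le> 1 / real (Suc j)"
      using p(4) by (simp add: norm_L1_def abs_minus_commute)
    moreover have "(q x - g x)^2 = \<bar>g x - q x\<bar>^2" for x by (simp add: power2_commute)
    then have "norm_L2 l (\<lambda>x. q x - g x) \<le> sqrt (1 / real (Suc j))"
      unfolding norm_L2_def using q(5) by (intro real_sqrt_le_mono) simp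
    ultimately show ?thesis by blast
  qed
  have "\<forall>j. \<exists>p q. (p, q) \<in> Y_C l \<and> norm_L1 l (\<lambda>x. p x - \<theta> x) \<le> 1 / real (Suc j)
      \<and> norm_L2 l (\<lambda>x. q x - g x) \<le> sqrt (1 / real (Suc j))"
    using ex by blast
  from choice[OF this] obtain \<theta>s where
    "\<forall>j. \<exists>q. (\<theta>s j, q) \<in> Y_C l \<and> norm_L1 l (\<lambda>x. \<theta>s j x - \<theta> x) \<le> 1 / real (Suc j)
      \<and> norm_L2 l (\<lambda>x. q x - g x) \<le> sqrt (1 / real (Suc j))" by blast
  from choice[OF this] obtain gs where
    "\<forall>j. (\<theta>s j, gs j) \<in> Y_C l \<and> norm_L1 l (\<lambda>x. \<theta>s j x - \<theta> x) \<le> 1 / real (Suc j)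
      \<and> norm_L2 l (\<lambda>x. gs j x - g x) \<le> sqrt (1 / real (Suc j))" by blast
  then have Y: "\<And>j. (\<theta>s j, gs j) \<in> Y_C l"
    and 1: "\<And>j. norm_L1 l (\<lambda>x. \<theta>s j x - \<theta> x) \<le> 1 / real (Suc j)"
    and 2: "\<And>j. norm_L2 l (\<lambda>x. gs j x - g x) \<le> sqrt (1 / real (Suc j))" by blast+
  have lim: "(\<lambda>j. 1 / real (Suc j)) \<longlonglongrightarrow> 0" using LIMSEQ_inverse_real_of_nat by (simp add: inverse_eq_divide)
  have "(\<lambda>j. norm_L1 l (\<lambda>x. \<theta>s j x - \<theta> x)) \<longlonglongrightarrow> 0"
    by (rule tendsto_sandwich[OF _ _ tendsto_const lim])
      (use 1 in \<open>auto intro!: always_eventually simp: norm_L1_def\<close>)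
  moreover have "(\<lambda>j. norm_L2 l (\<lambda>x. gs j x - g x)) \<longlonglongrightarrow> 0"
  proof (rule tendsto_sandwich[OF _ _ tendsto_const])
    show "(\<lambda>j. sqrt (1 / real (Suc j))) \<longlonglongrightarrow> 0" using tendsto_real_sqrt[OF lim] by simp
  qed (use 2 in \<open>auto intro!: always_eventually simp: norm_L2_def\<close>)
  ultimately show ?thesis using that Y by blast
qed

section \<open>Structure of pairs of finite limit energy\<close>

text \<open>If \<theta> is a.e. equal to \<open>s\<close> near the end point, its mean deviation
  from any \<open>t\<close> is eventually \<bar>\<open>s - t\<close>\<bar>. This tends to 0 for
  \<open>t = s\<close> only, which gives existence and uniqueness for the definite
  description.\<close>

lemma trace_eqI:
  assumes l: "l > 0" and m: "\<theta> \<in> borel_measurable (leb_I l)" and d: "0 < d" "d \<le> 2 * l"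
  shows "AE x in leb_I l. x < -l + d \<longrightarrow> \<theta> x = s \<Longrightarrow> trace_left l \<theta> = s"
    and "AE x in leb_I l. l - d < x \<longrightarrow> \<theta> x = s \<Longrightarrow> trace_right l \<theta> = s"
proof -
  have avg: "(\<integral>x. \<bar>\<theta> x - t\<bar> \<partial>lebesgue_on {a<..<a+r}) / r = \<bar>s - t\<bar>"
    if "-l \<le> a" "a + r \<le> l" "0 < r" and ae: "AE x in leb_I l. a < x \<and> x < a + r \<longrightarrow> \<theta> x = s" for a r t
  proof -
    let ?M = "lebesgue_on {a<..<a+r}"
    have "{a<..<a+r} \<subseteq> {-l<..<l}" using that by auto
    then have "\<theta> \<in> borel_measurable ?M" using measurable_subinterval_lebesgue m by blast
    moreover have "AE x in ?M. \<bar>\<theta> x - t\<bar> = \<bar>s - t\<bar>"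
    proof -
      have "AE x in lebesgue. x \<in> {a<..<a+r} \<longrightarrow> \<bar>\<theta> x - t\<bar> = \<bar>s - t\<bar>"
        using ae unfolding AE_leb_I_iff by eventually_elim (use that in auto)
      then show ?thesis by (simp add: AE_restrict_space_iff)
    qed
    ultimately have "(\<integral>x. \<bar>\<theta> x - t\<bar> \<partial>?M) = (\<integral>x. \<bar>s - t\<bar> \<partial>?M)"
      by (intro integral_cong_AE) auto
    also have "\<dots> = r * \<bar>s - t\<bar>" using that by (simp add: measure_restrict_space)
    finally show ?thesis using that by simp
  qed
  have the: "(THE t. (F t \<longlongrightarrow> 0) (at_right 0)) = s"
    if ev: "\<And>t. \<forall>\<^sub>F r in at_right 0. F t r = \<bar>s - t\<bar>" for F :: "real \<Rightarrow> real \<Rightarrow> real"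
  proof (rule the_equality)
    show "(F s \<longlongrightarrow> 0) (at_right 0)" by (rule tendsto_eventually) (use ev[of s] in simp)
    fix t assume F0: "(F t \<longlongrightarrow> 0) (at_right 0)"
    have "(F t \<longlongrightarrow> \<bar>s - t\<bar>) (at_right 0)" by (rule tendsto_eventually[OF ev])
    from tendsto_unique[OF trivial_limit_at_right_real F0 this] show "t = s" by simp
  qed
  have ev: "\<forall>\<^sub>F r in at_right 0. 0 < r \<and> r < d"
    using eventually_at_right_less[of "0::real"] eventually_at_right_0_less[OF d(1)] by eventually_elim simp
  show "trace_left l \<theta> = s" if "AE x in leb_I l. x < -l + d \<longrightarrow> \<theta> x = s"
    unfolding trace_left_def
  proof (rule the)
    fix t
    show "\<forall>\<^sub>F r in at_right 0. (\<integral>x. \<bar>\<theta> x - t\<bar> \<partial>lebesgue_on {-l<..<-l+r}) / r = \<bar>s - t\<bar>"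
      using ev
    proof eventually_elim
      case (elim r)
      show ?case by (rule avg) (use elim d that in \<open>auto elim: eventually_mono\<close>)
    qed
  qed
  show "trace_right l \<theta> = s" if "AE x in leb_I l. l - d < x \<longrightarrow> \<theta> x = s"
    unfolding trace_right_def
  proof (rule the)
    fix t
    show "\<forall>\<^sub>F r in at_right 0. (\<integral>x. \<bar>\<theta> x - t\<bar> \<partial>lebesgue_on {l-r<..<l}) / r = \<bar>s - t\<bar>"
      using ev
    proof eventually_elim
      case (elim r)
      have "(\<integral>x. \<bar>\<theta> x - t\<bar> \<partial>lebesgue_on {l-r<..<l-r+r}) / r = \<bar>s - t\<bar>"
        by (rule avg) (use elim d that in \<open>auto elim: eventually_mono\<close>)
      then show ?case by simp
    qed
  qed
qed

lemma measurable_leb_I_AE: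
  fixes u u' :: "real \<Rightarrow> real"
  assumes "u' \<in> borel_measurable (leb_I l)" "AE x in leb_I l. u' x = u x"
  shows "u \<in> borel_measurable (leb_I l)"
proof -
  have "(\<lambda>x. indicator {-l<..<l} x *\<^sub>R u' x) \<in> borel_measurable lebesgue"
    using assms(1) by (subst (asm) borel_measurable_restrict_space_iff) auto
  moreover have "AE x in lebesgue. indicator {-l<..<l} x *\<^sub>R u' x = indicator {-l<..<l} x *\<^sub>R u x"
    using assms(2) unfolding AE_leb_I_iff by eventually_elim (auto simp: indicator_def)
  ultimately have "(\<lambda>x. indicator {-l<..<l} x *\<^sub>R u x) \<in> borel_measurable lebesgue"
    by (rule borel_measurable_AE)
  then show ?thesis by (subst borel_measurable_restrict_space_iff) auto
qed

text \<open>Recovers \<open>g\<close> from the constraint in \<open>A_C\<close>: the explicit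
  primitive \<open>G\<close> has the same weak derivative almost everywhere, so \<open>g - G\<close>
  is a.e. constant. This formula is what \<open>recovery_pair\<close> compares \<gamma>
  with.\<close>

lemma W12_primitive_step:
  assumes l: "l > 0" and g: "g \<in> W12 l" and T: "finite T"
    and ae: "AE x in leb_I l. weak_deriv l g x + sin (step_fun s T x) = 0"
  obtains k where "AE x in leb_I l. g x = k - integral {-l..x} (\<lambda>y. sin (step_fun s T y))"
proof -
  let ?S = "\<lambda>y. sin (step_fun s T y)"
  have Sm: "?S \<in> borel_measurable borel" using step_fun_measurable[of s T] by simp
  have Si: "?S integrable_on {x..y}" for x y by (rule integrable_on_bounded_borel[OF Sm, of 1]) simp
  define G where "G x = - integral {-l..x} ?S" for x
  have Gc: "continuous_on {-l..l} G"
    unfolding G_def by (intro continuous_intros indefinite_integral_continuous_1 Si)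
  have Gd: "(G has_real_derivative - ?S x) (at x)" if x: "x \<in> {-l<..<l} - T" for x
  proof -
    \<comment> \<open>The integrand is locally constant off \<open>T\<close>, so its primitive is
      classically differentiable there.\<close>
    have "isCont ?S x"
    proof -
      have "\<forall>\<^sub>F y in nhds x. ?S y = ?S x"
        using step_fun_locally_const[OF T, of x s] x by (auto elim: eventually_mono)
      from DERIV_locally_const[of ?S, OF this] show ?thesis by (rule DERIV_isCont)
    qed
    then have "continuous (at x within {-l..l}) ?S" by (rule continuous_at_imp_continuous_at_within)
    then have "((\<lambda>u. integral {-l..u} ?S) has_vector_derivative ?S x) (at x within {-l..l})"
      using integral_has_vector_derivative_continuous_at[OF Si, of x "-l" l "{}"] x by simp
    then have "((\<lambda>u. integral {-l..u} ?S) has_real_derivative ?S x) (at x)"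
      using x by (simp add: has_real_derivative_iff_has_vector_derivative at_within_Icc_at)
    then show ?thesis unfolding G_def by (rule DERIV_minus)
  qed
  have wG: "(\<lambda>x. - ?S x) \<in> L2 l" "has_weak_deriv l G (\<lambda>x. - ?S x)"
    using piecewise_has_weak_deriv[OF l Gc T Gd, of 1] by auto
  have gL: "g \<in> L2 l" using g by (simp add: W12_def)
  have GL: "G \<in> L2 l" by (rule L2_continuous[OF Gc])
  note wg = W12_weak_deriv[OF g]
  have "has_weak_deriv l (\<lambda>x. g x - G x) (\<lambda>x. weak_deriv l g x - (- ?S x))"
    unfolding has_weak_deriv_def
  proof
    fix \<phi> assume \<phi>: "\<phi> \<in> Cc1 l"
    note i = L2_mult_integrable[OF _ Cc1_L2(1)[OF \<phi>]] and i' = L2_mult_integrable[OF _ Cc1_L2(2)[OF \<phi>]]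
    have "(\<integral>x. (g x - G x) * deriv \<phi> x \<partial>leb_I l) = (\<integral>x. g x * deriv \<phi> x \<partial>leb_I l) - (\<integral>x. G x * deriv \<phi> x \<partial>leb_I l)"
      using Bochner_Integration.integral_diff[OF i'[OF gL] i'[OF GL]] by (simp add: left_diff_distrib)
    moreover have "(\<integral>x. (weak_deriv l g x - (- ?S x)) * \<phi> x \<partial>leb_I l)
        = (\<integral>x. weak_deriv l g x * \<phi> x \<partial>leb_I l) - (\<integral>x. - ?S x * \<phi> x \<partial>leb_I l)"
      using Bochner_Integration.integral_diff[OF i[OF wg(1)] i[OF wG(1)]] by (simp only: left_diff_distrib)
    moreover have "(\<integral>x. g x * deriv \<phi> x \<partial>leb_I l) = - (\<integral>x. weak_deriv l g x * \<phi> x \<partial>leb_I l)"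
      "(\<integral>x. G x * deriv \<phi> x \<partial>leb_I l) = - (\<integral>x. - ?S x * \<phi> x \<partial>leb_I l)"
      using wg(2) wG(2) \<phi> unfolding has_weak_deriv_def by blast+
    ultimately show "(\<integral>x. (g x - G x) * deriv \<phi> x \<partial>leb_I l)
        = - (\<integral>x. (weak_deriv l g x - (- ?S x)) * \<phi> x \<partial>leb_I l)" by linarith
  qed
  moreover have "AE x in leb_I l. weak_deriv l g x - (- ?S x) = 0" using ae by simp
  ultimately obtain k where "AE x in leb_I l. g x - G x = k"
    by (rule weak_deriv_AE_const[OF l L2_diff[OF gL GL] L2_diff[OF wg(1) wG(1)]]) blast
  then have "AE x in leb_I l. g x = k - integral {-l..x} ?S"
    by eventually_elim (simp add: G_def)
  then show ?thesis using that by blast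
qed

text \<open>\<open>T\<close> is the jump set of \<theta>, with \<open>l\<close> added if the number
  of jumps is odd. In that case the two traces are opposite, and the boundary term of the limit
  energy is exactly the cost of the added jump.\<close>

lemma A_C_structure:
  assumes \<sigma>: "\<sigma> > 0" "D2 > 0" and l: "l > 0"
    and A: "(\<theta>, g) \<in> A_C \<sigma> D2 l" and fin: "total_variation l (Phi \<sigma> D2 \<circ> \<theta>) < \<infinity>"
  obtains T s where "finite T" "T \<subseteq> {-l<..l}" "even (card T)" "s \<in> {- beta \<sigma> D2, beta \<sigma> D2}"
    "AE x in leb_I l. \<theta> x = step_fun s T x"
    "ennreal (card T * Phi \<sigma> D2 (beta \<sigma> D2)) \<le> G0_C \<sigma> D2 l \<theta> g"
proof -
  let ?b = "beta \<sigma> D2" and ?\<Phi> = "Phi \<sigma> D2" and ?u = "Phi \<sigma> D2 \<circ> \<theta>" and ?J = "jumps l \<theta>"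
  have b: "?b > 0" using beta_props[OF \<sigma>] by simp
  note \<Phi> = Phi_beta_pos[OF \<sigma>]
  have two: "AE x in leb_I l. \<theta> x \<in> {- ?b, ?b}" and \<theta>m: "\<theta> \<in> borel_measurable (leb_I l)"
    using A by (auto simp: A_C_def BV_def L1_def)
  have utwo: "AE x in leb_I l. ?u x \<in> {0, ?\<Phi> ?b}"
    using two by eventually_elim (use \<Phi> in auto)
  have um: "?u \<in> borel_measurable (leb_I l)"
  proof (rule measurable_leb_I_AE)
    \<comment> \<open>The affine function that agrees with \<Phi> at \<plusminus>\<beta>;
      measurability of the composition is thus inherited from \<theta>.\<close>
    show "(\<lambda>x. ?\<Phi> ?b / (2 * ?b) * (\<theta> x + ?b)) \<in> borel_measurable (leb_I l)" using \<theta>m by simp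
    show "AE x in leb_I l. ?\<Phi> ?b / (2 * ?b) * (\<theta> x + ?b) = ?u x"
      using two by eventually_elim (use \<Phi> b in auto)
  qed
  note fj = finite_jumps[OF um utwo \<Phi>(1) fin]
  \<comment> \<open>\<Phi> separates the two wells, so where the composition is a.e. constant,
    \<theta> is too.\<close>
  have sub: "?J \<subseteq> jumps l ?u"
  proof
    fix t assume t: "t \<in> ?J"
    have "\<not> (AE x in leb_I l. \<bar>x - t\<bar> < \<delta> \<longrightarrow> ?u x = c)" if "\<delta> > 0" for \<delta> c
    proof
      assume "AE x in leb_I l. \<bar>x - t\<bar> < \<delta> \<longrightarrow> ?u x = c"
      with two have "AE x in leb_I l. \<bar>x - t\<bar> < \<delta> \<longrightarrow> \<theta> x = (if c = 0 then - ?b else ?b)"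
        by eventually_elim (use \<Phi> in auto)
      then show False using t that unfolding jumps_def by blast
    qed
    then show "t \<in> jumps l ?u" using t by (auto simp: jumps_def)
  qed
  have finJ: "finite ?J" using sub fj(1) by (rule finite_subset)
  have J: "?J \<subseteq> {-l<..<l}" by (auto simp: jumps_def)
  then have J': "?J \<subseteq> {-l<..l}" by (rule order_trans) auto
  have "real (card ?J) * ?\<Phi> ?b \<le> real (card (jumps l ?u)) * (?\<Phi> ?b - 0)"
    using card_mono[OF fj(1) sub] \<Phi>(1) by simp
  then have cJ: "ennreal (card ?J * ?\<Phi> ?b) \<le> total_variation l ?u"
    using fj(2) by (meson ennreal_leI order_trans)
  obtain s where s: "s \<in> {- ?b, ?b}" "AE x in leb_I l. \<theta> x = s * (\<Prod>t\<in>?J. sgn (t - x))"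
    by (rule two_valued_structure[OF l b two finJ]) blast
  have ae: "AE x in leb_I l. \<theta> x = step_fun s ?J x" using s(2) by (simp add: step_fun_def)
  have G0: "G0_C \<sigma> D2 l \<theta> g = total_variation l ?u
      + ennreal \<bar>?\<Phi> (trace_right l \<theta>) - ?\<Phi> (trace_left l \<theta>)\<bar>"
    using A by (simp add: G0_C_def)
  show ?thesis
  proof (cases "even (card ?J)")
    case True
    have "ennreal (card ?J * ?\<Phi> ?b) \<le> G0_C \<sigma> D2 l \<theta> g"
      unfolding G0 using cJ by (rule order_trans) simp
    then show ?thesis using that[of ?J s] finJ J' True s(1) ae by blast
  next
    case False
    obtain d where d: "d > 0" "\<And>t. t \<in> ?J \<Longrightarrow> -l + 2 * d < t \<and> t < l - 2 * d"
      by (rule finite_separation[OF finJ J]) blast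
    define d' where "d' = min d (2 * l)"
    have d': "0 < d'" "d' \<le> 2 * l" "d' \<le> d" using d(1) l by (auto simp: d'_def)
    \<comment> \<open>The finitely many jumps keep a distance from \<plusminus>\<open>l\<close>, so
      the step function is constant near both ends: \<open>s\<close> on the left and, after an odd
      number of sign changes, \<open>- s\<close> on the right.\<close>
    have left: "step_fun s ?J x = s" if "x < -l + d'" for x
    proof -
      have "(\<Prod>t\<in>?J. sgn (t - x)) = 1"
      proof (rule prod.neutral, rule ballI)
        fix t assume "t \<in> ?J"
        then show "sgn (t - x) = 1" using d(1) d(2)[of t] that d' by (simp add: sgn_if)
      qed
      then show ?thesis by (simp add: step_fun_def)
    qed
    have right: "step_fun s ?J x = - s" if "l - d' < x" for x
    proof -
      have "(\<Prod>t\<in>?J. sgn (t - x)) = (\<Prod>t\<in>?J. -1)"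
      proof (rule prod.cong)
        fix t assume "t \<in> ?J"
        then show "sgn (t - x) = -1" using d(1) d(2)[of t] that d' by (simp add: sgn_if)
      qed simp
      then show ?thesis using False by (simp add: step_fun_def)
    qed
    have tl: "trace_left l \<theta> = s"
      by (rule trace_eqI(1)[OF l \<theta>m d'(1,2)]) (use ae left in \<open>auto elim: eventually_mono\<close>)
    have tr: "trace_right l \<theta> = - s"
      by (rule trace_eqI(2)[OF l \<theta>m d'(1,2)]) (use ae right in \<open>auto elim: eventually_mono\<close>)
    have jump: "\<bar>?\<Phi> (- s) - ?\<Phi> s\<bar> = ?\<Phi> ?b" using s(1) \<Phi> by auto
    have lJ: "l \<notin> ?J" using J by auto
    have "real (card (insert l ?J)) * ?\<Phi> ?b = real (card ?J) * ?\<Phi> ?b + ?\<Phi> ?b"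
      using finJ lJ by (simp add: algebra_simps)
    also have "ennreal \<dots> = ennreal (real (card ?J) * ?\<Phi> ?b) + ennreal (?\<Phi> ?b)"
      using \<Phi>(1) by (intro ennreal_plus) auto
    finally have "ennreal (real (card (insert l ?J)) * ?\<Phi> ?b) \<le> G0_C \<sigma> D2 l \<theta> g"
      unfolding G0 tl tr jump using cJ by (simp add: add_right_mono)
    \<comment> \<open>The added factor \<open>sgn (l - x)\<close> is 1 inside the interval: the jump
      at \<open>l\<close> changes the parity of \<open>T\<close>, not the function.\<close>
    moreover have "step_fun s (insert l ?J) x = step_fun s ?J x" if "x < l" for x
      using finJ lJ that by (simp add: step_fun_def)
    then have "AE x in leb_I l. \<theta> x = step_fun s (insert l ?J) x"
      using ae space_interval_AE[of "-l" l] by (auto elim: eventually_elim2)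
    ultimately show ?thesis
      using that[of "insert l ?J" s] finJ lJ J' False s(1) l by simp
  qed
qed

theorem lemma3p2:
  fixes \<sigma> D1 D2 l :: real and \<epsilon> :: "nat \<Rightarrow> real" and \<theta> g :: "real \<Rightarrow> real"
  assumes "\<sigma> > 0" "D1 > 0" "D2 > 0" "l > 0"
    and "\<And>j. \<epsilon> j > 0" and "\<epsilon> \<longlonglongrightarrow> 0"
    and "\<theta> \<in> L1 l" and "g \<in> L2 l"
  shows "\<exists>(\<theta>s :: nat \<Rightarrow> real \<Rightarrow> real) (gs :: nat \<Rightarrow> real \<Rightarrow> real).
      (\<forall>j. (\<theta>s j, gs j) \<in> Y_C l)
    \<and> (\<lambda>j. norm_L1 l (\<lambda>x. \<theta>s j x - \<theta> x)) \<longlonglongrightarrow> 0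
    \<and> (\<lambda>j. norm_L2 l (\<lambda>x. gs j x - g x)) \<longlonglongrightarrow> 0
    \<and> limsup (\<lambda>j. G_C \<sigma> D1 D2 l (\<epsilon> j) (\<theta>s j) (gs j)) \<le> G0_C \<sigma> D2 l \<theta> g"
proof (cases "G0_C \<sigma> D2 l \<theta> g = \<infinity>")
  case True
  obtain \<theta>s gs :: "nat \<Rightarrow> real \<Rightarrow> real" where "\<And>j. (\<theta>s j, gs j) \<in> Y_C l"
    "(\<lambda>j. norm_L1 l (\<lambda>x. \<theta>s j x - \<theta> x)) \<longlonglongrightarrow> 0"
    "(\<lambda>j. norm_L2 l (\<lambda>x. gs j x - g x)) \<longlonglongrightarrow> 0"
    using density_Y_C[OF assms(4,7,8)] by blast
  then show ?thesis using True by (intro exI[of _ \<theta>s] exI[of _ gs]) simp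
next
  case False
  note \<sigma> = \<open>\<sigma> > 0\<close> \<open>D2 > 0\<close> and l = \<open>l > 0\<close>
  let ?b = "beta \<sigma> D2" and ?\<Phi> = "Phi \<sigma> D2 (beta \<sigma> D2)"
  have A: "(\<theta>, g) \<in> A_C \<sigma> D2 l" using False by (auto simp: G0_C_def split: if_splits)
  have tv: "total_variation l (Phi \<sigma> D2 \<circ> \<theta>) < \<infinity>"
    using False A by (auto simp: G0_C_def top.not_eq_extremum)
  obtain T s where T: "finite T" "T \<subseteq> {-l<..l}" "even (card T)" and s: "s \<in> {- ?b, ?b}"
    and ae: "AE x in leb_I l. \<theta> x = step_fun s T x"
    and G0: "ennreal (card T * ?\<Phi>) \<le> G0_C \<sigma> D2 l \<theta> g"
    by (rule A_C_structure[OF \<sigma> l A tv]) blast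
  have \<theta>m: "\<theta> \<in> borel_measurable (leb_I l)" and \<theta>0: "(\<integral>x. \<theta> x \<partial>leb_I l) = 0" and gW: "g \<in> W12 l"
    and gm: "g \<in> borel_measurable (leb_I l)"
    and gs: "AE x in leb_I l. weak_deriv l g x + sin (\<theta> x) = 0"
    using A \<open>g \<in> L2 l\<close> \<open>\<theta> \<in> L1 l\<close> by (auto simp: A_C_def L2_def L1_def)
  have "AE x in leb_I l. weak_deriv l g x + sin (step_fun s T x) = 0"
    using ae gs by eventually_elim simp
  then obtain k where k: "AE x in leb_I l. g x = k - integral {-l..x} (\<lambda>y. sin (step_fun s T y))"
    by (rule W12_primitive_step[OF l gW T(1)]) blast
  \<comment> \<open>\<open>T\<close> may contain \<open>l\<close>, while
    \<open>finite_separation\<close> wants an open interval. Room is required only between the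
    points and to the right of \<open>-l\<close>, so the right end is moved to
    \<open>l + 1\<close>.\<close>
  have "T \<subseteq> {-l<..<l+1}" using T(2) by auto
  then obtain d where d: "d > 0" "\<And>t. t \<in> T \<Longrightarrow> -l + 2 * d < t \<and> t < l + 1 - 2 * d"
    "\<And>t t'. t \<in> T \<Longrightarrow> t' \<in> T \<Longrightarrow> t < t' \<Longrightarrow> t + 2 * d < t'"
    by (rule finite_separation[OF T(1)]) blast
  \<comment> \<open>\<open>K * r^3\<close> is the bound \<open>R\<close> of
    \<open>recovery_pair\<close>, and \<open>E r\<close> its energy bound.\<close>
  define K where "K = card T * (2 * ?b * (2 * ?b))"
  define E where "E r = (5 * D2 + 1) * (K * r^3 / (2 * l))^2 / r^4 * (2 * l)
      + card T * (?\<Phi> + 4 * ?b * r)" for r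
  define r where "r j = sqrt (sqrt (\<epsilon> j))" for j
  have r: "r j > 0" "(r j)^4 = \<epsilon> j" for j
  proof -
    have e: "\<epsilon> j > 0" by fact
    then show "r j > 0" by (simp add: r_def)
    have "(r j)^4 = ((r j)^2)^2" by (simp flip: power_mult)
    then show "(r j)^4 = \<epsilon> j" using e by (simp add: r_def)
  qed
  have r0: "r \<longlonglongrightarrow> 0"
    unfolding r_def using tendsto_real_sqrt[OF tendsto_real_sqrt[OF \<open>\<epsilon> \<longlonglongrightarrow> 0\<close>]] by simp
  \<comment> \<open>Only then are the layers short enough to be disjoint and inside the interval.
    This holds for all large \<open>j\<close>; for the remaining ones the zero pair serves as a
    default member of \<open>Y_C\<close>.\<close>
  define good where "good j \<longleftrightarrow> 2 * ?b * (r j)^3 \<le> d" for j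
  define P where "P j f \<gamma> \<longleftrightarrow> norm_L1 l (\<lambda>x. f x - \<theta> x) \<le> K * (r j)^3
      \<and> norm_L2 l (\<lambda>x. \<gamma> x - g x) \<le> 2 * (K * (r j)^3) * sqrt (2 * l)
      \<and> F_C \<sigma> D1 D2 l (\<epsilon> j) f \<gamma> \<le> ennreal (E (r j))" for j f \<gamma>
  have ex: "\<exists>f \<gamma>. (f, \<gamma>) \<in> Y_C l \<and> (good j \<longrightarrow> P j f \<gamma>)" for j
  proof (cases "good j")
    case True
    have "\<exists>f \<gamma>. (f, \<gamma>) \<in> Y_C l
      \<and> norm_L1 l (\<lambda>x. f x - \<theta> x) \<le> card T * (2 * ?b * (2 * ?b * (r j)^3))
      \<and> norm_L2 l (\<lambda>x. \<gamma> x - g x) \<le> 2 * (card T * (2 * ?b * (2 * ?b * (r j)^3))) * sqrt (2 * l)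
      \<and> F_C \<sigma> D1 D2 l ((r j)^4) f \<gamma> \<le> ennreal ((5 * D2 + 1)
          * (card T * (2 * ?b * (2 * ?b * (r j)^3)) / (2 * l))^2 / (r j)^4 * (2 * l)
        + card T * (?\<Phi> + 4 * ?b * r j))"
    proof (rule recovery_pair[OF \<sigma> l r(1) T s])
      show "-l + d < t" if "t \<in> T" for t using d(1) d(2)[OF that] by linarith
      show "t + d < t'" if "t \<in> T" "t' \<in> T" "t < t'" for t t' using d(1) d(3)[OF that] by linarith
      show "2 * ?b * (r j)^3 \<le> d" using True by (simp add: good_def)
    qed (fact \<theta>m ae \<theta>0 k gm)+
    moreover have KK: "card T * (2 * ?b * (2 * ?b * (r j)^3)) = K * (r j)^3" by (simp add: K_def)
    ultimately show ?thesis unfolding P_def E_def KK r(2) by blast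
  next
    case False
    have "((\<lambda>_. 0), (\<lambda>_. 0)) \<in> Y_C l"
      by (rule polynomial_Y_C[OF l real_polynomial_function.intros(2) real_polynomial_function.intros(2)])
        (auto dest: DERIV_unique[OF DERIV_const])
    then show ?thesis using False by blast
  qed
  have "\<forall>j. \<exists>f \<gamma>. (f, \<gamma>) \<in> Y_C l \<and> (good j \<longrightarrow> P j f \<gamma>)" using ex by blast
  from choice[OF this] obtain \<theta>s where
    "\<forall>j. \<exists>\<gamma>. (\<theta>s j, \<gamma>) \<in> Y_C l \<and> (good j \<longrightarrow> P j (\<theta>s j) \<gamma>)" by blast
  from choice[OF this] obtain gs where
    Y: "\<forall>j. (\<theta>s j, gs j) \<in> Y_C l \<and> (good j \<longrightarrow> P j (\<theta>s j) (gs j))" by blast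
  have lim3: "(\<lambda>j. c * (r j)^3) \<longlonglongrightarrow> 0" for c
    using tendsto_mult[OF tendsto_const[of c] tendsto_power[OF r0, of 3]] by simp
  have "\<forall>\<^sub>F j in sequentially. 2 * ?b * (r j)^3 < d"
    by (rule order_tendstoD(2)[OF lim3]) (rule d(1))
  then have evP: "\<forall>\<^sub>F j in sequentially. P j (\<theta>s j) (gs j)"
    by eventually_elim (use Y in \<open>auto simp: good_def\<close>)
  have 1: "(\<lambda>j. norm_L1 l (\<lambda>x. \<theta>s j x - \<theta> x)) \<longlonglongrightarrow> 0"
  proof (rule tendsto_sandwich[OF _ _ tendsto_const lim3])
    show "\<forall>\<^sub>F j in sequentially. norm_L1 l (\<lambda>x. \<theta>s j x - \<theta> x) \<le> K * (r j)^3"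
      using evP by eventually_elim (simp add: P_def)
  qed (auto simp: norm_L1_def)
  have 2: "(\<lambda>j. norm_L2 l (\<lambda>x. gs j x - g x)) \<longlonglongrightarrow> 0"
  proof (rule tendsto_sandwich[OF _ _ tendsto_const lim3])
    show "\<forall>\<^sub>F j in sequentially. norm_L2 l (\<lambda>x. gs j x - g x) \<le> 2 * K * sqrt (2 * l) * (r j)^3"
      using evP by eventually_elim (simp add: P_def algebra_simps)
  qed (auto simp: norm_L2_def)
  \<comment> \<open>The square of \<open>r^3\<close> divided by \<open>r^4\<close> leaves
    \<open>r^2\<close>, so only the cost of the jumps survives in the limit.\<close>
  have E_eq: "E (r j) = (5 * D2 + 1) * (K / (2 * l))^2 * (2 * l) * (r j)^2 + card T * (?\<Phi> + 4 * ?b * r j)" for j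
  proof -
    have "(K * (r j)^3 / (2 * l))^2 = (K / (2 * l))^2 * (r j)^2 * (r j)^4"
      by (simp add: power_divide power_mult_distrib flip: power_mult power_add)
    then have "(K * (r j)^3 / (2 * l))^2 / (r j)^4 = (K / (2 * l))^2 * (r j)^2"
      using r(1)[of j] by simp
    then show ?thesis unfolding E_def by (simp add: mult.assoc mult.left_commute mult.commute flip: times_divide_eq_right)
  qed
  have "(\<lambda>j. E (r j)) \<longlonglongrightarrow> (5 * D2 + 1) * (K / (2 * l))^2 * (2 * l) * 0^2 + card T * (?\<Phi> + 4 * ?b * 0)"
    unfolding E_eq by (intro tendsto_intros r0)
  then have "(\<lambda>j. E (r j)) \<longlonglongrightarrow> card T * ?\<Phi>" by simp
  then have limE: "(\<lambda>j. ennreal (E (r j))) \<longlonglongrightarrow> ennreal (card T * ?\<Phi>)" by (rule tendsto_ennrealI)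
  have "limsup (\<lambda>j. G_C \<sigma> D1 D2 l (\<epsilon> j) (\<theta>s j) (gs j)) \<le> limsup (\<lambda>j. ennreal (E (r j)))"
    using evP Y by (intro Limsup_mono) (auto simp: G_C_def P_def elim: eventually_mono)
  also have "\<dots> = ennreal (card T * ?\<Phi>)" using limE by (intro lim_imp_Limsup) auto
  also have "\<dots> \<le> G0_C \<sigma> D2 l \<theta> g" by (rule G0)
  finally show ?thesis using Y 1 2 by blast
qed

end
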